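(* Let $\mathcal{K}$ be a $q$-arc contained in a normal rational curve of $H_\infty=\mathrm{PG}(n,q)$. The automorphism group $\mathrm{Aut}(\Lambda_{n,q})$ of the graph $\Lambda_{n,q}$ is isomorphic to the edge-transitive group $\mathrm{P\Gamma L}(n+2,q)_{\mathcal{K}}$. Moreover: - if $q\geq n+3$, $q=p^h$, $p$ prime, $n\geq 3$ or $n=2$ and $q$ odd, then $\mathrm{Aut}(\Lambda_{n,q})$ has size $hq^{n+2}(q-1)^2$; - if $q=p=n+2$, then $\mathrm{Aut}(\Lambda_{n,q})$ has size $q^{n+1}(q-1)\,q!$.
   Context: Here $q=p^h$ is a prime power ($p$ prime). The graph $\Lambda_{n,q}$ is the bipartite graph whose vertex classes are two disjoint copies $\mathcal{P}_n$ and $\mathcal{L}_n$ of the $(n+1)$-dimensional vector space over $\mathbb{F}_q$, where $(p_1,\ldots,p_{n+1})\in\mathcal{P}_n$ is adjacent to $[l_1,\ldots,l_{n+1}]\in\mathcal{L}_n$ if and only if $l_{i+1}+p_{i+1}=p_1l_i$ for all $1\le i\le n$. A $k$-arc in $\mathrm{PG}(n,q)$ is a set of $k\ge n+1$ points such that no $n+1$ of them lie in a hyperplane. A normal rational curve in $\mathrm{PG}(n,q)$, $2\le n\le q$, is a $(q+1)$-arc projectively equivalent to $\{(0,\ldots,0,1)\}\cup\{(1,t,t^2,\ldots,t^n)\mid t\in\mathbb{F}_q\}$. The space $H_\infty=\mathrm{PG}(n,q)$ is embedded as a hyperplane in $\mathrm{PG}(n+1,q)$, and $\mathrm{P\Gamma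 L}(n+2,q)_{\mathcal{K}}$ is the setwise stabiliser of $\mathcal{K}$ in the collineation group of $\mathrm{PG}(n+1,q)$. The graph $\Lambda_{n,q}$ is isomorphic to the bipartite incidence graph $\Gamma_{n,q}(\mathcal{K})$ between the points of $\mathrm{PG}(n+1,q)\setminus H_\infty$ and the lines of $\mathrm{PG}(n+1,q)$ not contained in $H_\infty$ and passing through a point of $\mathcal{K}$; the group $\mathrm{P\Gamma L}(n+2,q)_{\mathcal{K}}$ acts naturally on this graph, and "edge-transitive" refers to this action.
   Formalization: The isomorphism is stated only for q≥n+3 (n≥3, or n=2 and q odd), for q=p=n+2, and for (n,q)=(2,3); for all other pairs with n≥2, q≥n+1 (n=2 with q even; q=n+1≥4; q=n+2 not prime) it is false, as Aut is strictly larger. Edge-transitivity is unrestricted. *)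

theory Defs
  imports
    "HOL-Analysis.Cartesian_Space"
    "HOL-Algebra.Group_Action"
    "HOL-Computational_Algebra.Primes"
begin

text \<open>A simple graph is a pair of a vertex set and a set of edges (two-element sets of vertices).\<close>

type_synonym 'v sgraph = "'v set \<times> 'v set set"

definition graph_Aut :: "'v sgraph \<Rightarrow> ('v \<Rightarrow> 'v) monoid" where
  "graph_Aut G = (BijGroup (fst G))
     \<lparr>carrier := {f \<in> Bij (fst G). \<forall>u \<in> fst G. \<forall>v \<in> fst G. {f u, f v} \<in> snd G \<longleftrightarrow> {u, v} \<in> snd G}\<rparr>"

text \<open>
  The vector space of dimension \<open>n + 1\<close> is the set of functions on \<open>{1..n+1}\<close>; its two disjoint
  copies are tagged by \<open>Inl\<close> (the points \<open>p\<close>) and \<open>Inr\<close> (the lines \<open>l\<close>).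
\<close>

definition coord_space :: "nat \<Rightarrow> (nat \<Rightarrow> 'a::field) set" where
  "coord_space n = {1..n+1} \<rightarrow>\<^sub>E UNIV"

definition Lambda_graph :: "nat \<Rightarrow> ((nat \<Rightarrow> 'a::field) + (nat \<Rightarrow> 'a)) sgraph" where
  "Lambda_graph n =
     (Inl ` coord_space n \<union> Inr ` coord_space n,
      {{Inl p, Inr l} | p l. p \<in> coord_space n \<and> l \<in> coord_space n \<and>
         (\<forall>i \<in> {1..n}. l (i+1) + p (i+1) = p 1 * l i)})"

text \<open>
  The projective space of \<open>'a ^ 'm\<close>, of projective dimension \<open>CARD('m) - 1\<close>. A point is a
  one-dimensional linear subspace; a flat of projective dimension \<open>k\<close> is the set of points
  contained in a linear subspace of dimension \<open>k + 1\<close>.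
\<close>

definition pg_points :: "('a::field ^ 'm::finite) set set" where
  "pg_points = {P. vec.subspace P \<and> vec.dim P = 1}"

definition pg_flat :: "('a::field ^ 'm::finite) set \<Rightarrow> ('a ^ 'm) set set" where
  "pg_flat W = {P \<in> pg_points. P \<subseteq> W}"

definition pg_flats :: "nat \<Rightarrow> ('a::field ^ 'm::finite) set set set" where
  "pg_flats k = {pg_flat W | W. vec.subspace W \<and> vec.dim W = k + 1}"

text \<open>
  \<open>H\<close> is a flat of projective dimension \<open>n\<close>, so the hyperplanes of \<open>H\<close> are the flats of
  dimension \<open>n - 1\<close> contained in it.
\<close>

definition is_arc :: "nat \<Rightarrow> ('a::field ^ 'm::finite) set set \<Rightarrow> nat \<Rightarrow> ('a ^ 'm) set set \<Rightarrow> bool" where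
  "is_arc n H k K \<longleftrightarrow>
     K \<subseteq> H \<and> finite K \<and> card K = k \<and> n + 1 \<le> k \<and>
     (\<forall>S \<subseteq> K. card S = n + 1 \<longrightarrow> \<not> (\<exists>U \<in> pg_flats (n - 1). U \<subseteq> H \<and> S \<subseteq> U))"

text \<open>
  Projective equivalence to the standard curve: a basis \<open>b 0, \<dots>, b n\<close> of the linear subspace
  underlying \<open>H\<close> identifies \<open>H\<close> with coordinates \<open>(x\<^sub>0, \<dots>, x\<^sub>n)\<close>, and \<open>C\<close> is the image of the
  standard curve under that identification.
\<close>

definition is_normal_rational_curve ::
  "nat \<Rightarrow> ('a::{field,finite} ^ 'm::finite) set set \<Rightarrow> ('a ^ 'm) set set \<Rightarrow> bool" where
  "is_normal_rational_curve n H C \<longleftrightarrow>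
     2 \<le> n \<and> n \<le> CARD('a) \<and>
     (\<exists>b :: nat \<Rightarrow> 'a ^ 'm.
        inj_on b {0..n} \<and> vec.independent (b ` {0..n}) \<and>
        H = pg_flat (vec.span (b ` {0..n})) \<and>
        C = insert (vec.span {b n}) {vec.span {\<Sum>i=0..n. t ^ i *s b i} | t. t \<in> UNIV})"

definition field_automorphism :: "('a::field \<Rightarrow> 'a) \<Rightarrow> bool" where
  "field_automorphism \<sigma> \<longleftrightarrow>
     bij \<sigma> \<and> (\<forall>x y. \<sigma> (x + y) = \<sigma> x + \<sigma> y) \<and> (\<forall>x y. \<sigma> (x * y) = \<sigma> x * \<sigma> y)"

definition semilinear_bij :: "('a::field ^ 'm::finite \<Rightarrow> 'a ^ 'm) \<Rightarrow> bool" where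
  "semilinear_bij f \<longleftrightarrow>
     bij f \<and> (\<forall>x y. f (x + y) = f x + f y) \<and>
     (\<exists>\<sigma>. field_automorphism \<sigma> \<and> (\<forall>c x. f (c *s x) = \<sigma> c *s f x))"

text \<open>
  The collineation group, as the group of permutations of the point set induced by the invertible
  semilinear maps. Maps differing by a scalar induce the same permutation.
\<close>

definition PGammaL :: "(('a::field ^ 'm::finite) set \<Rightarrow> ('a ^ 'm) set) monoid" where
  "PGammaL = (BijGroup pg_points)
     \<lparr>carrier := {restrict (image f) pg_points | f. semilinear_bij f}\<rparr>"

definition PGammaL_stab ::
  "('a::field ^ 'm::finite) set set \<Rightarrow> (('a ^ 'm) set \<Rightarrow> ('a ^ 'm) set) monoid" where
  "PGammaL_stab K = PGammaL\<lparr>carrier := {g \<in> carrier PGammaL. g ` K = K}\<rparr>"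

definition affine_points :: "('a::field ^ 'm::finite) set set \<Rightarrow> ('a ^ 'm) set set" where
  "affine_points H = pg_points - H"

definition affine_lines ::
  "('a::field ^ 'm::finite) set set \<Rightarrow> ('a ^ 'm) set set \<Rightarrow> ('a ^ 'm) set set set" where
  "affine_lines H K = {L \<in> pg_flats 1. \<not> L \<subseteq> H \<and> L \<inter> K \<noteq> {}}"

definition Gamma_graph ::
  "('a::field ^ 'm::finite) set set \<Rightarrow> ('a ^ 'm) set set \<Rightarrow> (('a ^ 'm) set + ('a ^ 'm) set set) sgraph" where
  "Gamma_graph H K =
     (Inl ` affine_points H \<union> Inr ` affine_lines H K,
      {{Inl P, Inr L} | P L. P \<in> affine_points H \<and> L \<in> affine_lines H K \<and> P \<in> L})"

text \<open>The natural action on vertices: a collineation moves points, and lines as sets of points.\<close>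

definition vertex_action ::
  "('a::field ^ 'm::finite) set set \<Rightarrow> ('a ^ 'm) set set \<Rightarrow> (('a ^ 'm) set \<Rightarrow> ('a ^ 'm) set)
     \<Rightarrow> ('a ^ 'm) set + ('a ^ 'm) set set \<Rightarrow> ('a ^ 'm) set + ('a ^ 'm) set set" where
  "vertex_action H K g = restrict (map_sum g (image g)) (fst (Gamma_graph H K))"

definition edge_action ::
  "('a::field ^ 'm::finite) set set \<Rightarrow> ('a ^ 'm) set set \<Rightarrow> (('a ^ 'm) set \<Rightarrow> ('a ^ 'm) set)
     \<Rightarrow> (('a ^ 'm) set + ('a ^ 'm) set set) set \<Rightarrow> (('a ^ 'm) set + ('a ^ 'm) set set) set" where
  "edge_action H K g = restrict (image (vertex_action H K g)) (snd (Gamma_graph H K))"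

text \<open>
  The stabiliser acts on the vertices, the induced map on edges is again an action (so each element
  is a graph automorphism), and this action on edges is transitive.
\<close>

definition edge_transitive_PGammaL_stab ::
  "('a::field ^ 'm::finite) set set \<Rightarrow> ('a ^ 'm) set set \<Rightarrow> bool" where
  "edge_transitive_PGammaL_stab H K \<longleftrightarrow>
     group_action (PGammaL_stab K) (fst (Gamma_graph H K)) (vertex_action H K) \<and>
     transitive_action (PGammaL_stab K) (snd (Gamma_graph H K)) (edge_action H K)"

end

theory Submission
  imports
    Defs
    "HOL-Number_Theory.Residues"
    "HOL-Computational_Algebra.Polynomial"
    "HOL-Combinatorics.Permutations"
    "HOL-Library.Disjoint_Sets"
    "HOL-Library.Z2"
begin

text \<open>
  After a reparametrisation the arc consists of the points \<open>v t = (1, t, \<dots>,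
  t\<^sup>n)\<close>, and both graphs are the incidence graph between the points of the affine space
  \<open>W\<close> spanned by the vectors \<open>v t\<close> and the lines with directions
  \<open>v t\<close>. An automorphism cannot exchange points and lines: otherwise, for some vector
  outside the span of every single \<open>v t\<close>, each \<open>v t\<close> would span with a
  second direction a plane containing it. Two disjoint lines with a transversal are parallel if and
  only if every point of one of them is on a transversal, so an automorphism preserves parallelism.
  Since any three directions are independent, it is then additive up to a translation, and the linear
  relations between \<open>n + 2\<close> of the \<open>v t\<close>, whose coefficients are the
  weights of divided differences, show that it multiplies by cross-ratios in a compatible way. Hence
  it is semilinear, and the induced permutation of the parameters is \<open>t \<mapsto> \<alpha>
  \<sigma>(t) + \<beta>\<close> as soon as \<open>q \<ge> n + 3\<close>; for \<open>q = n +
  2\<close> all weights are equal and every permutation occurs.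
\<close>

section \<open>Automorphisms of finite fields\<close>

text \<open>The bounds on \<open>q\<close> count free parameters. Exchanging one node of a set of
  \<open>n + 2\<close> parameters for another multiplies the quotient of the weights at two
  remaining nodes by a cross-ratio, which takes \<open>n + 3\<close> parameters in all. For
  \<open>q = n + 2\<close> no exchange is possible and primality replaces it: an additive map of a
  prime field is linear. For \<open>q = n + 1 = 3\<close> there is no relation between the
  directions at all, and even additivity along a single line has to come from the small size of the
  field. Oddness of \<open>q\<close> for \<open>n = 2\<close> enters where points and lines are kept
  apart: in characteristic 2 with \<open>n = 2\<close> the vector \<open>v (t + c) - v t\<close> is
  the same for all \<open>t\<close>, so vectors of the kind to be excluded do exist. The group is
  counted through unique representatives. In the affine chart of the vectors \<open>e + w\<close>
  with \<open>w\<close> in \<open>W\<close>, and for \<open>q \<ge> n + 2\<close>, a collineation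
  stabilising the arc is given by a translation, a scalar, a field automorphism and a permutation of
  the parameters.\<close>

lemma finite_field_mult_group:
  "\<exists>g :: 'a::{field,finite}. g \<noteq> 0 \<and> (\<forall>x. x \<noteq> 0 \<longrightarrow> (\<exists>i. x = g ^ i))"
  "(x :: 'a) \<noteq> 0 \<Longrightarrow> x ^ (CARD('a) - 1) = 1"
proof -
  \<comment> \<open>Cyclicity of the multiplicative group and the order of its elements are theorems
    about ring records, so the field type is turned into such a record.\<close>
  define R where "R = \<lparr>carrier = (UNIV :: 'a set), monoid.mult = ((*) :: 'a \<Rightarrow> 'a \<Rightarrow> 'a), one = 1, zero = (0 :: 'a), add = (+)\<rparr>"
  have "\<exists>y. y * x = 1" if "x \<noteq> 0" for x :: 'a
    using that by (intro exI[of _ "inverse x"]) simp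
  moreover have "\<exists>y. y + x = 0" for x :: 'a
    by (intro exI[of _ "- x"]) simp
  ultimately interpret F: Ring.field R
    by unfold_locales (auto simp: R_def Units_def algebra_simps)
  have pow: "x [^]\<^bsub>R\<^esub> i = x ^ i" for x :: 'a and i :: nat
    by (induct i) (simp_all add: R_def nat_pow_def mult.commute)
  have "finite (carrier R)"
    by (simp add: R_def)
  from F.finite_field_mult_group_has_gen[OF this]
  show "\<exists>g :: 'a. g \<noteq> 0 \<and> (\<forall>x. x \<noteq> 0 \<longrightarrow> (\<exists>i. x = g ^ i))"
    by (auto simp: pow nat_pow_mult_of) (auto simp: R_def set_eq_iff)
  assume "x \<noteq> 0"
  hence "x [^]\<^bsub>mult_of R\<^esub> Coset.order (mult_of R) = \<one>\<^bsub>mult_of R\<^esub>"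
    by (intro group.pow_order_eq_1[OF F.field_mult_group]) (simp_all add: R_def)
  thus "x ^ (CARD('a) - 1) = 1"
    by (simp add: nat_pow_mult_of pow Coset.order_def) (simp add: R_def card_Diff_subset)
qed

lemma finite_field_pow_card:
  fixes x :: "'a::{field,finite}"
  shows "x ^ CARD('a) = x"
proof (cases "x = 0")
  case False
  have "x ^ CARD('a) = x * x ^ (CARD('a) - 1)"
    by (simp add: power_eq_if)
  thus ?thesis using finite_field_mult_group(2)[OF False] by simp
qed (simp add: zero_less_card_finite)

lemma CHAR_eq_prime:
  assumes "prime p" "CARD('a::{field,finite}) = p ^ h"
  shows "CHAR('a) = p"
proof -
  have "CHAR('a) > 0"
    by (rule finite_imp_CHAR_pos) simp
  hence "prime CHAR('a)"
    using prime_CHAR_semidom by blast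
  moreover have "CHAR('a) dvd p ^ h"
    using CHAR_dvd_CARD[where 'a='a] assms by simp
  ultimately show ?thesis
    using assms prime_dvd_power primes_dvd_imp_eq by blast
qed

lemma field_automorphism_simps:
  assumes "field_automorphism \<sigma>"
  shows "\<sigma> 0 = 0" "\<sigma> 1 = 1" "\<sigma> (x + y) = \<sigma> x + \<sigma> y" "\<sigma> (x * y) = \<sigma> x * \<sigma> y" "\<sigma> (- x) = - \<sigma> x"
    "\<sigma> (x - y) = \<sigma> x - \<sigma> y" "\<sigma> x = \<sigma> y \<longleftrightarrow> x = y" "\<sigma> x = 0 \<longleftrightarrow> x = 0"
    "\<sigma> (inverse x) = inverse (\<sigma> x)" "\<sigma> (x / y) = \<sigma> x / \<sigma> y"
    "\<sigma> (x ^ i) = \<sigma> x ^ i" "\<sigma> (of_nat i) = of_nat i"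
    "\<sigma> (prod f A) = (\<Prod>a\<in>A. \<sigma> (f a))" "\<sigma> (sum g B) = (\<Sum>a\<in>B. \<sigma> (g a))"
proof -
  have add: "\<sigma> (x + y) = \<sigma> x + \<sigma> y" and mult: "\<sigma> (x * y) = \<sigma> x * \<sigma> y" for x y
    using assms by (auto simp: field_automorphism_def)
  have inj: "\<sigma> x = \<sigma> y \<longleftrightarrow> x = y" for x y
    using assms by (auto simp: field_automorphism_def bij_def inj_def)
  have z: "\<sigma> 0 = 0" using add[of 0 0] by (metis add_cancel_right_left add_0)
  have "\<sigma> 1 * \<sigma> 1 = \<sigma> 1" "\<sigma> 1 \<noteq> 0" using mult[of 1 1] inj[of 1 0] z by simp_all
  hence one: "\<sigma> 1 = 1" by simp
  have neg: "\<sigma> (- x) = - \<sigma> x" for x using add[of x "-x"] z by (simp add: eq_neg_iff_add_eq_0 add.commute)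
  have inv: "\<sigma> (inverse x) = inverse (\<sigma> x)" for x
    using mult[of x "inverse x"] z one by (cases "x = 0") (auto simp: inverse_unique)
  show "\<sigma> 0 = 0" "\<sigma> 1 = 1" "\<sigma> (x + y) = \<sigma> x + \<sigma> y" "\<sigma> (x * y) = \<sigma> x * \<sigma> y" "\<sigma> (- x) = - \<sigma> x"
    "\<sigma> x = \<sigma> y \<longleftrightarrow> x = y" "\<sigma> (inverse x) = inverse (\<sigma> x)"
    by (fact z one add mult neg inj inv)+
  show "\<sigma> (x - y) = \<sigma> x - \<sigma> y" using add[of x "-y"] neg by simp
  show "\<sigma> x = 0 \<longleftrightarrow> x = 0" using inj z by metis
  show "\<sigma> (x / y) = \<sigma> x / \<sigma> y" by (simp add: divide_inverse mult inv)
  show "\<sigma> (x ^ i) = \<sigma> x ^ i" by (induct i) (simp_all add: one mult)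
  show "\<sigma> (of_nat i) = of_nat i" by (induct i) (simp_all add: z one add)
  show "\<sigma> (prod f A) = (\<Prod>a\<in>A. \<sigma> (f a))"
    by (induct A rule: infinite_finite_induct) (simp_all add: one mult)
  show "\<sigma> (sum g B) = (\<Sum>a\<in>B. \<sigma> (g a))"
    by (induct B rule: infinite_finite_induct) (simp_all add: z add)
qed

lemma card_power_fixed_le:
  assumes "1 < m"
  shows "card {x :: 'a::field. x ^ m = x} \<le> m"
proof -
  let ?P = "monom 1 m - [:0, 1:] :: 'a poly"
  have "coeff ?P m = 1"
    using assms by (simp add: coeff_pCons split: nat.split)
  hence nz: "?P \<noteq> 0" by (metis coeff_0 zero_neq_one)
  have "degree ?P \<le> m"
    using assms by (intro degree_diff_le) (auto simp: degree_monom_le)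
  hence "card {x. poly ?P x = 0} \<le> m"
    using card_poly_roots_bound[OF nz] by linarith
  thus ?thesis by (simp add: poly_monom)
qed

text \<open>The polynomial \<open>X ^ p - X\<close> has at most \<open>p\<close> roots, and by the
  freshman's dream the images of the \<open>p\<close> natural numbers below \<open>p\<close> are
  already that many.\<close>

lemma prime_field_eq_range_of_nat:
  fixes x :: "'a::{field,finite}"
  assumes "x ^ CHAR('a) = x"
  shows "x \<in> range of_nat"
proof -
  let ?p = "CHAR('a)"
  have "?p > 0"
    by (rule finite_imp_CHAR_pos) simp
  hence pr: "prime ?p"
    using prime_CHAR_semidom by blast
  hence p2: "?p > 1"
    using prime_gt_1_nat by blast
  have "card {x :: 'a. x ^ ?p = x} \<le> ?p"
    by (rule card_power_fixed_le[OF p2])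
  moreover have "of_nat k ^ ?p = (of_nat k :: 'a)" for k
  proof (induct k)
    case (Suc k)
    thus ?case using freshmans_dream[OF pr refl, of "of_nat k" 1] by (simp add: add.commute)
  qed (use p2 in simp)
  hence sub: "of_nat ` {..<?p} \<subseteq> {x :: 'a. x ^ ?p = x}" by auto
  moreover have inj: "inj_on (of_nat :: nat \<Rightarrow> 'a) {..<?p}"
    by (auto simp: inj_on_def of_nat_eq_iff_cong_CHAR cong_def)
  hence "card (of_nat ` {..<?p} :: 'a set) = ?p"
    by (simp add: card_image)
  ultimately have "of_nat ` {..<?p} = {x :: 'a. x ^ ?p = x}"
    by (intro card_seteq) auto
  with assms show ?thesis by blast
qed

text \<open>One polynomial replaces Galois theory: the product of \<open>X - F i g\<close> over the
  Frobenius conjugates of a generator \<open>g\<close> has coefficients in the prime field, so every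
  automorphism sends \<open>g\<close> to one of these conjugates and agrees with that Frobenius
  power on all powers of \<open>g\<close>.\<close>

lemma card_field_automorphisms:
  assumes p: "prime p" and q: "CARD('a::{field,finite}) = p ^ h" and h: "1 \<le> h"
  shows "card {\<sigma> :: 'a \<Rightarrow> 'a. field_automorphism \<sigma>} = h"
proof -
  obtain g :: 'a where g0: "g \<noteq> 0" and g: "\<And>x. x \<noteq> 0 \<Longrightarrow> \<exists>i. x = g ^ i"
    using finite_field_mult_group(1) by blast
  have char: "CHAR('a) = p"
    by (rule CHAR_eq_prime[OF p q])
  define F where "F = (\<lambda>i (x::'a). x ^ (p ^ i))"
  have F_add: "F i (x + y) = F i x + F i y" for i x y
    unfolding F_def using p char by (intro freshmans_dream') auto
  have F_inj: "inj (F i)" for i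
  proof (rule injI)
    fix x y assume "F i x = F i y"
    hence "F i (x - y) = 0" using F_add[of i "x - y" y] by simp
    thus "x = y" by (simp add: F_def)
  qed
  have F_aut: "field_automorphism (F i)" for i
    unfolding field_automorphism_def
    using F_inj F_add finite_UNIV_inj_surj[of "F i"] by (auto simp: bij_def F_def power_mult_distrib)
  have F_h: "F h x = x" for x
    unfolding F_def using finite_field_pow_card[of x] q by simp
  have inj: "inj_on F {..<h}"
  proof (rule linorder_inj_onI')
    fix i j assume ij: "i \<in> {..<h}" "j \<in> {..<h}" "i < j"
    show "F i \<noteq> F j"
    proof
      assume eq: "F i = F j"
      \<comment> \<open>Two equal Frobenius powers would give \<open>q\<close> roots to a polynomial
        of degree \<open>p ^ (j - i) < q\<close>.\<close>
      have "F (j - i) x = x" for x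
      proof -
        have "F i (F (j - i) x) = F j x"
          using ij by (simp add: F_def power_mult[symmetric] power_add[symmetric])
        with eq show ?thesis using F_inj[of i] by (auto dest: injD)
      qed
      hence "{x::'a. x ^ (p ^ (j - i)) = x} = UNIV"
        by (auto simp: F_def)
      moreover have "1 < p ^ (j - i)"
        using ij prime_gt_1_nat[OF p] by (intro one_less_power) auto
      ultimately have "CARD('a) \<le> p ^ (j - i)"
        using card_power_fixed_le[of "p ^ (j - i)", where 'a = 'a] by simp
      also have "\<dots> < p ^ h"
        using ij prime_gt_1_nat[OF p] by (intro power_strict_increasing) auto
      finally show False using q by simp
    qed
  qed
  have "{\<sigma>. field_automorphism \<sigma>} = F ` {..<h}"
  proof (intro equalityI subsetI)
    fix \<sigma> :: "'a \<Rightarrow> 'a" assume "\<sigma> \<in> {\<sigma>. field_automorphism \<sigma>}"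
    hence \<sigma>: "field_automorphism \<sigma>" by simp
    note s = field_automorphism_simps[OF \<sigma>]
    define P where "P = (\<Prod>i<h. [:- F i g, 1:])"
    have map_P: "map_poly \<tau> P = (\<Prod>i<h. [:- \<tau> (F i g), 1:])" if "field_automorphism \<tau>" for \<tau>
    proof -
      note t = field_automorphism_simps[OF that]
      have mm: "map_poly \<tau> (A * B) = map_poly \<tau> A * map_poly \<tau> B" for A B
        by (rule poly_eqI) (simp add: coeff_map_poly coeff_mult t)
      have "map_poly \<tau> (\<Prod>i\<in>I. [:- F i g, 1:]) = (\<Prod>i\<in>I. map_poly \<tau> [:- F i g, 1:])"
        if "finite I" for I :: "nat set"
        using that by (induct I rule: finite_induct) (simp_all add: mm t map_poly_1' del: mult_pCons_left mult_pCons_right)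
      thus ?thesis by (simp add: P_def map_poly_pCons t)
    qed
    \<comment> \<open>Frobenius shifts the factors cyclically, because \<open>F h\<close> is the
      identity.\<close>
    have "map_poly (F 1) P = (\<Prod>i<h. [:- F (Suc i) g, 1:])"
      by (simp add: map_P[OF F_aut]) (simp add: F_def power_mult[symmetric] mult.commute)
    also have "\<dots> = P"
    proof -
      obtain h' where h': "h = Suc h'" using h by (cases h) auto
      have "(\<Prod>i<h. [:- F (Suc i) g, 1:]) = (\<Prod>i<h'. [:- F (Suc i) g, 1:]) * [:- F 0 g, 1:]"
        using F_h[of g] unfolding h' by (simp add: F_def)
      also have "\<dots> = P" unfolding P_def h' by (subst prod.lessThan_Suc_shift) (simp add: mult.commute)
      finally show ?thesis .
    qed
    finally have fixed: "map_poly (F 1) P = P" .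
    have "\<sigma> (coeff P i) = coeff P i" for i
    proof -
      have "coeff P i ^ p = coeff P i"
        using arg_cong[OF fixed, of "\<lambda>P. coeff P i"] p by (simp add: coeff_map_poly F_def prime_gt_0_nat)
      then obtain k where "coeff P i = of_nat k"
        using prime_field_eq_range_of_nat[of "coeff P i"] char by auto
      thus ?thesis by (simp add: s)
    qed
    hence "map_poly \<sigma> P = P"
      by (intro poly_eqI) (simp add: coeff_map_poly s)
    hence "poly P (\<sigma> g) = poly (map_poly \<sigma> P) (\<sigma> g)"
      by simp
    also have "\<dots> = (\<Prod>i<h. \<sigma> g - \<sigma> (F i g))"
      by (simp add: map_P[OF \<sigma>] poly_prod)
    also have "\<dots> = 0"
      using h by (intro prod_zero bexI[of _ 0]) (auto simp: F_def)
    finally have "(\<Prod>i<h. \<sigma> g - F i g) = 0"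
      by (simp add: P_def poly_prod)
    then obtain i where i: "i < h" "\<sigma> g = F i g"
      by auto
    have "\<sigma> x = F i x" for x
    proof (cases "x = 0")
      case True thus ?thesis using p by (simp add: s F_def prime_gt_0_nat)
    next
      case False
      then obtain j where "x = g ^ j" using g by blast
      thus ?thesis using i by (simp add: s F_def power_mult[symmetric] mult.commute)
    qed
    thus "\<sigma> \<in> F ` {..<h}" using i by auto
  qed (use F_aut in auto)
  thus ?thesis by (simp add: card_image[OF inj])
qed

section \<open>The moment curve\<close>

text \<open>The barycentric weight of interpolation theory: the reciprocal of the derivative at
  \<open>t\<close> of the monic polynomial with simple roots at the elements of \<open>S\<close>.
  For a single node the empty product gives 1.\<close>

definition node_weight :: "'a::field set \<Rightarrow> 'a \<Rightarrow> 'a" where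
  "node_weight S t = inverse (\<Prod>k\<in>S - {t}. t - k)"

lemma node_weight_nonzero: "finite S \<Longrightarrow> node_weight S t \<noteq> 0"
  by (auto simp: node_weight_def)

lemma node_weight_insert:
  assumes "finite R" "s \<notin> R" "t \<in> R"
  shows "node_weight (insert s R) t = node_weight R t / (t - s)"
proof -
  have "insert s R - {t} = insert s (R - {t})" using assms by auto
  thus ?thesis using assms by (simp add: node_weight_def field_simps)
qed

text \<open>The factor \<open>t - a\<close> kills the term of the node \<open>a\<close> and cancels
  the factor by which the weights for \<open>S\<close> and for \<open>S - {a}\<close> differ. This
  is the recursion of divided differences.\<close>

lemma sum_node_weight_diff:
  assumes "finite S" "a \<in> S"
  shows "(\<Sum>t\<in>S. node_weight S t * ((t - a) * g t)) = (\<Sum>t\<in>S - {a}. node_weight (S - {a}) t * g t)"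
proof -
  have "(\<Sum>t\<in>S. node_weight S t * ((t - a) * g t)) = (\<Sum>t\<in>S - {a}. node_weight S t * ((t - a) * g t))"
    using assms by (intro sum.mono_neutral_right) auto
  also have "\<dots> = (\<Sum>t\<in>S - {a}. node_weight (S - {a}) t * g t)"
  proof (intro sum.cong refl)
    fix t assume t: "t \<in> S - {a}"
    have "node_weight S t = node_weight (S - {a}) t / (t - a)"
      using node_weight_insert[of "S - {a}" a t] t assms by (simp add: insert_absorb)
    thus "node_weight S t * ((t - a) * g t) = node_weight (S - {a}) t * g t"
      using t by simp
  qed
  finally show ?thesis .
qed

text \<open>The divided difference of a constant vanishes. Multiplying by \<open>t - a\<close> or by
  \<open>t - b\<close> leads to sets with one node less, and the two resulting sums agree: both are
  0 by induction, or both are 1 if a single node is left.\<close>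

lemma sum_node_weight:
  assumes "finite S" "2 \<le> card S"
  shows "(\<Sum>t\<in>S. node_weight S t) = 0"
  using assms
proof (induct "card S" arbitrary: S rule: less_induct)
  case less
  obtain a b where ab: "a \<in> S" "b \<in> S" "a \<noteq> b"
    using less.prems by (metis One_nat_def card_le_Suc0_iff_eq not_less_eq_eq numeral_2_eq_2)
  have *: "(\<Sum>t\<in>S. node_weight S t * (t - c)) = (\<Sum>t\<in>S - {c}. node_weight (S - {c}) t)"
    if "c \<in> S" for c
    using sum_node_weight_diff[OF less.prems(1) that, of "\<lambda>_. 1"] by simp
  have eq: "(\<Sum>t\<in>S - {a}. node_weight (S - {a}) t) = (\<Sum>t\<in>S - {b}. node_weight (S - {b}) t)"
  proof (cases "card S = 2")
    case True
    then have "S = {a, b}"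
      using ab less.prems(1) by (intro card_seteq[symmetric]) auto
    moreover from this have "S - {a} = {b}" "S - {b} = {a}" using ab by auto
    ultimately show ?thesis by (simp add: node_weight_def)
  next
    case False
    hence "2 \<le> card (S - {c}) \<and> card (S - {c}) < card S" if "c \<in> S" for c
      using less.prems that by simp
    hence "(\<Sum>t\<in>S - {c}. node_weight (S - {c}) t) = 0" if "c \<in> S" for c
      using less.hyps[of "S - {c}"] less.prems that by auto
    thus ?thesis using ab by simp
  qed
  have "(b - a) * (\<Sum>t\<in>S. node_weight S t)
      = (\<Sum>t\<in>S. node_weight S t * (t - a)) - (\<Sum>t\<in>S. node_weight S t * (t - b))"
    by (simp add: sum_subtractf[symmetric] sum_distrib_left algebra_simps)
  also have "\<dots> = 0"
    using *[OF ab(1)] *[OF ab(2)] eq by simp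
  finally show ?case using ab by simp
qed

text \<open>Divided differences kill polynomials of degree at most \<open>card S - 2\<close>. The
  induction splits one factor \<open>t\<close> as \<open>(t - a) + a\<close>.\<close>

lemma sum_node_weight_power:
  assumes "finite S" "i + 2 \<le> card S"
  shows "(\<Sum>t\<in>S. node_weight S t * t ^ i) = 0"
  using assms
proof (induct i arbitrary: S)
  case 0
  thus ?case using sum_node_weight[of S] by (simp add: numeral_2_eq_2)
next
  case (Suc i)
  then obtain a where a: "a \<in> S" by fastforce
  have "(\<Sum>t\<in>S. node_weight S t * t ^ Suc i)
      = (\<Sum>t\<in>S. node_weight S t * ((t - a) * t ^ i)) + a * (\<Sum>t\<in>S. node_weight S t * t ^ i)"
    by (simp add: sum.distrib[symmetric] sum_distrib_left algebra_simps)
  also have "(\<Sum>t\<in>S. node_weight S t * ((t - a) * t ^ i)) = 0"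
    using Suc a by (simp add: sum_node_weight_diff)
  finally show ?case using Suc by simp
qed

text \<open>The Vandermonde argument: test against the polynomial that vanishes on all nodes but one.\<close>

lemma power_sums_zero_imp_zero:
  fixes g :: "'a::field \<Rightarrow> 'a"
  assumes T: "finite T" "card T \<le> n + 1" and z: "\<And>i. i \<le> n \<Longrightarrow> (\<Sum>t\<in>T. g t * t ^ i) = 0" and u: "u \<in> T"
  shows "g u = 0"
proof -
  define P where "P = (\<Prod>k\<in>T - {u}. [:- k, 1:])"
  have "degree P \<le> (\<Sum>k\<in>T - {u}. degree [:- k, 1:])"
    unfolding P_def by (rule order.trans[OF degree_prod_sum_le]) (use T in auto)
  also have "\<dots> \<le> n" using T u by simp
  finally have deg: "degree P \<le> n" .
  have "(\<Sum>t\<in>T. g t * poly P t) = (\<Sum>t\<in>T. \<Sum>i\<le>degree P. coeff P i * (g t * t ^ i))"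
    by (simp add: poly_altdef sum_distrib_left algebra_simps)
  also have "\<dots> = (\<Sum>i\<le>degree P. coeff P i * (\<Sum>t\<in>T. g t * t ^ i))"
    by (subst sum.swap) (simp add: sum_distrib_left)
  also have "\<dots> = 0" using deg by (simp add: z)
  also have "(\<Sum>t\<in>T. g t * poly P t) = (\<Sum>t\<in>{u}. g t * poly P t)"
    using T u by (intro sum.mono_neutral_right) (auto simp: P_def poly_prod)
  finally have "g u * poly P u = 0" by simp
  moreover have "poly P u \<noteq> 0" using T by (simp add: P_def poly_prod)
  ultimately show ?thesis by simp
qed

text \<open>Each of the \<open>card S - 1\<close> differences in the product picks up the factor
  \<open>\<alpha>\<close>, and the translation by \<open>\<beta>\<close> cancels in all of
  them.\<close>

lemma node_weight_image_affine:
  assumes "field_automorphism \<sigma>" "\<And>t. \<pi> t = \<alpha> * \<sigma> t + \<beta>" "\<alpha> \<noteq> 0" "finite S" "t \<in> S"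
  shows "node_weight (\<pi> ` S) (\<pi> t) = inverse (\<alpha> ^ (card S - 1)) * \<sigma> (node_weight S t)"
proof -
  note s = field_automorphism_simps[OF assms(1)]
  have inj: "inj \<pi>" using assms(2,3) s by (auto simp: inj_def)
  have "(\<Prod>k\<in>\<pi> ` S - {\<pi> t}. \<pi> t - k) = (\<Prod>k\<in>\<pi> ` (S - {t}). \<pi> t - k)"
    using inj by (simp add: image_set_diff)
  also have "\<dots> = (\<Prod>k\<in>S - {t}. \<pi> t - \<pi> k)"
    using inj by (subst prod.reindex) (auto intro: inj_on_subset)
  also have "\<dots> = (\<Prod>k\<in>S - {t}. \<alpha> * \<sigma> (t - k))"
    by (simp add: assms(2) s algebra_simps)
  also have "\<dots> = \<alpha> ^ (card S - 1) * \<sigma> (\<Prod>k\<in>S - {t}. t - k)"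
    using assms by (simp add: prod.distrib s)
  finally show ?thesis by (simp add: node_weight_def s)
qed

text \<open>The vectors \<open>b i\<close> span the space underlying the hyperplane at infinity, and
  \<open>e\<close> lies off it, so the vectors \<open>e + w\<close> give an affine chart of the
  complement. The parametrisation \<open>v\<close> omits the point of \<open>b n\<close>; the bound
  \<open>n + 1 \<le> CARD('a)\<close> still makes the vectors \<open>v t\<close> span the
  hyperplane.\<close>

locale moment_curve =
  fixes b :: "nat \<Rightarrow> 'a::{field,finite}^'m::finite" and n :: nat and e :: "'a^'m"
  assumes inj_b: "inj_on b {0..n}" and indep_b: "vec.independent (b ` {0..n})"
    and dim: "CARD('m) = n + 2" and n2: "2 \<le> n" and nq: "n + 1 \<le> CARD('a)"
    and e: "e \<notin> vec.span (b ` {0..n})"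
begin

definition W :: "('a^'m) set" where
  "W = vec.span (b ` {0..n})"

definition v :: "'a \<Rightarrow> 'a^'m" where
  "v t = (\<Sum>i=0..n. t ^ i *s b i)"

lemma subspace_W: "vec.subspace W"
  by (simp add: W_def)

lemmas W_closed [simp] = vec.subspace_0[OF subspace_W] vec.subspace_add[OF subspace_W]
  vec.subspace_diff[OF subspace_W] vec.subspace_scale[OF subspace_W]

lemma dim_W: "vec.dim W = n + 1"
  using vec.dim_span_eq_card_independent[OF indep_b] card_image[OF inj_b] by (simp add: W_def)

lemma v_in_W [simp]: "v t \<in> W"
  unfolding v_def W_def by (intro vec.span_sum vec.span_scale vec.span_base) auto

lemma sum_b_eq_0:
  assumes "(\<Sum>i=0..n. a i *s b i) = 0" "i \<le> n"
  shows "a i = 0"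
proof -
  have "(\<Sum>x\<in>b ` {0..n}. a (the_inv_into {0..n} b x) *s x) = (\<Sum>i=0..n. a i *s b i)"
    using inj_b by (subst sum.reindex) (auto simp: the_inv_into_f_f)
  hence "a (the_inv_into {0..n} b (b i)) = 0"
    using indep_b assms by (auto simp: vec.independent_explicit)
  thus ?thesis using inj_b assms(2) by (simp add: the_inv_into_f_f)
qed

lemma sum_v: "(\<Sum>t\<in>T. g t *s v t) = (\<Sum>i=0..n. (\<Sum>t\<in>T. g t * t ^ i) *s b i)"
  unfolding v_def by (simp add: vec.scale_sum_right vec.scale_sum_left, subst sum.swap) simp

text \<open>In the coordinates given by \<open>b\<close>, a vanishing combination is a Vandermonde
  system of vanishing power sums.\<close>

lemma sum_v_eq_0:
  assumes "card T \<le> n + 1" "(\<Sum>t\<in>T. g t *s v t) = 0" "u \<in> T"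
  shows "g u = 0"
proof (rule power_sums_zero_imp_zero[OF _ assms(1) _ assms(3)])
  show "(\<Sum>t\<in>T. g t * t ^ i) = 0" if "i \<le> n" for i
    using sum_b_eq_0[of "\<lambda>i. \<Sum>t\<in>T. g t * t ^ i" i] assms(2) that by (simp add: sum_v)
qed simp

lemma v_nonzero [simp]: "v t \<noteq> 0"
  using sum_v_eq_0[of "{t}" "\<lambda>_. 1" t] by auto

lemma v_indep2:
  assumes "t \<noteq> u" "x *s v t + y *s v u = 0"
  shows "x = 0" "y = 0"
proof -
  let ?g = "(\<lambda>_. 0)(t := x, u := y)"
  have "(\<Sum>s\<in>{t, u}. ?g s *s v s) = 0" "card {t, u} \<le> n + 1"
    using assms n2 by auto
  hence "\<forall>s\<in>{t, u}. ?g s = 0"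
    using sum_v_eq_0 by blast
  thus "x = 0" "y = 0" using assms(1) by auto
qed

lemma v_indep3:
  assumes "t \<noteq> u" "t \<noteq> w" "u \<noteq> w" "x *s v t + y *s v u + z *s v w = 0"
  shows "x = 0" "y = 0" "z = 0"
proof -
  let ?g = "(\<lambda>_. 0)(t := x, u := y, w := z)"
  have "(\<Sum>s\<in>{t, u, w}. ?g s *s v s) = 0" "card {t, u, w} \<le> n + 1"
    using assms n2 by (auto simp: add.assoc)
  hence "\<forall>s\<in>{t, u, w}. ?g s = 0"
    using sum_v_eq_0 by blast
  thus "x = 0" "y = 0" "z = 0" using assms(1-3) by auto
qed

lemma v_indep4:
  assumes "3 \<le> n" "distinct [t, u, w, s]" "x *s v t + y *s v u + z *s v w + c *s v s = 0"
  shows "x = 0" "y = 0" "z = 0" "c = 0"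
proof -
  let ?g = "(\<lambda>_. 0)(t := x, u := y, w := z, s := c)"
  have "(\<Sum>r\<in>{t, u, w, s}. ?g r *s v r) = 0" "card {t, u, w, s} \<le> n + 1"
    using assms by (auto simp: add.assoc)
  hence "\<forall>r\<in>{t, u, w, s}. ?g r = 0"
    using sum_v_eq_0 by blast
  thus "x = 0" "y = 0" "z = 0" "c = 0" using assms(2) by (auto split: if_splits)
qed

lemma inj_v: "inj v"
proof (rule injI, rule ccontr)
  fix t u assume "v t = v u" "t \<noteq> u"
  with v_indep2[of t u 1 "-1"] show False by simp
qed

lemma independent_v:
  assumes "card T \<le> n + 1"
  shows "vec.independent (v ` T)"
proof -
  have "(\<Sum>x\<in>v ` T. g x *s x) = (\<Sum>t\<in>T. g (v t) *s v t)" for g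
    using inj_v by (subst sum.reindex) (auto intro: inj_on_subset)
  thus ?thesis
    unfolding vec.independent_explicit using sum_v_eq_0[OF assms] by auto
qed

lemma span_v:
  assumes "n + 1 \<le> card T"
  shows "vec.span (v ` T) = W"
proof (rule vec.subspace_dim_equal)
  obtain T' where T': "T' \<subseteq> T" "card T' = n + 1"
    using assms by (meson obtain_subset_with_card_n)
  have "card (v ` T') = n + 1"
    using T' inj_v by (simp add: card_image inj_on_subset)
  moreover have "vec.independent (v ` T')" by (rule independent_v) (use T' in simp)
  ultimately have "vec.dim (vec.span (v ` T')) = n + 1"
    by (simp add: vec.dim_eq_card_independent)
  thus "vec.dim W \<le> vec.dim (vec.span (v ` T))"
    using T' dim_W by (metis image_mono vec.dim_subset vec.span_mono)
  show "vec.span (v ` T) \<subseteq> W"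
    by (rule vec.span_minimal) (auto simp: subspace_W)
qed (simp_all add: subspace_W)

lemma span_range_v: "vec.span (range v) = W"
  using span_v[of UNIV] nq by simp

text \<open>The directions \<open>v t\<close> span \<open>W\<close>, so every point is reached from
  0 by moving along lines of the incidence structure. Facts about collineations then only have to be
  followed along one line at a time.\<close>

lemma W_induct [consumes 1, case_names zero step]:
  assumes "x \<in> W" "P 0" "\<And>y c t. y \<in> W \<Longrightarrow> P y \<Longrightarrow> P (y + c *s v t)"
  shows "P x"
proof -
  have "x \<in> vec.span (range v)" using assms(1) by (simp add: span_range_v)
  hence "x \<in> W \<and> P x"
    by (induct rule: vec.span_induct_alt) (auto simp: assms add.commute[of "_ *s _"])
  thus ?thesis ..
qed

lemma relation_v:
  assumes "card S = n + 2"
  shows "(\<Sum>t\<in>S. node_weight S t *s v t) = 0"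
  unfolding sum_v using assms by (simp add: sum_node_weight_power)

text \<open>Subtracting the multiple that removes the coefficient at one node leaves a relation
  between \<open>n + 1\<close> of the vectors \<open>v t\<close>, which are independent.\<close>

lemma relation_v_unique:
  assumes S: "card S = n + 2" and d: "(\<Sum>t\<in>S. d t *s v t) = 0"
  shows "\<exists>\<mu>. \<forall>t\<in>S. d t = \<mu> * node_weight S t"
proof -
  obtain u where u: "u \<in> S" using S by fastforce
  define \<mu> where "\<mu> = d u / node_weight S u"
  let ?g = "\<lambda>t. d t - \<mu> * node_weight S t"
  have "(\<Sum>t\<in>S. ?g t *s v t) = (\<Sum>t\<in>S. d t *s v t) - \<mu> *s (\<Sum>t\<in>S. node_weight S t *s v t)"
    by (simp add: vec.scale_left_diff_distrib sum_subtractf vec.scale_sum_right)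
  also have "\<dots> = 0" using d relation_v[OF S] by simp
  finally have "(\<Sum>t\<in>S. ?g t *s v t) = 0" .
  moreover have gu: "?g u = 0"
    using node_weight_nonzero[of S u] by (simp add: \<mu>_def)
  ultimately have "(\<Sum>t\<in>S - {u}. ?g t *s v t) = 0"
    using u by (simp add: sum.remove)
  moreover have "card (S - {u}) \<le> n + 1" using S u by simp
  ultimately have "?g t = 0" if "t \<in> S - {u}" for t
    using sum_v_eq_0[of "S - {u}" ?g t] that by blast
  with gu have "\<forall>t\<in>S. ?g t = 0" by blast
  thus ?thesis by auto
qed

lemma e_notin [simp]: "e \<notin> W"
  using e by (simp add: W_def)

lemma e_decomp: "\<exists>c. \<exists>w\<in>W. x = c *s e + w"
proof -
  have "vec.independent (insert e (b ` {0..n}))"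
    using e indep_b by (simp add: vec.independent_insertI)
  moreover have "e \<notin> b ` {0..n}" using e vec.span_base by blast
  hence "card (insert e (b ` {0..n})) = n + 2"
    by (simp add: card_image[OF inj_b])
  ultimately have "vec.dim (vec.span (insert e (b ` {0..n}))) = CARD('m)"
    by (simp add: vec.dim_eq_card_independent dim)
  hence "vec.span (insert e (b ` {0..n})) = UNIV"
    by (intro vec.subspace_dim_equal) (simp_all add: vec_dim_card del: vec.dim_UNIV)
  hence "x \<in> vec.span (insert e (b ` {0..n}))" by simp
  then obtain k where "x - k *s e \<in> W"
    unfolding W_def using vec.span_breakdown_eq by blast
  thus ?thesis
    by (intro exI[of _ k] bexI[of _ "x - k *s e"]) auto
qed

lemma e_scale_in_W: "c *s e \<in> W \<longleftrightarrow> c = 0"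
proof
  assume "c *s e \<in> W"
  hence "inverse c *s (c *s e) \<in> W" by (rule vec.subspace_scale[OF subspace_W])
  thus "c = 0" by (cases "c = 0") auto
qed simp

lemma e_add_in_W: "w \<in> W \<Longrightarrow> c *s e + w \<in> W \<longleftrightarrow> c = 0"
  using vec.subspace_diff[OF subspace_W, of "c *s e + w" w] by (auto simp: e_scale_in_W)

lemma e_unique:
  assumes "w \<in> W" "w' \<in> W" "c *s e + w = c' *s e + w'"
  shows "c = c'" "w = w'"
proof -
  have "(c - c') *s e = w' - w"
    using assms by (simp add: vec.scale_left_diff_distrib algebra_simps)
  hence "(c - c') *s e \<in> W" using assms by simp
  thus c: "c = c'" by (simp add: e_scale_in_W)
  show "w = w'" using assms(3) c by simp
qed

end

section \<open>Semilinear maps and collineations\<close>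

text \<open>Makes the companion automorphism explicit, since it has to be tracked and counted, and
  leaves bijectivity to be established separately.\<close>

definition semilinear :: "('a::field \<Rightarrow> 'a) \<Rightarrow> ('a ^ 'm::finite \<Rightarrow> 'a ^ 'm) \<Rightarrow> bool" where
  "semilinear \<sigma> f \<longleftrightarrow> field_automorphism \<sigma> \<and> (\<forall>x y. f (x + y) = f x + f y) \<and> (\<forall>c x. f (c *s x) = \<sigma> c *s f x)"

lemma semilinear_bij_iff: "semilinear_bij f \<longleftrightarrow> bij f \<and> (\<exists>\<sigma>. semilinear \<sigma> f)"
  by (auto simp: semilinear_bij_def semilinear_def)

lemma semilinear_simps:
  assumes "semilinear \<sigma> f"
  shows "f (x + y) = f x + f y" "f (c *s x) = \<sigma> c *s f x" "f 0 = 0" "f (- x) = - f x"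
    "f (x - y) = f x - f y" "f (sum g A) = (\<Sum>a\<in>A. f (g a))"
proof -
  have add: "f (x + y) = f x + f y" and sc: "f (c *s x) = \<sigma> c *s f x" for x y c
    using assms by (auto simp: semilinear_def)
  have z: "f 0 = 0" using add[of 0 0] by (metis add_cancel_right_left add_0)
  have neg: "f (- x) = - f x" for x using add[of x "-x"] z by (simp add: eq_neg_iff_add_eq_0 add.commute)
  show "f (x + y) = f x + f y" "f (c *s x) = \<sigma> c *s f x" "f 0 = 0" "f (- x) = - f x"
    by (fact add sc z neg)+
  show "f (x - y) = f x - f y" using add[of x "-y"] neg by simp
  show "f (sum g A) = (\<Sum>a\<in>A. f (g a))"
    by (induct A rule: infinite_finite_induct) (simp_all add: z add)
qed

lemma semilinear_automorphism: "semilinear \<sigma> f \<Longrightarrow> field_automorphism \<sigma>"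
  by (simp add: semilinear_def)

lemma field_automorphism_id: "field_automorphism (\<lambda>x. x)"
  by (simp add: field_automorphism_def bij_def inj_def surj_def)

lemma field_automorphism_inv:
  assumes "field_automorphism \<sigma>"
  shows "field_automorphism (inv_into UNIV \<sigma>)" "\<sigma> (inv_into UNIV \<sigma> x) = x" "inv_into UNIV \<sigma> (\<sigma> x) = x"
proof -
  have bij: "bij \<sigma>" using assms by (simp add: field_automorphism_def)
  show 1: "\<sigma> (inv_into UNIV \<sigma> x) = x" for x using bij by (simp add: bij_is_surj surj_f_inv_f)
  show 2: "inv_into UNIV \<sigma> (\<sigma> x) = x" for x using bij by (simp add: bij_is_inj)
  have "inv_into UNIV \<sigma> (x + y) = inv_into UNIV \<sigma> x + inv_into UNIV \<sigma> y"
    "inv_into UNIV \<sigma> (x * y) = inv_into UNIV \<sigma> x * inv_into UNIV \<sigma> y" for x y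
    using field_automorphism_simps(3,4,7)[OF assms] by (metis 1)+
  thus "field_automorphism (inv_into UNIV \<sigma>)"
    using bij by (simp add: field_automorphism_def bij_imp_bij_inv)
qed

lemma semilinear_comp:
  "semilinear \<sigma> f \<Longrightarrow> semilinear \<tau> g \<Longrightarrow> semilinear (\<sigma> \<circ> \<tau>) (f \<circ> g)"
  by (auto simp: semilinear_def field_automorphism_def bij_comp)

lemma semilinear_inv:
  assumes f: "semilinear \<sigma> f" "bij f"
  shows "semilinear (inv_into UNIV \<sigma>) (inv_into UNIV f)"
proof -
  have 1: "f (inv_into UNIV f x) = x" for x using f(2) by (simp add: bij_is_surj surj_f_inv_f)
  have inj: "f x = f y \<longleftrightarrow> x = y" for x y using f(2) by (simp add: bij_is_inj inj_eq)
  note s = field_automorphism_inv[OF semilinear_automorphism[OF f(1)]]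
  have "inv_into UNIV f (x + y) = inv_into UNIV f x + inv_into UNIV f y" for x y
    using inj semilinear_simps(1)[OF f(1)] by (metis 1)
  moreover have "inv_into UNIV f (c *s x) = inv_into UNIV \<sigma> c *s inv_into UNIV f x" for c x
    using inj semilinear_simps(2)[OF f(1)] by (metis 1 s(2))
  ultimately show ?thesis using s by (simp add: semilinear_def)
qed

lemma semilinear_bij_id: "semilinear_bij (\<lambda>x. x)"
  using field_automorphism_id by (auto simp: semilinear_bij_def bij_id[unfolded id_def])

lemma semilinear_bij_comp: "semilinear_bij f \<Longrightarrow> semilinear_bij g \<Longrightarrow> semilinear_bij (f \<circ> g)"
  unfolding semilinear_bij_iff using semilinear_comp bij_comp by blast

lemma semilinear_bij_inv: "semilinear_bij f \<Longrightarrow> semilinear_bij (inv_into UNIV f)"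
  unfolding semilinear_bij_iff using semilinear_inv bij_imp_bij_inv by blast

lemma semilinear_bij_scale:
  assumes "semilinear_bij f" "c \<noteq> 0"
  shows "semilinear_bij (\<lambda>x. c *s f x)"
proof -
  have "bij (\<lambda>x :: 'a^'b. c *s x)"
    using assms(2) by (intro o_bij[of "\<lambda>x. inverse c *s x"]) auto
  hence "bij (\<lambda>x. c *s f x)"
    using assms(1) bij_comp[of f "\<lambda>x. c *s x"] by (auto simp: semilinear_bij_def o_def)
  thus ?thesis
    using assms by (auto simp: semilinear_bij_def vec.scale_right_distrib mult.commute)
qed

lemma semilinear_image_span:
  assumes f: "semilinear \<sigma> f"
  shows "f ` vec.span S = vec.span (f ` S)"
proof (intro equalityI subsetI)
  note s = semilinear_simps[OF f]
  fix y assume "y \<in> f ` vec.span S"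
  then obtain x where "x \<in> vec.span S" "y = f x" by blast
  have "f x \<in> vec.span (f ` S)" using \<open>x \<in> vec.span S\<close>
    by (induct rule: vec.span_induct_alt)
       (simp_all add: s vec.span_zero vec.span_add vec.span_scale vec.span_base)
  thus "y \<in> vec.span (f ` S)" by (simp add: \<open>y = f x\<close>)
next
  note s = semilinear_simps[OF f]
  note t = field_automorphism_inv[OF semilinear_automorphism[OF f]]
  fix y assume "y \<in> vec.span (f ` S)"
  thus "y \<in> f ` vec.span S"
  proof (induct rule: vec.span_induct_alt)
    case base
    show ?case using s(3) by (intro image_eqI[of _ _ 0]) (simp_all add: vec.span_zero)
  next
    case (step c x y)
    then obtain u w where "x = f u" "u \<in> S" "y = f w" "w \<in> vec.span S" by blast
    hence "c *s x + y = f (inv_into UNIV \<sigma> c *s u + w)" by (simp add: s t)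
    thus ?case using \<open>u \<in> S\<close> \<open>w \<in> vec.span S\<close>
      by (simp add: vec.span_add vec.span_scale vec.span_base)
  qed
qed

text \<open>A linear map attains the values twisted by the inverse of \<open>\<sigma>\<close>;
  applying \<open>\<sigma>\<close> to every coordinate afterwards is semilinear and undoes the
  twist.\<close>

lemma semilinear_extend:
  assumes ind: "vec.independent B" and \<sigma>: "field_automorphism \<sigma>"
  shows "\<exists>f. semilinear \<sigma> f \<and> (\<forall>x\<in>B. f x = g x)"
proof -
  define F where "F = (\<lambda>x :: 'a^'b. \<chi> i. \<sigma> (x $ i))"
  define F' where "F' = (\<lambda>x :: 'a^'b. \<chi> i. inv_into UNIV \<sigma> (x $ i))"
  note s = field_automorphism_simps[OF \<sigma>] and t = field_automorphism_inv[OF \<sigma>]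
  obtain L where L: "Vector_Spaces.linear (*s) (*s) L" "\<forall>x\<in>B. L x = F' (g x)"
    using vec.linear_independent_extend[OF ind, of "\<lambda>x. F' (g x)"] by blast
  have "semilinear \<sigma> F"
    using \<sigma> by (auto simp: semilinear_def F_def vec_eq_iff s)
  moreover have "L (x + y) = L x + L y" "L (c *s x) = c *s L x" for x y c
    using L(1) by (simp_all add: linear_iff_module_hom module_hom.add module_hom.scale)
  ultimately have "semilinear \<sigma> (\<lambda>x. F (L x))"
    by (simp add: semilinear_def)
  moreover have "F (L x) = g x" if "x \<in> B" for x
    using L(2) that by (simp add: F_def F'_def vec_eq_iff t)
  ultimately show ?thesis by blast
qed

section \<open>Projective points and the permutations that semilinear maps induce on them\<close>

lemma span_single: "vec.span {x} = range (\<lambda>c. c *s x)"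
  by (rule vec.span_singleton)

lemma span_single_eq_iff:
  assumes "x \<noteq> 0"
  shows "vec.span {x} = vec.span {y} \<longleftrightarrow> (\<exists>c. c \<noteq> 0 \<and> y = c *s x)"
proof
  assume eq: "vec.span {x} = vec.span {y}"
  have "y \<in> vec.span {x}" using eq vec.span_base by auto
  then obtain c where c: "y = c *s x" by (auto simp: span_single)
  have "c \<noteq> 0"
  proof
    assume "c = 0"
    hence "vec.span {x} = {0}" using eq c by simp
    thus False using assms vec.span_base[of x "{x}"] by auto
  qed
  with c show "\<exists>c. c \<noteq> 0 \<and> y = c *s x" by blast
next
  assume "\<exists>c. c \<noteq> 0 \<and> y = c *s x"
  then obtain c where c: "c \<noteq> 0" "y = c *s x" by blast
  hence "x = inverse c *s y" by simp
  hence "y \<in> vec.span {x}" "x \<in> vec.span {y}"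
    using c(2) by (auto simp: span_single)
  thus "vec.span {x} = vec.span {y}"
    by (simp add: vec.span_eq)
qed

lemma pg_points_iff: "P \<in> pg_points \<longleftrightarrow> (\<exists>x. x \<noteq> 0 \<and> P = vec.span {x})"
proof
  assume "P \<in> pg_points"
  hence P: "vec.subspace P" "vec.dim P = 1" by (auto simp: pg_points_def)
  obtain B where B: "B \<subseteq> P" "vec.independent B" "P \<subseteq> vec.span B" "card B = vec.dim P"
    using vec.basis_exists by blast
  then obtain x where x: "B = {x}" using P(2) by (metis card_1_singletonE)
  hence "P = vec.span {x}" using B P(1) vec.span_minimal by blast
  moreover have "x \<noteq> 0" using B(2) x by simp
  ultimately show "\<exists>x. x \<noteq> 0 \<and> P = vec.span {x}" by blast
qed (auto simp: pg_points_def)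

lemma span_in_pg_points [simp]: "vec.span {x} \<in> pg_points \<longleftrightarrow> x \<noteq> 0"
  by (auto simp: pg_points_def)

text \<open>The restriction makes the map \<open>undefined\<close> off the points, as
  \<open>Bij\<close> demands, so that equal permutations are equal functions.\<close>

definition induced :: "('a::field ^ 'm::finite \<Rightarrow> 'a ^ 'm) \<Rightarrow> ('a ^ 'm) set \<Rightarrow> ('a ^ 'm) set" where
  "induced f = restrict (image f) pg_points"

lemma semilinear_bij_nonzero: "semilinear_bij f \<Longrightarrow> f x = 0 \<longleftrightarrow> x = 0"
  by (metis bij_is_inj injD semilinear_bij_iff semilinear_simps(3))

lemma semilinear_bij_image_span: "semilinear_bij f \<Longrightarrow> f ` vec.span S = vec.span (f ` S)"
  using semilinear_image_span semilinear_bij_iff by blast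

lemma induced_span: "semilinear_bij f \<Longrightarrow> x \<noteq> 0 \<Longrightarrow> induced f (vec.span {x}) = vec.span {f x}"
  by (simp add: induced_def semilinear_bij_image_span)

lemma induced_in_pg_points: "semilinear_bij f \<Longrightarrow> P \<in> pg_points \<Longrightarrow> induced f P \<in> pg_points"
  by (auto simp: pg_points_iff[of P] induced_span semilinear_bij_nonzero)

lemma induced_comp:
  assumes "semilinear_bij f" "semilinear_bij g"
  shows "compose pg_points (induced f) (induced g) = induced (f \<circ> g)"
proof
  fix P
  show "compose pg_points (induced f) (induced g) P = induced (f \<circ> g) P"
    using induced_in_pg_points[OF assms(2), of P]
    by (auto simp: compose_def induced_def image_comp)
qed

lemma induced_id: "induced (\<lambda>x. x) = restrict (\<lambda>x. x) pg_points"
  by (rule ext) (simp add: induced_def)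

lemma induced_Bij:
  assumes f: "semilinear_bij f"
  shows "induced f \<in> Bij pg_points"
proof -
  let ?g = "inv_into UNIV f"
  have g: "semilinear_bij ?g" by (rule semilinear_bij_inv[OF f])
  have bij: "bij f" using f by (simp add: semilinear_bij_def)
  have "bij_betw (induced f) pg_points pg_points"
  proof (rule bij_betwI[of _ _ _ "induced ?g"])
    show "induced f \<in> pg_points \<rightarrow> pg_points" "induced ?g \<in> pg_points \<rightarrow> pg_points"
      using induced_in_pg_points f g by auto
    show "induced ?g (induced f P) = P" if "P \<in> pg_points" for P
      using that induced_in_pg_points[OF f that] bij_is_inj[OF bij]
      by (simp add: induced_def)
    show "induced f (induced ?g P) = P" if "P \<in> pg_points" for P
      using that induced_in_pg_points[OF g that] bij_is_surj[OF bij]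
      by (simp add: induced_def image_f_inv_f)
  qed
  thus ?thesis by (simp add: Bij_def induced_def)
qed

lemma carrier_PGammaL_stab:
  "g \<in> carrier (PGammaL_stab K) \<longleftrightarrow> (\<exists>f. semilinear_bij f \<and> g = induced f \<and> g ` K = K)"
  by (auto simp: PGammaL_stab_def PGammaL_def induced_def)

lemma PGammaL_stab_eq:
  "PGammaL_stab K = (BijGroup pg_points)\<lparr>carrier := carrier (PGammaL_stab K)\<rparr>"
  by (simp add: PGammaL_stab_def PGammaL_def)

lemma mult_PGammaL_stab:
  assumes "semilinear_bij f" "semilinear_bij g"
  shows "induced f \<otimes>\<^bsub>PGammaL_stab K\<^esub> induced g = induced (f \<circ> g)"
  using induced_Bij[OF assms(1)] induced_Bij[OF assms(2)]
  by (simp add: PGammaL_stab_def PGammaL_def BijGroup_def induced_comp[OF assms])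

text \<open>The inverse of an induced permutation is induced by the inverse semilinear map, so the
  stabiliser is a subgroup of the group of all permutations of the points.\<close>

lemma group_PGammaL_stab:
  assumes K: "K \<subseteq> pg_points"
  shows "group (PGammaL_stab K)"
proof -
  interpret B: group "BijGroup pg_points" by (rule group_BijGroup)
  have mult: "induced f \<otimes>\<^bsub>BijGroup pg_points\<^esub> induced g = induced (f \<circ> g)"
    if "semilinear_bij f" "semilinear_bij g" for f g :: "'a^'b \<Rightarrow> 'a^'b"
    using mult_PGammaL_stab[OF that, of K] by (simp add: PGammaL_stab_def PGammaL_def)
  have img: "induced (f \<circ> g) ` K = induced f ` (induced g ` K)"
    if "semilinear_bij f" "semilinear_bij g" for f g :: "'a^'b \<Rightarrow> 'a^'b"
    using K by (auto simp: induced_comp[OF that, symmetric] compose_def image_image intro!: image_cong)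
  have id: "induced (\<lambda>x :: 'a^'b. x) \<in> carrier (PGammaL_stab K)"
    unfolding carrier_PGammaL_stab using K semilinear_bij_id
    by (intro exI[of _ "\<lambda>x. x"]) (auto simp: induced_id subset_iff)
  have "subgroup (carrier (PGammaL_stab K)) (BijGroup pg_points)"
  proof (rule B.subgroupI)
    show "carrier (PGammaL_stab K) \<subseteq> carrier (BijGroup pg_points)"
      using induced_Bij by (auto simp: carrier_PGammaL_stab BijGroup_def)
    show "carrier (PGammaL_stab K) \<noteq> {}" using id by blast
    fix g assume "g \<in> carrier (PGammaL_stab K)"
    then obtain f where f: "semilinear_bij f" "g = induced f" "g ` K = K"
      by (auto simp: carrier_PGammaL_stab)
    have f': "semilinear_bij (inv_into UNIV f)" by (rule semilinear_bij_inv[OF f(1)])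
    have *: "inv_into UNIV f \<circ> f = (\<lambda>x. x)" "f \<circ> inv_into UNIV f = (\<lambda>x. x)"
      using f(1) by (auto simp: semilinear_bij_def bij_is_inj bij_is_surj surj_iff o_def surj_f_inv_f)
    have inv: "inv\<^bsub>BijGroup pg_points\<^esub> g = induced (inv_into UNIV f)"
    proof (rule B.inv_equality)
      show "induced (inv_into UNIV f) \<otimes>\<^bsub>BijGroup pg_points\<^esub> g = \<one>\<^bsub>BijGroup pg_points\<^esub>"
        using mult[OF f' f(1)] * f by (simp add: induced_id BijGroup_def)
    qed (use induced_Bij f f' in \<open>auto simp: BijGroup_def\<close>)
    have "induced (inv_into UNIV f) ` K = induced (inv_into UNIV f) ` (induced f ` K)"
      using f by simp
    also have "\<dots> = induced (\<lambda>x. x) ` K"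
      using img[OF f' f(1)] * by simp
    also have "\<dots> = K" using K by (auto simp: induced_id subset_iff)
    finally show "inv\<^bsub>BijGroup pg_points\<^esub> g \<in> carrier (PGammaL_stab K)"
      using f' inv by (auto simp: carrier_PGammaL_stab)
  next
    fix g h assume "g \<in> carrier (PGammaL_stab K)" "h \<in> carrier (PGammaL_stab K)"
    then obtain f f' where "semilinear_bij f" "g = induced f" "g ` K = K"
      "semilinear_bij f'" "h = induced f'" "h ` K = K"
      by (auto simp: carrier_PGammaL_stab)
    thus "g \<otimes>\<^bsub>BijGroup pg_points\<^esub> h \<in> carrier (PGammaL_stab K)"
      using img mult semilinear_bij_comp by (auto simp: carrier_PGammaL_stab intro!: exI[of _ "f \<circ> f'"])
  qed
  from B.subgroup_imp_group[OF this] show ?thesis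
    by (subst PGammaL_stab_eq)
qed

section \<open>Parallelism and additivity\<close>

lemma of_nat_bit_eq_0: "of_nat n = (0 :: bit) \<longleftrightarrow> even n"
  by (induct n) auto

text \<open>In the two-element field 1 is its own negative, so the involution cancels the terms of a
  sum of ones in pairs, and the value of that sum is the parity of the number of terms.\<close>

lemma even_card_of_involution:
  assumes h: "\<And>x. x \<in> X \<Longrightarrow> h x \<in> X" "\<And>x. x \<in> X \<Longrightarrow> h (h x) = x" "\<And>x. x \<in> X \<Longrightarrow> h x \<noteq> x"
  shows "even (card X)"
proof -
  have "(\<Sum>x\<in>X. 1 :: bit) = 0"
    using h by (intro sum_involution_eq_0[where h = h]) auto
  thus ?thesis by (simp add: of_nat_bit_eq_0)
qed

text \<open>A permutation of \<open>0, 1, -1\<close> that fixes 0 is the identity or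
  negation.\<close>

lemma additive_if_card_3:
  fixes f :: "'a::{field,finite} \<Rightarrow> 'a"
  assumes "CARD('a) = 3" "inj f" "f 0 = 0"
  shows "f (x + y) = f x + f y"
proof -
  have "CHAR('a) = 3" using CHAR_eq_prime[of 3 1, where 'a = 'a] assms by simp
  hence three: "(1 :: 'a) + 1 + 1 = 0"
    using of_nat_CHAR[where 'a = 'a] by (simp add: numeral_3_eq_3)
  hence two: "(1 :: 'a) + 1 = -1" by (simp add: eq_neg_iff_add_eq_0)
  hence m1: "(1 :: 'a) \<noteq> -1" using three by force
  have all3: "z = 0 \<or> z = a \<or> z = b" if "a \<noteq> 0" "b \<noteq> 0" "a \<noteq> b" for a b z :: 'a
  proof -
    have "{0, a, b} = UNIV" using that assms(1) by (intro card_seteq) auto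
    thus ?thesis by auto
  qed
  have ne: "f 1 \<noteq> 0" "f (-1) \<noteq> 0" "f 1 \<noteq> f (-1)"
    using assms m1 by (metis injD zero_neq_one neg_equal_0_iff_equal)+
  have "- f 1 \<noteq> f 1"
    using ne(1) two m1 by (metis mult_minus1 mult_right_cancel mult_1)
  hence neg: "f (-1) = - f 1"
    using all3[OF ne, of "- f 1"] ne by auto
  have t1: "f 1 + f 1 = - f 1" using two by (metis mult_1 mult_minus1 ring_distribs(2))
  have two': "-1 + -1 = (1 :: 'a)" using two by (metis minus_add_distrib minus_minus)
  have t2: "- f 1 + - f 1 = f 1" using t1 by (metis minus_add_distrib minus_minus)
  have "x = 0 \<or> x = 1 \<or> x = -1" "y = 0 \<or> y = 1 \<or> y = -1"
    using all3[of 1 "-1"] m1 by auto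
  thus ?thesis
    by (elim disjE) (simp_all only: add_0_left add_0_right two two' t1 t2 neg assms(3) right_minus left_minus)
qed

context moment_curve begin

text \<open>Any three directions are independent, so each \<open>t\<close> has only one partner
  \<open>u\<close>. Partnership is then an involution without fixed points and the field has even
  order. This leaves \<open>n \<ge> 3\<close>, where four directions are independent and
  \<open>d\<close> cannot lie in the planes of two disjoint pairs.\<close>

lemma no_direction_covers_all_pairs:
  assumes nq': "3 \<le> n \<or> odd CARD('a)" and cov: "\<And>t. \<exists>u x y. d = x *s v t + y *s v u"
    and nd: "\<And>t x. d \<noteq> x *s v t"
  shows False
proof -
  define R where "R t u \<longleftrightarrow> t \<noteq> u \<and> (\<exists>x y. d = x *s v t + y *s v u)" for t u
  have ex: "\<exists>u. R t u" for t
  proof -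
    obtain u x y where d: "d = x *s v t + y *s v u" using cov by blast
    have "t \<noteq> u"
    proof
      assume "t = u"
      hence "d = (x + y) *s v t" using d by (simp add: vec.scale_left_distrib)
      thus False using nd by blast
    qed
    thus ?thesis using d by (auto simp: R_def)
  qed
  have sym: "R t u \<Longrightarrow> R u t" for t u by (auto simp: R_def) (metis add.commute)
  have uniq: "u = w" if R: "R t u" "R t w" for t u w
  proof (rule ccontr)
    assume "u \<noteq> w"
    obtain x y x' y' where d: "d = x *s v t + y *s v u" "d = x' *s v t + y' *s v w" "t \<noteq> u" "t \<noteq> w"
      using R unfolding R_def by metis
    have "(x - x') *s v t + y *s v u + (- y') *s v w = d - d"
      by (subst (1) d(1), subst d(2)) (simp add: vec.scale_left_diff_distrib)
    also have "\<dots> = 0" by simp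
    finally have "y = 0" by (rule v_indep3(2)[OF d(3,4) \<open>u \<noteq> w\<close>])
    thus False using d(1) nd[of x t] by simp
  qed
  define h where "h t = (SOME u. R t u)" for t
  have h: "R t (h t)" for t unfolding h_def using ex by (rule someI_ex)
  have "h (h t) = t" "h t \<noteq> t" for t
    using uniq[OF h sym[OF h]] h[of t] by (auto simp: R_def)
  hence "even CARD('a)"
    by (intro even_card_of_involution[of _ h]) auto
  with nq' have n3: "3 \<le> n" by blast
  have "\<exists>w. w \<notin> {0, h 0}"
  proof (rule ccontr)
    assume "\<not> ?thesis"
    hence "UNIV \<subseteq> {0, h 0}" by auto
    hence "CARD('a) \<le> card {0, h 0}" by (intro card_mono) auto
    also have "\<dots> \<le> 2" by (simp add: card_insert_if)
    finally have "CARD('a) \<le> 2" .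
    thus False using nq n2 by simp
  qed
  then obtain w where w: "w \<noteq> 0" "w \<noteq> h 0" by auto
  have "h w \<noteq> 0" "h w \<noteq> h 0"
    using w \<open>\<And>t. h (h t) = t\<close> by metis+
  hence dist: "distinct [0, h 0, w, h w]"
    using w h[of 0] h[of w] by (auto simp: R_def)
  obtain x y where d: "d = x *s v 0 + y *s v (h 0)" using h[of 0] by (auto simp: R_def)
  obtain x' y' where d': "d = x' *s v w + y' *s v (h w)" using h[of w] by (auto simp: R_def)
  have "x *s v 0 + y *s v (h 0) + (- x') *s v w + (- y') *s v (h w) = d - d"
    by (subst (1) d, subst d') simp
  also have "\<dots> = 0" by simp
  finally have "y = 0" by (rule v_indep4(2)[OF n3 dist])
  thus False using d nd[of x 0] by simp
qed

text \<open>Two lines of different directions \<open>v s\<close> and \<open>v s'\<close> are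
  displaced by \<open>m *s v u\<close>. If every point \<open>a\<close> of the first had a
  transversal to the second, its direction \<open>r a\<close> would depend injectively on
  \<open>a\<close> and take all values; but it is never \<open>s\<close>.\<close>

lemma directions_pigeonhole:
  assumes dist: "s \<noteq> s'" "s \<noteq> u" "s' \<noteq> u" and m: "m \<noteq> 0"
    and ex: "\<And>a. \<exists>r l k. a *s v s + k *s v r = m *s v u + l *s v s'"
  shows False
proof -
  obtain r l k where eq: "\<And>a. a *s v s + k a *s v (r a) = m *s v u + l a *s v s'"
    using ex by metis
  have z: "a *s v s + k a *s v (r a) - m *s v u - l a *s v s' = 0" for a
    using eq[of a] by simp
  have k0: "k a \<noteq> 0" for a
  proof
    assume "k a = 0"
    hence "a *s v s + (- m) *s v u + (- l a) *s v s' = 0" using z[of a] by (simp add: algebra_simps)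
    from v_indep3(2)[OF dist(2,1) dist(3)[symmetric] this] show False using m by simp
  qed
  have rs: "r a \<noteq> s" for a
  proof
    assume "r a = s"
    hence "(a + k a) *s v s + (- m) *s v u + (- l a) *s v s' = 0"
      using z[of a] by (simp add: vec.scale_left_distrib)
    from v_indep3(2)[OF dist(2,1) dist(3)[symmetric] this] show False using m by simp
  qed
  have "inj r"
  proof (rule injI)
    fix a a' assume r: "r a = r a'"
    \<comment> \<open>This combination eliminates the common direction \<open>v (r a)\<close> and
      leaves a relation between \<open>v s\<close>, \<open>v u\<close> and
      \<open>v s'\<close>.\<close>
    have "k a' *s (a *s v s + k a *s v (r a) - m *s v u - l a *s v s')
        - k a *s (a' *s v s + k a' *s v (r a') - m *s v u - l a' *s v s') = 0"
      by (simp only: z) simp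
    hence "(k a' * a - k a * a') *s v s + ((k a - k a') * m) *s v u + (k a * l a' - k a' * l a) *s v s' = 0"
      unfolding r by (simp add: vec.scale_left_diff_distrib vec.scale_right_diff_distrib
          vec.scale_left_distrib vec.scale_right_distrib algebra_simps)
    hence "(k a - k a') * m = 0" "k a' * a - k a * a' = 0"
      using v_indep3(1,2)[OF dist(2,1) dist(3)[symmetric]] by blast+
    thus "a = a'" using k0[of a] m by auto
  qed
  hence "surj r" by (simp add: finite_UNIV_inj_surj)
  thus False using rs by (metis surjD)
qed

definition dir :: "'a^'m \<Rightarrow> 'a^'m \<Rightarrow> 'a \<Rightarrow> bool" where
  "dir x y t \<longleftrightarrow> (\<exists>c. y = x + c *s v t)"

lemma dir_refl [simp]: "dir x x t"
  unfolding dir_def by (intro exI[of _ 0]) simp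

lemma dir_add [simp]: "dir x (x + c *s v t) t"
  by (auto simp: dir_def)

lemma dir_sym: "dir x y t \<Longrightarrow> dir y x t"
  unfolding dir_def by (elim exE, rule_tac x = "- c" in exI) simp

lemma dir_trans: "dir x y t \<Longrightarrow> dir y z t \<Longrightarrow> dir x z t"
  unfolding dir_def by (elim exE, rule_tac x = "c + ca" in exI) (simp add: vec.scale_left_distrib)

lemma dir_unique: "dir x y t \<Longrightarrow> dir x y u \<Longrightarrow> x \<noteq> y \<Longrightarrow> t = u"
proof (rule ccontr)
  assume *: "dir x y t" "dir x y u" "x \<noteq> y" "t \<noteq> u"
  then obtain c d where cd: "y = x + c *s v t" "y = x + d *s v u" unfolding dir_def by blast
  hence "c *s v t + (- d) *s v u = 0" by (metis add_left_cancel add.right_inverse vec.scale_minus_left)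
  hence "c = 0" using v_indep2 * by blast
  thus False using cd * by simp
qed

text \<open>The lines of direction \<open>t\<close> through \<open>x\<close> and through
  \<open>x + c *s v u\<close> are joined at every point by a line of direction \<open>u\<close>. If
  their images had different directions, the images of these transversals would contradict
  \<open>directions_pigeonhole\<close>.\<close>

lemma parallel_preserved:
  assumes phi: "bij_betw \<phi> W W"
    and dir: "\<And>x y t. x \<in> W \<Longrightarrow> y \<in> W \<Longrightarrow> dir x y t \<longleftrightarrow> dir (\<phi> x) (\<phi> y) (\<tau> x t)"
    and inj: "\<And>x. x \<in> W \<Longrightarrow> inj (\<tau> x)"
    and same: "\<And>x y t. x \<in> W \<Longrightarrow> y \<in> W \<Longrightarrow> dir x y t \<Longrightarrow> \<tau> x t = \<tau> y t"
    and x: "x \<in> W"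
  shows "\<tau> x t = \<tau> 0 t"
  using x
proof (induct rule: W_induct)
  case zero show ?case ..
next
  case (step x c u)
  let ?y = "x + c *s v u"
  have y: "?y \<in> W" using step by simp
  have phiW: "\<phi> z \<in> W" if "z \<in> W" for z using phi that by (auto simp: bij_betw_def)
  have "\<tau> ?y t = \<tau> x t"
  proof (cases "c = 0 \<or> u = t")
    case True
    hence "dir x ?y t" by auto
    thus ?thesis using same step y by metis
  next
    case False
    show ?thesis
    proof (rule ccontr)
      assume ne: "\<tau> ?y t \<noteq> \<tau> x t"
      have u: "\<tau> ?y u = \<tau> x u" using same[OF \<open>x \<in> W\<close> y, of u] by simp
      have "dir (\<phi> x) (\<phi> ?y) (\<tau> x u)"
        using dir[OF \<open>x \<in> W\<close> y, of u] by simp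
      then obtain m where m: "\<phi> ?y = \<phi> x + m *s v (\<tau> x u)"
        by (auto simp: dir_def)
      have "x \<noteq> ?y" using False by simp
      hence "\<phi> x \<noteq> \<phi> ?y" using phi step y by (metis bij_betw_inv_into_left)
      hence m0: "m \<noteq> 0" using m by auto
      show False
      proof (rule directions_pigeonhole[of "\<tau> x t" "\<tau> ?y t" "\<tau> x u" m])
        show "\<tau> x t \<noteq> \<tau> ?y t" "\<tau> x t \<noteq> \<tau> x u" "\<tau> ?y t \<noteq> \<tau> x u"
          using ne False u inj[OF step(1)] inj[OF y] by (metis injD)+
        show "m \<noteq> 0" by fact
        fix a
        have "\<phi> x + a *s v (\<tau> x t) \<in> W" using phiW[OF step(1)] by simp
        \<comment> \<open>Surjectivity of \<open>\<phi>\<close> makes every scalar \<open>a\<close>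
          occur: the point with parameter \<open>a\<close> on the image line comes from a point
          \<open>z\<close> of the line through \<open>x\<close>.\<close>
        then obtain z where z: "z \<in> W" "\<phi> z = \<phi> x + a *s v (\<tau> x t)"
          using phi by (metis bij_betw_imp_surj_on imageE)
        hence "dir x z t" using dir[OF step(1) z(1), of t] by simp
        then obtain k where k: "z = x + k *s v t" by (auto simp: dir_def)
        let ?z = "?y + k *s v t"
        have zW: "?z \<in> W" using y by simp
        have "dir (\<phi> ?y) (\<phi> ?z) (\<tau> ?y t)" using dir[OF y zW, of t] by simp
        then obtain l where l: "\<phi> ?z = \<phi> ?y + l *s v (\<tau> ?y t)" by (auto simp: dir_def)
        have zz: "?z = z + c *s v u" using k by simp
        have "dir (\<phi> z) (\<phi> ?z) (\<tau> z u)"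
          using dir[OF z(1) zW, of u] zz dir_add by metis
        then obtain j where j: "\<phi> ?z = \<phi> z + j *s v (\<tau> z u)" by (auto simp: dir_def)
        have "a *s v (\<tau> x t) + j *s v (\<tau> z u) = m *s v (\<tau> x u) + l *s v (\<tau> ?y t)"
          using j l m z(2) by (simp add: add.assoc)
        thus "\<exists>r l k. a *s v (\<tau> x t) + k *s v r = m *s v (\<tau> x u) + l *s v (\<tau> ?y t)" by blast
      qed
    qed
  qed
  thus ?case using step by simp
qed

text \<open>A displacement along \<open>v t\<close> has the same image at all base points.
  Parallelograms go to parallelograms, which allows the base point to change by any vector in the
  span of the other directions. If \<open>n + 2 \<le> CARD('a)\<close>, this span is
  \<open>W\<close>; over three elements the movement along \<open>v t\<close> itself is handled by
  \<open>additive_if_card_3\<close>.\<close>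

lemma additive_of_parallel:
  assumes q: "n + 2 \<le> CARD('a) \<or> CARD('a) = 3" and inj_phi: "inj_on \<phi> W"
    and dir: "\<And>x t c. x \<in> W \<Longrightarrow> \<exists>d. \<phi> (x + c *s v t) = \<phi> x + d *s v (\<pi> t)"
    and inj: "inj \<pi>" and x: "x \<in> W" and y: "y \<in> W"
  shows "\<phi> (x + y) - \<phi> 0 = (\<phi> x - \<phi> 0) + (\<phi> y - \<phi> 0)"
proof -
  \<comment> \<open>The two ways round the parallelogram give a relation between
    \<open>v (\<pi> t)\<close> and \<open>v (\<pi> u)\<close>, so opposite sides have equal
    images.\<close>
  have par: "\<phi> (x + m *s v u + c *s v t) - \<phi> (x + m *s v u) = \<phi> (x + c *s v t) - \<phi> x"
    if hx: "x \<in> W" and "u \<noteq> t" for x m u c t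
  proof -
    have W: "x + m *s v u \<in> W" "x + c *s v t \<in> W" using that by auto
    obtain d1 where d1: "\<phi> (x + m *s v u + c *s v t) = \<phi> (x + m *s v u) + d1 *s v (\<pi> t)"
      using dir[OF W(1)] by blast
    obtain d2 where d2: "\<phi> (x + c *s v t) = \<phi> x + d2 *s v (\<pi> t)" using dir[OF hx] by blast
    obtain d3 where d3: "\<phi> (x + c *s v t + m *s v u) = \<phi> (x + c *s v t) + d3 *s v (\<pi> u)"
      using dir[OF W(2)] by blast
    obtain d4 where d4: "\<phi> (x + m *s v u) = \<phi> x + d4 *s v (\<pi> u)" using dir[OF hx] by blast
    have comm: "x + c *s v t + m *s v u = x + m *s v u + c *s v t" by simp
    have "(d1 - d2) *s v (\<pi> t) + (d4 - d3) *s v (\<pi> u) = 0"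
    proof -
      have "(d1 - d2) *s v (\<pi> t) + (d4 - d3) *s v (\<pi> u)
          = (\<phi> x + d4 *s v (\<pi> u) + d1 *s v (\<pi> t)) - (\<phi> x + d2 *s v (\<pi> t) + d3 *s v (\<pi> u))"
        by (simp add: vec.scale_left_diff_distrib)
      also have "\<dots> = 0" using d1 d2 d3 d4 unfolding comm by (simp only: right_minus_eq)
      finally show ?thesis .
    qed
    moreover have "\<pi> t \<noteq> \<pi> u" using inj that by (metis injD)
    ultimately have "d1 - d2 = 0" using v_indep2 by blast
    thus ?thesis using d1 d2 by simp
  qed
  have shift: "\<phi> (x + z + c *s v t) - \<phi> (x + z) = \<phi> (x + c *s v t) - \<phi> x"
    if "x \<in> W" "z \<in> vec.span (v ` (- {t}))" for x z c t
  proof -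
    have "z \<in> W \<and> (\<forall>x\<in>W. \<phi> (x + z + c *s v t) - \<phi> (x + z) = \<phi> (x + c *s v t) - \<phi> x)"
      using that(2)
    proof (induct rule: vec.span_induct_alt)
      case (step k w z)
      then obtain u where u: "w = v u" "u \<noteq> t" by auto
      have "\<phi> (x + (k *s v u + z) + c *s v t) - \<phi> (x + (k *s v u + z)) = \<phi> (x + c *s v t) - \<phi> x" if "x \<in> W" for x
      proof -
        have eq: "x + (k *s v u + z) = x + z + k *s v u" by simp
        have "\<phi> (x + z + c *s v t) - \<phi> (x + z) = \<phi> (x + c *s v t) - \<phi> x" using step that by blast
        thus ?thesis using par[of "x + z" u t k c] step u that unfolding eq by simp
      qed
      thus ?case using step u by simp
    qed simp
    thus ?thesis using that by blast
  qed
  have transl: "\<phi> (x + c *s v t) - \<phi> x = \<phi> (c *s v t) - \<phi> 0" if x: "x \<in> W" for x c t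
  proof (cases "n + 2 \<le> CARD('a)")
    case True
    hence "vec.span (v ` (- {t})) = W"
      by (intro span_v) (simp add: Compl_eq_Diff_UNIV)
    thus ?thesis using shift[of 0 x t c] x by simp
  next
    \<comment> \<open>Here \<open>n = 2\<close> and \<open>q = 3\<close>. Without \<open>t\<close>
      only two directions are left, so \<open>x\<close> is split into a multiple of
      \<open>v t\<close> and a vector covered by \<open>shift\<close>.\<close>
    case False
    with q have 3: "CARD('a) = 3" by simp
    have "UNIV = insert t (- {t})" by auto
    hence "x \<in> vec.span (insert (v t) (v ` (- {t})))" using x span_range_v by (metis image_insert)
    then obtain k where k: "x - k *s v t \<in> vec.span (v ` (- {t}))"
      using vec.span_breakdown_eq by blast
    have "\<forall>c. \<exists>d. \<phi> (c *s v t) = \<phi> 0 + d *s v (\<pi> t)" using dir[of 0 _ t] by simp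
    then obtain f where f: "\<And>c. \<phi> (c *s v t) = \<phi> 0 + f c *s v (\<pi> t)" by metis
    have "inj f"
    proof (rule injI)
      fix c d assume "f c = f d"
      hence "\<phi> (c *s v t) = \<phi> (d *s v t)" using f by simp
      hence "c *s v t = d *s v t" by (rule inj_onD[OF inj_phi]) auto
      thus "c = d" by simp
    qed
    moreover have "f 0 = 0" using f[of 0] by simp
    ultimately have "f (k + c) = f k + f c" using additive_if_card_3[OF 3] by blast
    hence "\<phi> (k *s v t + c *s v t) - \<phi> (k *s v t) = \<phi> (c *s v t) - \<phi> 0"
      using f[of "k + c"] f[of k] f[of c] by (simp add: vec.scale_left_distrib)
    thus ?thesis using shift[OF _ k, of "k *s v t" c] by simp
  qed
  show ?thesis using y
  proof (induct rule: W_induct)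
    case (step y c t)
    have "\<phi> (x + y + c *s v t) = \<phi> (x + y) + (\<phi> (c *s v t) - \<phi> 0)"
      "\<phi> (y + c *s v t) = \<phi> y + (\<phi> (c *s v t) - \<phi> 0)"
      using transl[of y c t] transl[of "x + y" c t] step x by (simp_all add: diff_eq_eq add.commute)
    moreover have "\<phi> (x + y) = (\<phi> x - \<phi> 0) + (\<phi> y - \<phi> 0) + \<phi> 0"
      using step by (metis diff_add_cancel)
    ultimately show ?case by (simp add: add.assoc[symmetric])
  qed simp
qed

end

section \<open>Relations between points of the moment curve\<close>

lemma finite_UNIV_choose:
  assumes "card (A :: 'a::finite set) < CARD('a)"
  shows "\<exists>x. x \<notin> A"
  using assms by (metis UNIV_eq_I less_irrefl)

definition cross_ratio :: "'a::field \<Rightarrow> 'a \<Rightarrow> 'a \<Rightarrow> 'a \<Rightarrow> 'a" where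
  "cross_ratio t u s s' = ((t - s) * (u - s')) / ((u - s) * (t - s'))"

text \<open>An affine normalisation makes the permutation fix 0 and 1. Cross-ratios involving 0 and
  1 then turn \<open>1 / p s\<close> into an affine function of \<open>1 / \<sigma> s\<close>. With
  a nonzero constant term this function would vanish for some \<open>s\<close>, so it is a multiple,
  and the value at 1 shows that the multiple is trivial.\<close>

lemma permutation_preserving_cross_ratios:
  fixes \<pi> :: "'a::{field,finite} \<Rightarrow> 'a"
  assumes q: "4 \<le> CARD('a)" and \<sigma>: "field_automorphism \<sigma>" and inj: "inj \<pi>"
    and cr: "\<And>t u s s'. distinct [t, u, s, s'] \<Longrightarrow>
      cross_ratio (\<pi> t) (\<pi> u) (\<pi> s) (\<pi> s') = \<sigma> (cross_ratio t u s s')"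
  shows "\<pi> t = (\<pi> 1 - \<pi> 0) * \<sigma> t + \<pi> 0"
proof -
  note \<sigma>s = field_automorphism_simps[OF \<sigma>]
  have inj': "\<pi> x = \<pi> y \<longleftrightarrow> x = y" for x y using inj by (simp add: inj_eq)
  define D where "D = \<pi> 1 - \<pi> 0"
  have D: "D \<noteq> 0" by (simp add: D_def inj')
  define p where "p t = (\<pi> t - \<pi> 0) / D" for t
  have p0: "p 0 = 0" and p1: "p 1 = 1" using D by (auto simp: p_def D_def)
  have p_inj: "p x = p y \<longleftrightarrow> x = y" for x y using D by (simp add: p_def inj')
  have pi_p: "\<pi> t = D * p t + \<pi> 0" for t using D by (simp add: p_def)
  have p_cr: "(p t - p s) / (p s * (p t - 1)) = (\<sigma> t - \<sigma> s) / (\<sigma> s * (\<sigma> t - 1))"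
    if "t \<notin> {0, 1}" "s \<notin> {0, 1}" "s \<noteq> t" for s t
  proof -
    have nz: "p s \<noteq> 0" "p t \<noteq> 1" "\<sigma> s \<noteq> 0" "\<sigma> t \<noteq> 1"
      using that p_inj[of s 0] p_inj[of t 1] p0 p1 \<sigma>s(2) \<sigma>s(7)[of t 1] \<sigma>s(8)[of s] by auto
    have "((\<pi> t - \<pi> s) * (\<pi> 0 - \<pi> 1)) / ((\<pi> 0 - \<pi> s) * (\<pi> t - \<pi> 1))
        = (D * (p t - p s) * (D * (0 - 1))) / (D * (0 - p s) * (D * (p t - 1)))"
      by (simp add: pi_p[of t] pi_p[of s] pi_p[of 1] p0 p1 algebra_simps)
    also have "\<dots> = (p t - p s) / (p s * (p t - 1))"
      using D nz by (simp add: divide_simps)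
    finally have E: "((\<pi> t - \<pi> s) * (\<pi> 0 - \<pi> 1)) / ((\<pi> 0 - \<pi> s) * (\<pi> t - \<pi> 1))
        = (p t - p s) / (p s * (p t - 1))" .
    have E': "\<sigma> (((t - s) * (0 - 1)) / ((0 - s) * (t - 1))) = (\<sigma> t - \<sigma> s) / (\<sigma> s * (\<sigma> t - 1))"
      using nz by (simp add: \<sigma>s divide_simps)
    have "distinct [t, 0, s, 1]" using that by auto
    from cr[OF this] show ?thesis unfolding cross_ratio_def E E' .
  qed
  have "card {0, 1 :: 'a} < CARD('a)" using q by (simp add: card_insert_if)
  then obtain t0 where t0: "t0 \<notin> {0, 1 :: 'a}" using finite_UNIV_choose by blast
  have nz: "p t0 \<noteq> 0" "p t0 \<noteq> 1" "\<sigma> t0 \<noteq> 0" "\<sigma> t0 \<noteq> 1"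
    using t0 p_inj[of t0 0] p_inj[of t0 1] p0 p1 \<sigma>s(2) \<sigma>s(7)[of t0 1] \<sigma>s(8)[of t0] by auto
  define K where "K = (p t0 - 1) / (\<sigma> t0 - 1)"
  have K0: "K \<noteq> 0" using nz by (simp add: K_def)
  have lin: "p t0 / p s = 1 - K + K * (\<sigma> t0 / \<sigma> s)" if s: "s \<noteq> 0" for s
  proof -
    have nzs: "p s \<noteq> 0" "\<sigma> s \<noteq> 0" using s p_inj[of s 0] p0 by (auto simp: \<sigma>s)
    consider "s = 1" | "s = t0" | "s \<notin> {0, 1}" "s \<noteq> t0" using s by auto
    thus ?thesis
    proof cases
      case 1
      have "K * (\<sigma> t0 - 1) = p t0 - 1" using nz by (simp add: K_def)
      thus ?thesis using 1 by (simp add: p1 \<sigma>s algebra_simps)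
    next
      case 2 thus ?thesis using nz by simp
    next
      case 3
      have "p t0 / p s - 1 = (p t0 - 1) * ((p t0 - p s) / (p s * (p t0 - 1)))"
        using nz nzs by (simp add: field_simps)
      also have "\<dots> = K * (\<sigma> t0 / \<sigma> s - 1)"
        using nz nzs unfolding p_cr[OF t0 3] K_def by (simp add: field_simps)
      finally show ?thesis by (simp add: algebra_simps)
    qed
  qed
  have "K = 1"
  proof (rule ccontr)
    assume "K \<noteq> 1"
    \<comment> \<open>The argument at which the right-hand side of \<open>lin\<close> vanishes,
      while the left-hand side never does.\<close>
    define s where "s = inv_into UNIV \<sigma> (K * \<sigma> t0 / (K - 1))"
    have "surj \<sigma>" using \<sigma> by (simp add: field_automorphism_def bij_def)
    hence s: "\<sigma> s = K * \<sigma> t0 / (K - 1)" by (simp add: s_def surj_f_inv_f)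
    hence "\<sigma> s \<noteq> 0" using \<open>K \<noteq> 1\<close> K0 nz by simp
    hence "s \<noteq> 0" by (simp add: \<sigma>s)
    have "p t0 / p s = 1 - K + K * (\<sigma> t0 / \<sigma> s)" using lin[OF \<open>s \<noteq> 0\<close>] .
    also have "\<dots> = 0" using s \<open>\<sigma> s \<noteq> 0\<close> \<open>K \<noteq> 1\<close> K0 nz by (simp add: field_simps)
    finally show False using nz p_inj[of s 0] p0 \<open>s \<noteq> 0\<close> by simp
  qed
  hence ratio: "p t0 / p s = \<sigma> t0 / \<sigma> s" if "s \<noteq> 0" for s using lin[OF that] by simp
  hence "p t0 = \<sigma> t0" using p1 \<sigma>s(2) by (metis div_by_1 zero_neq_one)
  hence "p s = \<sigma> s" if "s \<noteq> 0" for s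
    using ratio[OF that] nz p_inj[of s 0] p0 that by (simp add: \<sigma>s field_simps)
  hence "p t = \<sigma> t" using p0 \<sigma>s(1) by (cases "t = 0") auto
  thus ?thesis using pi_p[of t] by (simp add: D_def)
qed

section \<open>Scalar functions along the directions and the multipliers they respect\<close>

context moment_curve begin

text \<open>An additive map \<open>g\<close> that sends multiples of \<open>v t\<close> to multiples
  of \<open>v (\<pi> t)\<close> is recorded by the functions \<open>f t\<close> with
  \<open>g (c *s v t) = f t c *s v (\<pi> t)\<close>. The last condition is the image under
  \<open>g\<close> of \<open>l\<close> times the relation between the directions in
  \<open>S\<close>.\<close>

definition direction_maps :: "('a \<Rightarrow> 'a \<Rightarrow> 'a) \<Rightarrow> ('a \<Rightarrow> 'a) \<Rightarrow> bool" where
  "direction_maps f \<pi> \<longleftrightarrow> inj \<pi> \<and> (\<forall>t. inj (f t)) \<and> (\<forall>t x y. f t (x + y) = f t x + f t y) \<and>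
     (\<forall>S l. card S = n + 2 \<longrightarrow> (\<Sum>t\<in>S. f t (l * node_weight S t) *s v (\<pi> t)) = 0)"

lemma direction_mapsD:
  assumes "direction_maps f \<pi>"
  shows "inj \<pi>" "inj (f t)" "f t (x + y) = f t x + f t y" "f t 0 = 0" "f t x = 0 \<longleftrightarrow> x = 0"
    "card S = n + 2 \<Longrightarrow> (\<Sum>t\<in>S. f t (l * node_weight S t) *s v (\<pi> t)) = 0"
proof -
  show *: "inj \<pi>" "inj (f t)" "f t (x + y) = f t x + f t y" for x y
    using assms by (auto simp: direction_maps_def)
  show "card S = n + 2 \<Longrightarrow> (\<Sum>t\<in>S. f t (l * node_weight S t) *s v (\<pi> t)) = 0"
    using assms by (auto simp: direction_maps_def)
  show z: "f t 0 = 0" using *(3)[of 0 0] by (metis add_cancel_right_left add_0)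
  show "f t x = 0 \<longleftrightarrow> x = 0" using *(2) z by (metis injD)
qed

text \<open>Both the values of the functions and the weights of the image set are coefficients of a
  relation between the vectors \<open>v (\<pi> t)\<close>, and such a relation is unique up to a
  scalar. The product form eliminates this scalar.\<close>

lemma direction_maps_weights:
  assumes f: "direction_maps f \<pi>" and S: "card S = n + 2" and tu: "t \<in> S" "u \<in> S"
  shows "f t (l * node_weight S t) * node_weight (\<pi> ` S) (\<pi> u)
       = f u (l * node_weight S u) * node_weight (\<pi> ` S) (\<pi> t)"
proof -
  note inj = direction_mapsD(1)[OF f]
  define d where "d x = f (inv_into UNIV \<pi> x) (l * node_weight S (inv_into UNIV \<pi> x))" for x
  have d: "d (\<pi> t) = f t (l * node_weight S t)" for t by (simp add: d_def inj)
  have "(\<Sum>x\<in>\<pi> ` S. d x *s v x) = (\<Sum>t\<in>S. f t (l * node_weight S t) *s v (\<pi> t))"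
    using inj by (subst sum.reindex) (auto intro: inj_on_subset simp: d)
  also have "\<dots> = 0" by (rule direction_mapsD(6)[OF f S])
  finally have "(\<Sum>x\<in>\<pi> ` S. d x *s v x) = 0" .
  moreover have "card (\<pi> ` S) = n + 2" using S inj by (simp add: card_image inj_on_subset)
  ultimately obtain \<mu> where "\<forall>x\<in>\<pi> ` S. d x = \<mu> * node_weight (\<pi> ` S) x"
    using relation_v_unique by blast
  hence "f t (l * node_weight S t) = \<mu> * node_weight (\<pi> ` S) (\<pi> t)" if "t \<in> S" for t
    using that d by auto
  thus ?thesis using tu by simp
qed

lemma obtain_superset:
  fixes t u :: 'a
  assumes "n + 2 \<le> CARD('a)"
  obtains S where "card S = n + 2" "t \<in> S" "u \<in> S"
proof -
  have "card {t, u} \<le> n + 2" using n2 by (simp add: card_insert_if)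
  then obtain S where "{t, u} \<subseteq> S" "card S = n + 2"
    using assms exists_subset_between[of "{t, u}" "n + 2" "UNIV :: 'a set"] by auto
  thus ?thesis using that by auto
qed

text \<open>Two parameters lie in a common set of \<open>n + 2\<close>, whose relation ties the two
  functions to each other; one of them therefore determines all.\<close>

lemma direction_maps_proportional:
  assumes f: "direction_maps f \<pi>" and q: "n + 2 \<le> CARD('a)"
  shows "\<exists>A B. \<forall>l. f t l = B * f u (l * A)"
proof -
  obtain S where S: "card S = n + 2" "t \<in> S" "u \<in> S" using obtain_superset[OF q] by blast
  let ?w = "node_weight S" and ?w' = "\<lambda>t. node_weight (\<pi> ` S) (\<pi> t)"
  have nz: "?w t \<noteq> 0" "?w' u \<noteq> 0" by (auto simp: node_weight_nonzero)
  have "f t l = (?w' t / ?w' u) * f u (l * (?w u / ?w t))" for l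
    using direction_maps_weights[OF f S, of "l / ?w t"] nz by (simp add: field_simps)
  thus ?thesis by blast
qed

text \<open>The law relating \<open>f t\<close> to \<open>f u\<close> is written once for
  \<open>insert s R\<close> and once for \<open>insert s' R\<close>. Eliminating \<open>f t\<close>
  cancels the weights of \<open>R\<close> and leaves a cross-ratio in the argument and another one
  in front of the value.\<close>

lemma cross_ratio_multiplier:
  assumes f: "direction_maps f \<pi>" and q: "n + 3 \<le> CARD('a)" and dist: "distinct [t, u, s, s']"
  shows "f u (l * cross_ratio t u s s')
       = cross_ratio (\<pi> t) (\<pi> u) (\<pi> s) (\<pi> s') * f u l"
proof -
  have inj: "\<pi> x = \<pi> y \<longleftrightarrow> x = y" for x y using direction_mapsD(1)[OF f] by (simp add: inj_eq)
  have "card (- {s, s'}) = CARD('a) - 2" using dist by (simp add: Compl_eq_Diff_UNIV card_Diff_subset)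
  hence "n + 1 \<le> card (- {s, s'})" using q by linarith
  moreover have "card {t, u} \<le> n + 1" using n2 by (simp add: card_insert_if)
  moreover have "{t, u} \<subseteq> - {s, s'}" using dist by auto
  ultimately obtain R where R: "{t, u} \<subseteq> R" "R \<subseteq> - {s, s'}" "card R = n + 1"
    using exists_subset_between[of "{t, u}" "n + 1" "- {s, s'}"] by auto
  let ?r = "node_weight R" and ?r' = "\<lambda>t. node_weight (\<pi> ` R) (\<pi> t)"
  have nz: "?r t \<noteq> 0" "?r u \<noteq> 0" "?r' t \<noteq> 0" "?r' u \<noteq> 0" by (auto simp: node_weight_nonzero)
  have main: "f t l = f u (l * ((t - x) * ?r u / (?r t * (u - x)))) * (?r' t * (\<pi> u - \<pi> x) / (?r' u * (\<pi> t - \<pi> x)))"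
    if x: "x \<in> {s, s'}" for x l
  proof -
    have xR: "x \<notin> R" "\<pi> x \<notin> \<pi> ` R" using R x inj by auto
    have nx: "t - x \<noteq> 0" "u - x \<noteq> 0" "\<pi> t - \<pi> x \<noteq> 0" "\<pi> u - \<pi> x \<noteq> 0" using dist x inj by auto
    have S: "card (insert x R) = n + 2" using R xR by simp
    have w: "node_weight (insert x R) t = ?r t / (t - x)" "node_weight (insert x R) u = ?r u / (u - x)"
      "node_weight (\<pi> ` insert x R) (\<pi> t) = ?r' t / (\<pi> t - \<pi> x)"
      "node_weight (\<pi> ` insert x R) (\<pi> u) = ?r' u / (\<pi> u - \<pi> x)"
      using R xR by (auto simp: node_weight_insert)
    have "f t (l * (t - x) / ?r t * (?r t / (t - x))) * (?r' u / (\<pi> u - \<pi> x))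
        = f u (l * (t - x) / ?r t * (?r u / (u - x))) * (?r' t / (\<pi> t - \<pi> x))"
      using direction_maps_weights[OF f S, of t u "l * (t - x) / ?r t"] R unfolding w by auto
    moreover have "l * (t - x) / ?r t * (?r t / (t - x)) = l" using nz nx by simp
    moreover have "l * (t - x) / ?r t * (?r u / (u - x)) = l * ((t - x) * ?r u / (?r t * (u - x)))" by simp
    ultimately have *: "f t l * (?r' u / (\<pi> u - \<pi> x))
        = f u (l * ((t - x) * ?r u / (?r t * (u - x)))) * (?r' t / (\<pi> t - \<pi> x))" by (simp only:)
    have div: "a = b * (c * y' / (d * y))" if "a * (d / y') = b * (c / y)" "d \<noteq> 0" "y' \<noteq> 0" "y \<noteq> 0" for a b c d y y' :: 'a
      using that by (simp add: field_simps)
    show ?thesis by (rule div[OF * nz(4) nx(4,3)])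
  qed
  let ?A = "\<lambda>x. (t - x) * ?r u / (?r t * (u - x))" and ?B = "\<lambda>x. ?r' t * (\<pi> u - \<pi> x) / (?r' u * (\<pi> t - \<pi> x))"
  have nzs: "t - s \<noteq> 0" "u - s \<noteq> 0" "\<pi> t - \<pi> s \<noteq> 0" "\<pi> u - \<pi> s \<noteq> 0"
     "t - s' \<noteq> 0" "u - s' \<noteq> 0" "\<pi> t - \<pi> s' \<noteq> 0" "\<pi> u - \<pi> s' \<noteq> 0"
    using dist inj by auto
  have AB: "?A s \<noteq> 0" "?A s' \<noteq> 0" "?B s \<noteq> 0" "?B s' \<noteq> 0" using nz nzs by auto
  have div_mult: "l / a * a = l" if "a \<noteq> 0" for a l :: 'a
    using that by simp
  have solve: "x = (c / b) * y" if "x * b = y * c" "b \<noteq> 0" for b c x y :: 'a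
    using that by (simp add: field_simps)
  have ratio: "l / (a' * x / (y * b')) * (a * x / (y * b)) = l * (a * b' / (b * a'))"
    if "x \<noteq> 0" "y \<noteq> 0" "b \<noteq> 0" "b' \<noteq> 0" "a' \<noteq> 0" for a b a' b' x y l :: 'a
    using that by (simp add: field_simps)
  have ratio': "x * b' / (y * a') / (x * b / (y * a)) = a * b' / (b * a')"
    if "x \<noteq> 0" "y \<noteq> 0" "a \<noteq> 0" "b \<noteq> 0" "a' \<noteq> 0" for a b a' b' x y :: 'a
    using that by (simp add: field_simps)
  have "f u (l / ?A s' * ?A s) * ?B s = f u (l / ?A s' * ?A s') * ?B s'"
    using main[of s "l / ?A s'"] main[of s' "l / ?A s'"] by simp
  also have "l / ?A s' * ?A s' = l" by (rule div_mult[OF AB(2)])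
  finally have "f u (l / ?A s' * ?A s) = (?B s' / ?B s) * f u l" by (rule solve[OF _ AB(3)])
  moreover have "l / ?A s' * ?A s = l * (((t - s) * (u - s')) / ((u - s) * (t - s')))"
    by (rule ratio[OF nz(2,1) nzs(2,6,5)])
  moreover have "?B s' / ?B s = ((\<pi> t - \<pi> s) * (\<pi> u - \<pi> s')) / ((\<pi> u - \<pi> s) * (\<pi> t - \<pi> s'))"
    by (rule ratio'[OF nz(3,4) nzs(3,4,7)])
  ultimately show ?thesis unfolding cross_ratio_def by (simp only:)
qed

text \<open>The set \<open>M\<close> of scalars that can be moved out of the argument of
  \<open>f 0\<close> is closed under addition and contains the cross-ratios of
  \<open>1, 0, s, s'\<close> for a fixed \<open>s'\<close>. These generate the whole field, so
  \<open>f 0\<close> divided by its value at 1 is multiplicative, and every other \<open>f t\<close>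
  is obtained from \<open>f 0\<close> by rescaling.\<close>

lemma direction_maps_automorphism:
  assumes f: "direction_maps f \<pi>" and q: "n + 3 \<le> CARD('a)"
  shows "\<exists>\<sigma>. field_automorphism \<sigma> \<and> (\<forall>t c. f t c = \<sigma> c * f t 1)"
proof -
  note fs = direction_mapsD[OF f]
  define M where "M = {m. \<exists>m'. \<forall>l. f 0 (l * m) = m' * f 0 l}"
  have M_add: "x + y \<in> M" if xy: "x \<in> M" "y \<in> M" for x y
  proof -
    obtain x' y' where "\<forall>l. f 0 (l * x) = x' * f 0 l" "\<forall>l. f 0 (l * y) = y' * f 0 l"
      using xy by (auto simp: M_def)
    hence "\<forall>l. f 0 (l * (x + y)) = (x' + y') * f 0 l" by (simp add: ring_distribs fs(3))
    thus ?thesis by (auto simp: M_def)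
  qed
  have M01: "0 \<in> M" "1 \<in> M" by (auto simp: M_def fs intro: exI[of _ 0] exI[of _ 1])
  have "card {0, 1 :: 'a} < CARD('a)" using q n2 by (simp add: card_insert_if)
  then obtain s' where s': "s' \<notin> {0, 1 :: 'a}" using finite_UNIV_choose by blast
  \<comment> \<open>The limit of the cross-ratio of \<open>1, 0, s, s'\<close> as \<open>s\<close>
    goes to infinity. It is missed by the admissible \<open>s\<close>, like the value 0 at
    \<open>s = 1\<close> and the value 1 at \<open>s = s'\<close>.\<close>
  define m0 where "m0 = - s' / (1 - s')"
  have m0: "m0 \<noteq> 0" using s' by (simp add: m0_def)
  have M_gen: "m \<in> M" if m: "m \<notin> {0, 1, m0}" for m
  proof -
    define s where "s = m0 / (m0 - m)"
    have mm0: "m0 - m \<noteq> 0" using m by auto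
    have s0: "s \<noteq> 0" "s \<noteq> 1" using m m0 mm0 by (auto simp: s_def field_simps)
    have cr: "cross_ratio 1 0 s s' = m"
    proof -
      have "((1 - s) * (0 - s')) / ((0 - s) * (1 - s')) = ((1 - s) / (0 - s)) * m0"
        by (simp add: m0_def)
      also have "(1 - s) / (0 - s) = m / m0"
        using m m0 mm0 by (simp add: s_def divide_simps)
      finally show ?thesis using m0 by (simp add: cross_ratio_def)
    qed
    have "s \<noteq> s'"
    proof
      assume "s = s'"
      hence "m = 1" using cr s' s0 by (simp add: cross_ratio_def)
      thus False using m by simp
    qed
    hence "distinct [1, 0, s, s']" using s0 s' by auto
    from cross_ratio_multiplier[OF f q this] show ?thesis unfolding cr M_def by blast
  qed
  have "m0 \<in> M"
  proof -
    \<comment> \<open>Since \<open>q \<ge> n + 3 \<ge> 5\<close>, the missing value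
      \<open>m0\<close> is a sum of two cross-ratios \<open>x\<close> and
      \<open>m0 - x\<close>.\<close>
    have "card {0, 1, m0, m0 - 1} < CARD('a)" using q n2 by (simp add: card_insert_if)
    then obtain x where x: "x \<notin> {0, 1, m0, m0 - 1}" using finite_UNIV_choose by blast
    hence "m0 - x \<notin> {0, 1, m0}" by (auto simp: algebra_simps)
    hence "(m0 - x) + x \<in> M" using x by (intro M_add M_gen) auto
    thus ?thesis by simp
  qed
  hence all: "m \<in> M" for m using M_gen[of m] M01 by blast
  have f01: "f 0 1 \<noteq> 0" by (simp add: fs)
  define \<sigma> where "\<sigma> m = f 0 m / f 0 1" for m
  have f0: "f 0 (l * m) = \<sigma> m * f 0 l" for l m
  proof -
    obtain m' where m': "\<forall>l. f 0 (l * m) = m' * f 0 l" using all[of m] by (auto simp: M_def)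
    hence "f 0 m = m' * f 0 1" by (metis mult_1)
    thus ?thesis using m' f01 by (simp add: \<sigma>_def)
  qed
  have "inj \<sigma>" using f01 fs(2)[of 0] by (simp add: \<sigma>_def inj_def)
  moreover have "\<sigma> (x * y) = \<sigma> x * \<sigma> y" for x y
    using f0[of x y] f01 by (simp add: \<sigma>_def)
  moreover have "\<sigma> (x + y) = \<sigma> x + \<sigma> y" for x y by (simp add: \<sigma>_def fs add_divide_distrib)
  ultimately have aut: "field_automorphism \<sigma>"
    by (simp add: field_automorphism_def bij_def finite_UNIV_inj_surj)
  have "f t c = \<sigma> c * f t 1" for t c
  proof -
    obtain A B where AB: "\<And>l. f t l = B * f 0 (l * A)"
      using direction_maps_proportional[OF f, of t 0] q by auto
    show ?thesis using f0[of A c] f0[of 1 A] AB[of c] AB[of 1] by (simp add: mult.commute[of c] mult_ac)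
  qed
  with aut show ?thesis by blast
qed

text \<open>Every element of a prime field is a repeated sum of 1, so additivity alone gives
  linearity.\<close>

lemma direction_maps_prime:
  assumes f: "direction_maps f \<pi>" and q: "prime CARD('a)"
  shows "f t c = c * f t 1"
proof -
  note fs = direction_mapsD[OF f]
  have "CHAR('a) = CARD('a)" by (rule CHAR_eq_prime[of _ 1]) (use q in auto)
  hence "c \<in> range of_nat"
    by (intro prime_field_eq_range_of_nat) (simp add: finite_field_pow_card)
  then obtain k where "c = of_nat k" by blast
  moreover have "f t (of_nat k) = of_nat k * f t 1"
    by (induct k) (simp_all add: fs ring_distribs)
  ultimately show ?thesis by simp
qed

text \<open>Semilinear maps with companion \<open>\<sigma>\<close> that send every \<open>v t\<close> to a multiple of \<open>v (\<pi> t)\<close> map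
  linear relations between the \<open>v t\<close> to relations, which are unique up to a scalar.\<close>

definition compatible :: "('a \<Rightarrow> 'a) \<Rightarrow> ('a \<Rightarrow> 'a) \<Rightarrow> bool" where
  "compatible \<sigma> \<pi> \<longleftrightarrow> field_automorphism \<sigma> \<and> bij \<pi> \<and>
     (\<forall>S. card S = n + 2 \<longrightarrow>
        (\<exists>\<mu>. \<mu> \<noteq> 0 \<and> (\<forall>t\<in>S. node_weight (\<pi> ` S) (\<pi> t) = \<mu> * \<sigma> (node_weight S t))))"

lemma compatible_affine:
  assumes "field_automorphism \<sigma>" "\<And>t. \<pi> t = \<alpha> * \<sigma> t + \<beta>" "\<alpha> \<noteq> 0"
  shows "compatible \<sigma> \<pi>"
proof -
  note s = field_automorphism_simps[OF assms(1)]
  have "inj \<pi>" using assms(2,3) s by (auto simp: inj_def)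
  hence "bij \<pi>" by (simp add: bij_def finite_UNIV_inj_surj)
  moreover have "\<exists>\<mu>. \<mu> \<noteq> 0 \<and> (\<forall>t\<in>S. node_weight (\<pi> ` S) (\<pi> t) = \<mu> * \<sigma> (node_weight S t))"
    for S
    using node_weight_image_affine[OF assms] assms(3)
    by (intro exI[of _ "inverse (\<alpha> ^ (card S - 1))"]) auto
  ultimately show ?thesis using assms(1) by (auto simp: compatible_def)
qed

text \<open>Whatever \<open>t\<close> is, the differences \<open>t - k\<close> run through all
  nonzero field elements.\<close>

lemma node_weight_UNIV: "node_weight (UNIV :: 'a set) t = node_weight UNIV 0"
proof -
  have "(\<Prod>k\<in>UNIV - {t}. t - k) = (\<Prod>k\<in>UNIV - {0}. 0 - k)"
    by (rule prod.reindex_bij_witness[of _ "\<lambda>k. k + t" "\<lambda>k. k - t"]) auto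
  thus ?thesis by (simp add: node_weight_def)
qed

lemma compatible_permutation:
  assumes "CARD('a) = n + 2" "field_automorphism \<sigma>" "bij \<pi>"
  shows "compatible \<sigma> \<pi>"
proof -
  have "\<exists>\<mu>. \<mu> \<noteq> 0 \<and> (\<forall>t\<in>S. node_weight (\<pi> ` S) (\<pi> t) = \<mu> * \<sigma> (node_weight S t))"
    if S: "card S = n + 2" for S
  proof -
    have S: "S = UNIV" using S assms by (intro card_seteq) auto
    have im: "\<pi> ` UNIV = UNIV" using assms(3) by (simp add: bij_is_surj)
    have nz: "\<sigma> (node_weight UNIV 0) \<noteq> 0" "node_weight UNIV (0 :: 'a) \<noteq> 0"
      using field_automorphism_simps(8)[OF assms(2)] by (simp_all add: node_weight_nonzero)
    have "node_weight (\<pi> ` S) (\<pi> t) = node_weight UNIV 0 / \<sigma> (node_weight UNIV 0) * \<sigma> (node_weight S t)" for t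
      using nz(1) node_weight_UNIV[of "\<pi> t"] node_weight_UNIV[of t] unfolding S im by simp
    thus ?thesis using nz by (intro exI[of _ "node_weight UNIV 0 / \<sigma> (node_weight UNIV 0)"]) auto
  qed
  thus ?thesis using assms by (auto simp: compatible_def)
qed

text \<open>For functions of the form \<open>\<sigma> c * k t\<close> the multiplier law says that
  \<open>\<pi>\<close> carries cross-ratios to their images under \<open>\<sigma>\<close>, hence is
  affine over \<open>\<sigma>\<close>. For \<open>q = n + 2\<close> compatibility holds for every
  permutation. Once the weights are known to agree up to a common factor, the weight law forces
  \<open>k\<close> to be constant.\<close>

lemma direction_maps_compatible:
  assumes f: "direction_maps (\<lambda>t c. \<sigma> c * k t) \<pi>" and \<sigma>: "field_automorphism \<sigma>"
    and q: "n + 2 \<le> CARD('a)"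
  shows "compatible \<sigma> \<pi>" "k t = k u" "n + 3 \<le> CARD('a) \<Longrightarrow> \<pi> t = (\<pi> 1 - \<pi> 0) * \<sigma> t + \<pi> 0"
proof -
  note fs = direction_mapsD[OF f] and s = field_automorphism_simps[OF \<sigma>]
  have k: "k t \<noteq> 0" for t using fs(5)[where t = t and x = 1] by (simp add: s)
  show aff: "\<pi> t = (\<pi> 1 - \<pi> 0) * \<sigma> t + \<pi> 0" if q: "n + 3 \<le> CARD('a)" for t
  proof (rule permutation_preserving_cross_ratios[OF _ \<sigma> fs(1)])
    show "4 \<le> CARD('a)" using q n2 by simp
    fix t u s s' :: 'a assume "distinct [t, u, s, s']"
    from cross_ratio_multiplier[OF f q this, of 1]
    have "\<sigma> (cross_ratio t u s s') * k u
        = cross_ratio (\<pi> t) (\<pi> u) (\<pi> s) (\<pi> s') * k u"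
      by (simp only: mult_1_left s(2))
    thus "cross_ratio (\<pi> t) (\<pi> u) (\<pi> s) (\<pi> s') = \<sigma> (cross_ratio t u s s')"
      by (simp only: mult_right_cancel[OF k])
  qed
  show comp: "compatible \<sigma> \<pi>"
  proof (cases "n + 3 \<le> CARD('a)")
    case True
    thus ?thesis using compatible_affine[OF \<sigma> aff[OF True]] fs(1) by (simp add: inj_eq)
  next
    case False
    thus ?thesis using compatible_permutation[OF _ \<sigma>] fs(1) q by (simp add: bij_def finite_UNIV_inj_surj)
  qed
  obtain S where S: "card S = n + 2" "t \<in> S" "u \<in> S" using obtain_superset[OF q] by blast
  obtain \<mu> where \<mu>: "\<mu> \<noteq> 0" "\<forall>t\<in>S. node_weight (\<pi> ` S) (\<pi> t) = \<mu> * \<sigma> (node_weight S t)"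
    using comp S by (auto simp: compatible_def)
  have "\<sigma> (node_weight S x) \<noteq> 0" for x by (simp add: s node_weight_nonzero)
  thus "k t = k u"
    using direction_maps_weights[OF f S, of 1] \<mu> S by (simp add: mult_ac)
qed

section \<open>Realising permutations of the parameters by semilinear maps\<close>

lemma independent_frame:
  assumes "card T = n + 1"
  shows "vec.independent (insert e (v ` T))"
  using independent_v[of T] span_v[of T] assms by (simp add: vec.independent_insertI)

text \<open>The range is a subspace that contains \<open>W\<close> and \<open>e\<close>, hence
  everything; on a finite space surjectivity is enough.\<close>

lemma semilinear_bij_if_covers_W:
  assumes f: "semilinear \<sigma> f" and fe: "f e - e \<in> W" and W: "W \<subseteq> range f"
  shows "semilinear_bij f"
proof -
  have sub: "vec.subspace (range f)"
    using semilinear_image_span[OF f, of UNIV] by (metis vec.span_UNIV vec.subspace_span)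
  have "f e - (f e - e) \<in> range f"
    by (rule vec.subspace_diff[OF sub]) (use fe W in auto)
  hence "e \<in> range f" by simp
  hence "c *s e + w \<in> range f" if "w \<in> W" for c w
    using that W by (intro vec.subspace_add[OF sub] vec.subspace_scale[OF sub]) auto
  hence "surj f" using e_decomp by (metis surj_def rangeE)
  hence "bij f" by (simp add: bij_def finite_UNIV_surj_inj)
  thus ?thesis using f by (auto simp: semilinear_bij_iff)
qed

text \<open>The map is prescribed on the frame of \<open>e\<close> and \<open>n + 1\<close> of the
  vectors \<open>v t\<close>. The image of any further \<open>v t\<close> is forced by its relation
  to them, and compatibility says that the vectors \<open>k *s v (\<pi> t)\<close> satisfy the image
  of this relation.\<close>

lemma compatible_realisation:
  assumes comp: "compatible \<sigma> \<pi>" and k: "k \<noteq> 0" and w0: "w0 \<in> W"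
  shows "\<exists>f. semilinear \<sigma> f \<and> semilinear_bij f \<and> f e = e + w0 \<and> (\<forall>t. f (v t) = k *s v (\<pi> t))"
proof -
  have \<sigma>: "field_automorphism \<sigma>" and bij: "bij \<pi>" using comp by (auto simp: compatible_def)
  note s = field_automorphism_simps[OF \<sigma>]
  obtain T :: "'a set" where T: "card T = n + 1" using nq by (metis ex_card)
  obtain f where f: "semilinear \<sigma> f"
    "\<forall>x\<in>insert e (v ` T). f x = (if x = e then e + w0 else k *s v (\<pi> (inv_into UNIV v x)))"
    using semilinear_extend[OF independent_frame[OF T] \<sigma>,
      of "\<lambda>x. if x = e then e + w0 else k *s v (\<pi> (inv_into UNIV v x))"] by blast
  have ve: "v t \<noteq> e" for t using v_in_W e_notin by metis
  have fe: "f e = e + w0" using f(2) by simp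
  have fT: "f (v t) = k *s v (\<pi> t)" if "t \<in> T" for t
    using f(2) that ve by (simp add: inj_v)
  note fs = semilinear_simps[OF f(1)]
  have fv: "f (v t) = k *s v (\<pi> t)" for t
  proof (cases "t \<in> T")
    case False
    let ?S = "insert t T"
    have S: "card ?S = n + 2" using False T by simp
    obtain \<mu> where \<mu>: "\<mu> \<noteq> 0" "\<forall>u\<in>?S. node_weight (\<pi> ` ?S) (\<pi> u) = \<mu> * \<sigma> (node_weight ?S u)"
      using comp S unfolding compatible_def by blast
    have inj: "inj \<pi>" using bij by (simp add: bij_def)
    have "card (\<pi> ` ?S) = n + 2" using S inj by (metis card_image inj_on_subset subset_UNIV)
    from relation_v[OF this]
    have "(\<Sum>u\<in>?S. node_weight (\<pi> ` ?S) (\<pi> u) *s v (\<pi> u)) = 0"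
      by (subst (asm) sum.reindex[OF inj_on_subset[OF inj subset_UNIV]]) (simp only: o_def)
    moreover have "(\<Sum>u\<in>?S. node_weight (\<pi> ` ?S) (\<pi> u) *s v (\<pi> u))
        = \<mu> *s (\<Sum>u\<in>?S. \<sigma> (node_weight ?S u) *s v (\<pi> u))"
      unfolding vec.scale_sum_right
    proof (intro sum.cong refl)
      fix x assume "x \<in> ?S"
      hence "node_weight (\<pi> ` ?S) (\<pi> x) = \<mu> * \<sigma> (node_weight ?S x)" using \<mu>(2) by blast
      thus "node_weight (\<pi> ` ?S) (\<pi> x) *s v (\<pi> x) = \<mu> *s (\<sigma> (node_weight ?S x) *s v (\<pi> x))"
        by (simp only: vec.scale_scale)
    qed
    ultimately have r: "(\<Sum>u\<in>?S. \<sigma> (node_weight ?S u) *s v (\<pi> u)) = 0" using \<mu>(1) by simp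
    have "(\<Sum>u\<in>?S. \<sigma> (node_weight ?S u) *s (f (v u) - k *s v (\<pi> u)))
        = f (\<Sum>u\<in>?S. node_weight ?S u *s v u) - k *s (\<Sum>u\<in>?S. \<sigma> (node_weight ?S u) *s v (\<pi> u))"
      by (simp only: fs vec.scale_sum_right vec.scale_right_diff_distrib sum_subtractf vec.scale_scale mult.commute)
    also have "\<dots> = 0" using r relation_v[OF S] by (simp add: fs)
    finally have "\<sigma> (node_weight ?S t) *s (f (v t) - k *s v (\<pi> t)) = 0"
      using False fT by simp
    thus ?thesis by (simp add: s node_weight_nonzero)
  qed (rule fT)
  have "W \<subseteq> range f"
  proof -
    have sub: "vec.subspace (range f)"
      using semilinear_image_span[OF f(1), of UNIV] by (metis vec.span_UNIV vec.subspace_span)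
    have "v t \<in> range f" for t
    proof -
      have "v t = inverse k *s f (v (inv_into UNIV \<pi> t))"
        using fv k bij by (simp add: bij_is_surj surj_f_inv_f)
      thus ?thesis using vec.subspace_scale[OF sub] by (metis rangeI)
    qed
    thus ?thesis using vec.span_minimal[OF _ sub, of "range v"] span_range_v by blast
  qed
  hence "semilinear_bij f" using semilinear_bij_if_covers_W[OF f(1)] fe w0 by simp
  with f(1) fe fv show ?thesis by blast
qed

section \<open>Automorphisms of the incidence structure\<close>

text \<open>Both graphs of the theorem arise from this incidence structure: vertices \<open>pt w\<close> for the points
  \<open>w\<close> of the affine space \<open>W\<close> and \<open>lin w t\<close> for the line through \<open>w\<close> with direction \<open>v t\<close>.\<close>

definition model :: "'v sgraph \<Rightarrow> ('a^'m \<Rightarrow> 'v) \<Rightarrow> ('a^'m \<Rightarrow> 'a \<Rightarrow> 'v) \<Rightarrow> bool" where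
  "model G pt lin \<longleftrightarrow> fst G = pt ` W \<union> (\<lambda>(w, t). lin w t) ` (W \<times> UNIV) \<and> inj_on pt W \<and>
     (\<forall>w\<in>W. \<forall>w'\<in>W. \<forall>t t'. lin w t = lin w' t' \<longleftrightarrow> t = t' \<and> dir w w' t) \<and>
     (\<forall>w\<in>W. \<forall>w'\<in>W. \<forall>t. pt w \<noteq> lin w' t) \<and>
     snd G = {{pt w', lin w t} | w w' t. w \<in> W \<and> w' \<in> W \<and> dir w w' t}"

lemma model_simps:
  assumes M: "model G pt lin"
  shows "w \<in> W \<Longrightarrow> pt w \<in> fst G" "w \<in> W \<Longrightarrow> lin w t \<in> fst G"
    "w \<in> W \<Longrightarrow> w' \<in> W \<Longrightarrow> pt w = pt w' \<longleftrightarrow> w = w'"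
    "w \<in> W \<Longrightarrow> w' \<in> W \<Longrightarrow> lin w t = lin w' t' \<longleftrightarrow> t = t' \<and> dir w w' t"
    "w \<in> W \<Longrightarrow> w' \<in> W \<Longrightarrow> pt w \<noteq> lin w' t"
    "w \<in> W \<Longrightarrow> w' \<in> W \<Longrightarrow> {pt w', lin w t} \<in> snd G \<longleftrightarrow> dir w w' t"
    "w \<in> W \<Longrightarrow> w' \<in> W \<Longrightarrow> {lin w t, pt w'} \<in> snd G \<longleftrightarrow> dir w w' t"
    "w \<in> W \<Longrightarrow> w' \<in> W \<Longrightarrow> {pt w, pt w'} \<notin> snd G"
    "w \<in> W \<Longrightarrow> w' \<in> W \<Longrightarrow> {lin w t, lin w' t'} \<notin> snd G"
proof -
  have V: "fst G = pt ` W \<union> (\<lambda>(w, t). lin w t) ` (W \<times> UNIV)"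
    using M[unfolded model_def] by (elim conjE)
  have inj: "inj_on pt W"
    using M[unfolded model_def] by (elim conjE)
  have lin_eq: "\<forall>w\<in>W. \<forall>w'\<in>W. \<forall>t t'. lin w t = lin w' t' \<longleftrightarrow> t = t' \<and> dir w w' t"
    using M[unfolded model_def] by (elim conjE)
  have pt_lin: "\<forall>w\<in>W. \<forall>w'\<in>W. \<forall>t. pt w \<noteq> lin w' t"
    using M[unfolded model_def] by (elim conjE)
  have E: "snd G = {{pt w', lin w t} | w w' t. w \<in> W \<and> w' \<in> W \<and> dir w w' t}"
    using M[unfolded model_def] by (elim conjE)
  show "w \<in> W \<Longrightarrow> pt w \<in> fst G" "w \<in> W \<Longrightarrow> lin w t \<in> fst G"
    unfolding V by auto
  show pt: "w \<in> W \<Longrightarrow> w' \<in> W \<Longrightarrow> pt w = pt w' \<longleftrightarrow> w = w'" for w w'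
    by (rule inj_on_eq_iff[OF inj])
  show lin: "w \<in> W \<Longrightarrow> w' \<in> W \<Longrightarrow> lin w t = lin w' t' \<longleftrightarrow> t = t' \<and> dir w w' t" for w w' t t'
    by (rule lin_eq[rule_format])
  show ptln: "w \<in> W \<Longrightarrow> w' \<in> W \<Longrightarrow> pt w \<noteq> lin w' t" for w w' t
    by (rule pt_lin[rule_format])
  show *: "{pt w', lin w t} \<in> snd G \<longleftrightarrow> dir w w' t" if w: "w \<in> W" "w' \<in> W" for w w' t
  proof
    assume "{pt w', lin w t} \<in> snd G"
    then obtain a a' s where a: "{pt w', lin w t} = {pt a', lin a s}" "a \<in> W" "a' \<in> W" "dir a a' s"
      unfolding E by blast
    hence "pt w' = pt a'" "lin w t = lin a s"
      using ptln w by (metis doubleton_eq_iff)+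
    hence "w' = a'" "t = s" "dir w a t" using pt lin w a by auto
    thus "dir w w' t" using dir_trans a by blast
  qed (use w E in blast)
  thus "w \<in> W \<Longrightarrow> w' \<in> W \<Longrightarrow> {lin w t, pt w'} \<in> snd G \<longleftrightarrow> dir w w' t"
    by (simp add: insert_commute)
  show "{pt w, pt w'} \<notin> snd G" if w: "w \<in> W" "w' \<in> W"
  proof
    assume "{pt w, pt w'} \<in> snd G"
    then obtain a a' s where "{pt w, pt w'} = {pt a', lin a s}" "a \<in> W" unfolding E by blast
    hence "lin a s \<in> {pt w, pt w'}" by simp
    thus False using ptln[OF w(1) \<open>a \<in> W\<close>, of s] ptln[OF w(2) \<open>a \<in> W\<close>, of s] by auto
  qed
  show "{lin w t, lin w' t'} \<notin> snd G" if w: "w \<in> W" "w' \<in> W"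
  proof
    assume "{lin w t, lin w' t'} \<in> snd G"
    then obtain a a' s where "{lin w t, lin w' t'} = {pt a', lin a s}" "a' \<in> W" unfolding E by blast
    hence "pt a' \<in> {lin w t, lin w' t'}" by simp
    thus False using ptln[OF \<open>a' \<in> W\<close> w(1), of t] ptln[OF \<open>a' \<in> W\<close> w(2), of t'] by auto
  qed
qed

lemma model_cases:
  assumes "model G pt lin" "u \<in> fst G"
  obtains w where "w \<in> W" "u = pt w" | w t where "w \<in> W" "u = lin w t"
  using assms by (auto simp: model_def)

text \<open>If one point goes to a line, then all points do. The parallel lines of direction
  \<open>v 0\<close> through 0 and through \<open>v 1\<close> then go to points \<open>a\<close> and
  \<open>d\<close>, and \<open>d - a\<close> is a vector excluded by
  \<open>no_direction_covers_all_pairs\<close>.\<close>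

lemma automorphism_no_swap:
  assumes nq': "3 \<le> n \<or> odd CARD('a)" and M: "model G pt lin"
    and bij: "bij_betw \<psi> (fst G) (fst G)"
    and adj: "\<And>u w. u \<in> fst G \<Longrightarrow> w \<in> fst G \<Longrightarrow> {\<psi> u, \<psi> w} \<in> snd G \<longleftrightarrow> {u, w} \<in> snd G"
    and x: "x \<in> W"
  shows "\<exists>y\<in>W. \<psi> (pt x) = pt y"
proof (rule ccontr)
  assume no: "\<not> ?thesis"
  note m = model_simps[OF M]
  have psiV: "\<psi> u \<in> fst G" if "u \<in> fst G" for u using bij that by (auto simp: bij_betw_def)
  define isln where "isln u \<longleftrightarrow> (\<exists>a\<in>W. \<exists>s. u = lin a s)" for u
  define ispt where "ispt u \<longleftrightarrow> (\<exists>a\<in>W. u = pt a)" for u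
  have ln_pt: "ispt w" if "isln u" "{u, w} \<in> snd G" "w \<in> fst G" for u w
    using that m(9) unfolding isln_def ispt_def by (cases rule: model_cases[OF M that(3)]) auto
  have pt_ln: "isln w" if "ispt u" "{u, w} \<in> snd G" "w \<in> fst G" for u w
    using that m(8) unfolding isln_def ispt_def by (cases rule: model_cases[OF M that(3)]) auto
  have lines: "ispt (\<psi> (lin y t))" if "isln (\<psi> (pt y))" "y \<in> W" for y t
    by (rule ln_pt[OF that(1)]) (use that adj m psiV in auto)
  have x0: "isln (\<psi> (pt x))"
    using no psiV[OF m(1)[OF x]] unfolding isln_def by (cases rule: model_cases[OF M psiV[OF m(1)[OF x]]]) auto
  \<comment> \<open>Points are connected by steps along lines, and each step passes two edges, so
    the class of the image is the same for all points.\<close>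
  have swap: "isln (\<psi> (pt (x + y)))" if "y \<in> W" for y
    using that
  proof (induct rule: W_induct)
    case (step y c t)
    have "x + y \<in> W" "x + (y + c *s v t) \<in> W" using step x by auto
    moreover have "dir (x + y) (x + (y + c *s v t)) t"
      using dir_add[of "x + y" c t] by (simp add: add.assoc)
    ultimately have "{\<psi> (lin (x + y) t), \<psi> (pt (x + (y + c *s v t)))} \<in> snd G"
      using adj m by simp
    thus ?case using pt_ln[OF lines] step x psiV m by (metis W_closed(2) v_in_W W_closed(4))
  qed (simp add: x0)
  have pts: "isln (\<psi> (pt y))" if "y \<in> W" for y
    using swap[of "y - x"] that x by simp
  have lns: "ispt (\<psi> (lin y t))" if "y \<in> W" for y t using lines pts that by blast
  obtain a where a: "a \<in> W" "\<psi> (lin 0 0) = pt a" using lns[of 0 0] by (auto simp: ispt_def)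
  obtain d where d: "d \<in> W" "\<psi> (lin (v 1) 0) = pt d" using lns[of "v 1" 0] by (auto simp: ispt_def)
  have preim: "\<exists>z\<in>W. \<psi> (pt z) = lin a t \<and> dir 0 z 0" for t
  proof -
    have "lin a t \<in> fst G" using m a by simp
    then obtain u where u: "u \<in> fst G" "\<psi> u = lin a t"
      using bij by (metis bij_betw_imp_surj_on imageE)
    have "{\<psi> (lin 0 0), \<psi> u} \<in> snd G" using a u m by simp
    hence e: "{lin 0 0, u} \<in> snd G" using adj[of "lin 0 0" u] u(1) m(2)[of 0 0] by simp
    show ?thesis
    proof (cases rule: model_cases[OF M u(1)])
      case (1 w) thus ?thesis using e u m by auto
    next
      case (2 w t') thus ?thesis using e m by auto
    qed
  qed
  show False
  proof (rule no_direction_covers_all_pairs[OF nq'])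
    \<comment> \<open>Otherwise a line would join \<open>a\<close> and \<open>d\<close>, and its
      preimage would be a common point of the two parallel lines.\<close>
    show "d - a \<noteq> c *s v t" for t c
    proof
      assume "d - a = c *s v t"
      hence dir: "dir a d t" by (auto simp: dir_def algebra_simps)
      obtain z where z: "z \<in> W" "\<psi> (pt z) = lin a t" "dir 0 z 0" using preim by blast
      have "{\<psi> (lin (v 1) 0), \<psi> (pt z)} \<in> snd G" using z d a m dir by simp
      hence "{lin (v 1) 0, pt z} \<in> snd G"
        using adj[OF m(2)[of "v 1" 0] m(1)[OF z(1)]] by simp
      hence "dir (v 1) z 0" using z(1) m by simp
      hence "dir 0 (v 1) 0" using z dir_sym dir_trans by blast
      then obtain c where "v 1 + (- c) *s v 0 = 0" by (auto simp: dir_def)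
      thus False using v_indep2[of 1 0 1 "- c"] by simp
    qed
    fix t
    obtain z where z: "z \<in> W" "\<psi> (pt z) = lin a t" "dir 0 z 0" using preim by blast
    \<comment> \<open>The point of the second line that is joined to \<open>z\<close> by a line of
      direction \<open>v 1\<close>. The images form a path from \<open>a\<close> to \<open>d\<close>
      through \<open>r\<close>, with the prescribed direction \<open>v t\<close> in its first
      step.\<close>
    let ?z = "z + v 1"
    have zW: "?z \<in> W" using z by simp
    have "dir (v 1) ?z 0" using z(3) by (auto simp: dir_def)
    have "dir z ?z 1" using dir_add[of z 1 1] by simp
    obtain r where r: "r \<in> W" "\<psi> (lin z 1) = pt r" using lns[OF z(1), of 1] by (auto simp: ispt_def)
    obtain y t' where y: "y \<in> W" "\<psi> (pt ?z) = lin y t'" using pts[OF zW] by (auto simp: isln_def)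
    have "{\<psi> (lin z 1), \<psi> (pt z)} \<in> snd G"
      by (rule adj[THEN iffD2]) (use z(1) m in auto)
    hence 1: "dir a r t" using r z a m by simp
    have "{\<psi> (lin z 1), \<psi> (pt ?z)} \<in> snd G"
      by (rule adj[THEN iffD2]) (use z(1) zW \<open>dir z ?z 1\<close> m in auto)
    hence 2: "dir y r t'" using r y m by simp
    have "{\<psi> (lin (v 1) 0), \<psi> (pt ?z)} \<in> snd G"
      by (rule adj[THEN iffD2]) (use zW \<open>dir (v 1) ?z 0\<close> m in auto)
    hence "dir y d t'" using d y m by simp
    hence "dir r d t'" using 2 dir_sym dir_trans by blast
    with 1 obtain c c' where "r = a + c *s v t" "d = r + c' *s v t'" by (auto simp: dir_def)
    thus "\<exists>u x y. d - a = x *s v t + y *s v u"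
      by (intro exI[of _ t'] exI[of _ c] exI[of _ c']) simp
  qed
qed

text \<open>The chart linearises the affine map: \<open>\<phi> - \<phi> 0\<close> is additive and
  scales by one automorphism \<open>\<sigma>\<close> along every direction, hence on all of
  \<open>W\<close>, and the translation part \<open>\<phi> 0\<close> is absorbed into the image of
  \<open>e\<close>.\<close>

lemma parallel_collineation_semilinear:
  assumes q: "n + 3 \<le> CARD('a) \<or> prime CARD('a) \<and> (n + 2 \<le> CARD('a) \<or> CARD('a) = 3)"
    and phi: "bij_betw \<phi> W W" and inj: "inj \<pi>"
    and dir: "\<And>x t c. x \<in> W \<Longrightarrow> \<exists>d. \<phi> (x + c *s v t) = \<phi> x + d *s v (\<pi> t)"
  shows "\<exists>f. semilinear_bij f \<and> (\<forall>w\<in>W. f (e + w) = e + \<phi> w) \<and> (\<forall>t. \<exists>k. f (v t) = k *s v (\<pi> t))"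
proof -
  have phiW: "\<phi> w \<in> W" if "w \<in> W" for w using phi that by (auto simp: bij_betw_def)
  have phi_inj: "inj_on \<phi> W" using phi by (simp add: bij_betw_def)
  define g where "g x = \<phi> x - \<phi> 0" for x
  have gW: "g w \<in> W" if "w \<in> W" for w using that phiW by (simp add: g_def)
  have g_inj: "x = y" if "x \<in> W" "y \<in> W" "g x = g y" for x y
    using that phi_inj by (simp add: g_def inj_on_eq_iff)
  have q': "n + 2 \<le> CARD('a) \<or> CARD('a) = 3" using q by auto
  have g_add: "g (x + y) = g x + g y" if "x \<in> W" "y \<in> W" for x y
    unfolding g_def by (rule additive_of_parallel[OF q' phi_inj dir inj that])
  have g0: "g 0 = 0" by (simp add: g_def)
  have g_sum: "g (\<Sum>t\<in>S. h t) = (\<Sum>t\<in>S. g (h t)) \<and> (\<Sum>t\<in>S. h t) \<in> W"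
    if "\<And>t. h t \<in> W" for h and S :: "'a set"
    by (induct S rule: infinite_finite_induct) (simp_all add: g0 g_add that)
  have "\<forall>t c. \<exists>d. g (c *s v t) = d *s v (\<pi> t)"
  proof (intro allI)
    fix t c
    obtain d where "\<phi> (0 + c *s v t) = \<phi> 0 + d *s v (\<pi> t)" using dir[of 0 c t] by auto
    thus "\<exists>d. g (c *s v t) = d *s v (\<pi> t)" by (intro exI[of _ d]) (simp add: g_def)
  qed
  then obtain f where f: "\<And>t c. g (c *s v t) = f t c *s v (\<pi> t)" by metis
  have f_inj: "inj (f t)" for t
  proof (rule injI)
    fix x y assume "f t x = f t y"
    hence "g (x *s v t) = g (y *s v t)" by (simp only: f)
    from g_inj[OF _ _ this] show "x = y" by simp
  qed
  have f_add: "f t (x + y) = f t x + f t y" for t x y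
  proof -
    have "f t (x + y) *s v (\<pi> t) = g (x *s v t + y *s v t)"
      by (simp only: f vec.scale_left_distrib[symmetric])
    also have "\<dots> = (f t x + f t y) *s v (\<pi> t)"
      by (subst g_add) (simp_all add: f vec.scale_left_distrib)
    finally show ?thesis by simp
  qed
  have f_rel: "(\<Sum>t\<in>S. f t (l * node_weight S t) *s v (\<pi> t)) = 0" if S: "card S = n + 2" for S l
  proof -
    have "(\<Sum>t\<in>S. f t (l * node_weight S t) *s v (\<pi> t)) = (\<Sum>t\<in>S. g ((l * node_weight S t) *s v t))"
      by (simp only: f)
    also have "\<dots> = g (\<Sum>t\<in>S. (l * node_weight S t) *s v t)"
      using g_sum[of "\<lambda>t. (l * node_weight S t) *s v t" S] by simp
    also have "(\<Sum>t\<in>S. (l * node_weight S t) *s v t) = l *s (\<Sum>t\<in>S. node_weight S t *s v t)"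
      by (simp add: vec.scale_sum_right)
    finally show ?thesis using relation_v[OF S] by (simp add: g0)
  qed
  have dm: "direction_maps f \<pi>"
    unfolding direction_maps_def using inj f_inj f_add f_rel by blast
  have "\<exists>\<sigma>. field_automorphism \<sigma> \<and> (\<forall>t c. f t c = \<sigma> c * f t 1)"
  proof (cases "n + 3 \<le> CARD('a)")
    case False
    hence "prime CARD('a)" using q by blast
    hence "\<forall>t c. f t c = c * f t 1" by (intro allI direction_maps_prime[OF dm])
    thus ?thesis by (intro exI[of _ "\<lambda>x. x"] conjI field_automorphism_id)
  qed (rule direction_maps_automorphism[OF dm])
  then obtain \<sigma> where \<sigma>: "field_automorphism \<sigma>" "\<forall>t c. f t c = \<sigma> c * f t 1"
    by (elim exE conjE) (rule that)
  note s = field_automorphism_simps[OF \<sigma>(1)]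
  have g_scale: "g (c *s x) = \<sigma> c *s g x" if "x \<in> W" for c x
    using that
  proof (induct rule: W_induct)
    case (step y d t)
    have "g (c *s (y + d *s v t)) = \<sigma> c *s g y + g ((c * d) *s v t)"
      using step by (simp add: vec.scale_right_distrib g_add)
    also have "g ((c * d) *s v t) = \<sigma> c *s g (d *s v t)"
      using \<sigma>(2)[rule_format, of t "c * d"] \<sigma>(2)[rule_format, of t d]
      unfolding f by (simp only: s vec.scale_scale mult.assoc)
    finally show ?case using step by (simp add: g_add vec.scale_right_distrib)
  qed (simp add: g0)
  obtain T :: "'a set" where T: "card T = n + 1" using nq by (metis ex_card)
  obtain F where F: "semilinear \<sigma> F" "\<forall>x\<in>insert e (v ` T). F x = (if x = e then e + \<phi> 0 else g x)"
    using semilinear_extend[OF independent_frame[OF T] \<sigma>(1), of "\<lambda>x. if x = e then e + \<phi> 0 else g x"] by blast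
  note Fs = semilinear_simps[OF F(1)]
  have ve: "v t \<noteq> e" for t using v_in_W e_notin by metis
  have FW: "F x = g x" if "x \<in> W" for x
  proof -
    have "x \<in> vec.span (v ` T)" using that span_v[of T] T by simp
    hence "x \<in> W \<and> F x = g x"
    proof (induct rule: vec.span_induct_alt)
      case (step c x y)
      then obtain t where "x = v t" "t \<in> T" by blast
      thus ?case using step F(2) ve by (simp add: Fs g_add g_scale)
    qed (simp add: g0 Fs)
    thus ?thesis ..
  qed
  have Fe: "F e = e + \<phi> 0" using F(2) by simp
  have "W \<subseteq> range F"
  proof
    fix w assume "w \<in> W"
    hence "w + \<phi> 0 \<in> \<phi> ` W" using phi phiW by (simp add: bij_betw_def)
    then obtain x where "x \<in> W" "w = g x" by (auto simp: g_def algebra_simps)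
    thus "w \<in> range F" using FW by (metis rangeI)
  qed
  hence "semilinear_bij F" by (intro semilinear_bij_if_covers_W[OF F(1)]) (simp_all add: Fe phiW)
  moreover have "F (e + w) = e + \<phi> w" if "w \<in> W" for w
    using that by (simp add: Fs Fe FW g_def)
  moreover have "\<exists>k. F (v t) = k *s v (\<pi> t)" for t
    using f[of 1 t] FW[of "v t"] by auto
  ultimately show ?thesis by blast
qed

text \<open>As points go to points, every point \<open>x\<close> carries a map
  \<open>\<tau> x\<close> of directions. Preservation of parallelism makes it independent of
  \<open>x\<close>, which yields the single permutation \<open>\<pi>\<close> that the semilinear
  classification starts from.\<close>

lemma model_automorphism:
  assumes nq': "3 \<le> n \<or> odd CARD('a)"
    and q: "n + 3 \<le> CARD('a) \<or> prime CARD('a) \<and> (n + 2 \<le> CARD('a) \<or> CARD('a) = 3)"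
    and M: "model G pt lin" and bij: "bij_betw \<psi> (fst G) (fst G)"
    and adj: "\<And>u w. u \<in> fst G \<Longrightarrow> w \<in> fst G \<Longrightarrow> {\<psi> u, \<psi> w} \<in> snd G \<longleftrightarrow> {u, w} \<in> snd G"
  shows "\<exists>f \<phi> \<pi>. semilinear_bij f \<and> bij \<pi> \<and> (\<forall>t. \<exists>k. f (v t) = k *s v (\<pi> t)) \<and>
    (\<forall>w\<in>W. \<phi> w \<in> W \<and> f (e + w) = e + \<phi> w \<and> \<psi> (pt w) = pt (\<phi> w) \<and> (\<forall>t. \<psi> (lin w t) = lin (\<phi> w) (\<pi> t)))"
proof -
  note m = model_simps[OF M]
  have psiV: "\<psi> u \<in> fst G" if "u \<in> fst G" for u using bij that by (auto simp: bij_betw_def)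
  have psi_inj: "\<psi> u = \<psi> w \<longleftrightarrow> u = w" if "u \<in> fst G" "w \<in> fst G" for u w
    using bij that by (auto simp: bij_betw_def inj_on_eq_iff)
  have "\<forall>x\<in>W. \<exists>y\<in>W. \<psi> (pt x) = pt y"
    using automorphism_no_swap[OF nq' M bij adj] by blast
  then obtain \<phi> where \<phi>: "\<And>x. x \<in> W \<Longrightarrow> \<phi> x \<in> W" "\<And>x. x \<in> W \<Longrightarrow> \<psi> (pt x) = pt (\<phi> x)"
    by metis
  have "\<exists>s. \<psi> (lin x t) = lin (\<phi> x) s" if x: "x \<in> W" for x t
  proof -
    have e: "{\<psi> (lin x t), pt (\<phi> x)} \<in> snd G"
      using adj[of "lin x t" "pt x"] x m \<phi> by simp
    have V: "\<psi> (lin x t) \<in> fst G" using psiV m x by simp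
    show ?thesis
    proof (cases rule: model_cases[OF M V])
      case (1 w) thus ?thesis using e m \<phi> x by auto
    next
      case (2 w s)
      hence "dir w (\<phi> x) s" using e m \<phi> x by auto
      hence "lin w s = lin (\<phi> x) s" using 2 m \<phi> x by auto
      thus ?thesis using 2 by auto
    qed
  qed
  then obtain \<tau> where \<tau>: "\<And>x t. x \<in> W \<Longrightarrow> \<psi> (lin x t) = lin (\<phi> x) (\<tau> x t)" by metis
  have dir: "dir x y t \<longleftrightarrow> dir (\<phi> x) (\<phi> y) (\<tau> x t)" if "x \<in> W" "y \<in> W" for x y t
    using adj[of "lin x t" "pt y"] that m \<phi> \<tau> by simp
  have inj_phi: "inj_on \<phi> W"
  proof (rule inj_onI)
    fix x y assume "x \<in> W" "y \<in> W" "\<phi> x = \<phi> y"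
    thus "x = y" using \<phi>(2) psi_inj m(1,3) by metis
  qed
  hence phi_bij: "bij_betw \<phi> W W"
    using \<phi>(1) endo_inj_surj[of W \<phi>] by (auto simp: bij_betw_def)
  have inj: "inj (\<tau> x)" if x: "x \<in> W" for x
  proof (rule injI)
    fix t t' assume "\<tau> x t = \<tau> x t'"
    hence "\<psi> (lin x t) = \<psi> (lin x t')" using \<tau> x by simp
    hence "lin x t = lin x t'" using psi_inj m(2) x by blast
    thus "t = t'" using m(4) x by blast
  qed
  have same: "\<tau> x t = \<tau> y t" if "x \<in> W" "y \<in> W" "dir x y t" for x y t
  proof -
    have "lin x t = lin y t" using m(4) that by blast
    thus ?thesis using \<tau> m(4) \<phi>(1) that by metis
  qed
  define \<pi> where "\<pi> = \<tau> 0"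
  have par: "\<tau> x t = \<pi> t" if "x \<in> W" for x t
    unfolding \<pi>_def by (rule parallel_preserved[OF phi_bij dir inj same that])
  have "inj \<pi>" unfolding \<pi>_def by (rule inj) simp
  have step: "\<exists>d. \<phi> (x + c *s v t) = \<phi> x + d *s v (\<pi> t)" if x: "x \<in> W" for x c t
    using dir[OF x, of "x + c *s v t" t] x par unfolding dir_def by auto
  obtain f where f: "semilinear_bij f" "\<forall>w\<in>W. f (e + w) = e + \<phi> w" "\<forall>t. \<exists>k. f (v t) = k *s v (\<pi> t)"
    using parallel_collineation_semilinear[OF q phi_bij \<open>inj \<pi>\<close> step] by blast
  have "bij \<pi>" using \<open>inj \<pi>\<close> by (simp add: bij_def finite_UNIV_inj_surj)
  with f \<phi> \<tau> par show ?thesis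
    by (intro exI[of _ f] exI[of _ \<phi>] exI[of _ \<pi>]) auto
qed

end

section \<open>The linear representation graph\<close>

lemma in_span_pair: "x \<in> vec.span {y, z} \<longleftrightarrow> (\<exists>a b. x = a *s y + b *s (z :: 'a::field^'m::finite))"
proof -
  have "x \<in> vec.span {y, z} \<longleftrightarrow> (\<exists>a. x - a *s y \<in> vec.span {z})"
    by (rule vec.span_breakdown_eq)
  also have "\<dots> \<longleftrightarrow> (\<exists>a b. x - a *s y = b *s z)" by (auto simp: span_single)
  also have "\<dots> \<longleftrightarrow> (\<exists>a b. x = a *s y + b *s z)" by (simp add: algebra_simps)
  finally show ?thesis .
qed

lemma span_single_subset_iff: "vec.subspace U \<Longrightarrow> vec.span {x} \<subseteq> U \<longleftrightarrow> x \<in> U"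
  using vec.span_base[of x "{x}"] vec.span_minimal[of "{x}" U] by auto

lemma span_single_in_pg_flat:
  "vec.subspace U \<Longrightarrow> vec.span {x} \<in> pg_flat U \<longleftrightarrow> x \<noteq> 0 \<and> x \<in> U"
  by (auto simp: pg_flat_def span_single_subset_iff)

lemma induced_image_pg_flat:
  assumes f: "semilinear_bij f"
  shows "induced f ` pg_flat U = pg_flat (f ` U)"
proof -
  have inj: "inj f" and surj: "surj f" using f by (auto simp: semilinear_bij_def bij_def)
  have g: "semilinear_bij (inv_into UNIV f)" by (rule semilinear_bij_inv[OF f])
  show ?thesis
  proof (intro equalityI subsetI)
    fix P assume "P \<in> induced f ` pg_flat U"
    thus "P \<in> pg_flat (f ` U)"
      using induced_in_pg_points[OF f] by (auto simp: pg_flat_def induced_def)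
  next
    fix P assume P: "P \<in> pg_flat (f ` U)"
    let ?Q = "inv_into UNIV f ` P"
    have "?Q \<in> pg_points"
      using induced_in_pg_points[OF g, of P] P by (auto simp: pg_flat_def induced_def)
    moreover have "?Q \<subseteq> U" using P inj by (auto simp: pg_flat_def)
    moreover have "f ` ?Q = P" using surj by (simp add: image_f_inv_f)
    ultimately show "P \<in> induced f ` pg_flat U"
      by (intro image_eqI[of _ _ ?Q]) (auto simp: pg_flat_def induced_def)
  qed
qed

lemma bij_betw_finite_endo:
  assumes "finite A" "inj_on f A" "\<And>x. x \<in> A \<Longrightarrow> f x \<in> A"
  shows "bij_betw f A A"
  using assms endo_inj_surj[of A f] by (auto simp: bij_betw_def)

lemma graph_Aut_iff:
  "\<psi> \<in> carrier (graph_Aut G) \<longleftrightarrow> \<psi> \<in> Bij (fst G) \<and>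
     (\<forall>u\<in>fst G. \<forall>v\<in>fst G. {\<psi> u, \<psi> v} \<in> snd G \<longleftrightarrow> {u, v} \<in> snd G)"
  by (simp add: graph_Aut_def)

lemma mult_graph_Aut:
  "f \<in> Bij (fst G) \<Longrightarrow> g \<in> Bij (fst G) \<Longrightarrow> f \<otimes>\<^bsub>graph_Aut G\<^esub> g = compose (fst G) f g"
  by (simp add: graph_Aut_def BijGroup_def)

context moment_curve begin

definition hyp :: "('a^'m) set set" where
  "hyp = pg_flat W"

definition arc :: "('a^'m) set set" where
  "arc = range (\<lambda>t. vec.span {v t})"

text \<open>The chart of the complement of the hyperplane: a projective point not contained in
  \<open>W\<close> has exactly one generator of the form \<open>e + w\<close> with \<open>w\<close>
  in \<open>W\<close>.\<close>

definition ptG :: "'a^'m \<Rightarrow> ('a^'m) set" where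
  "ptG w = vec.span {e + w}"

definition lineG :: "'a^'m \<Rightarrow> 'a \<Rightarrow> ('a^'m) set set" where
  "lineG w t = pg_flat (vec.span {e + w, v t})"

lemma e_plus_notin: "w \<in> W \<Longrightarrow> e + w \<notin> W"
  using e_add_in_W[of w 1] by simp

lemma e_plus_nonzero: "w \<in> W \<Longrightarrow> e + w \<noteq> 0"
  using e_plus_notin W_closed(1) by metis

lemma arc_subset: "arc \<subseteq> pg_points"
  by (auto simp: arc_def)

lemma arc_eq_iff: "vec.span {v t} = vec.span {v s} \<longleftrightarrow> t = s"
proof
  assume "vec.span {v t} = vec.span {v s}"
  then obtain c where "v s = c *s v t" using span_single_eq_iff[of "v t" "v s"] by auto
  hence "v s + (- c) *s v t = 0" by simp
  thus "t = s" using v_indep2[of s t 1 "- c"] by auto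
qed simp

lemma ptG_eq_iff: "w \<in> W \<Longrightarrow> w' \<in> W \<Longrightarrow> ptG w = ptG w' \<longleftrightarrow> w = w'"
proof
  assume w: "w \<in> W" "w' \<in> W" "ptG w = ptG w'"
  then obtain c where "e + w' = c *s (e + w)"
    using span_single_eq_iff[OF e_plus_nonzero[OF w(1)], of "e + w'"] by (auto simp: ptG_def)
  hence eq: "1 *s e + w' = c *s e + c *s w" by (simp add: vec.scale_right_distrib)
  have "c = 1" "w' = c *s w" using e_unique[OF w(2) _ eq] w(1) by auto
  thus "w = w'" by simp
qed simp

lemma affine_points_eq: "affine_points hyp = ptG ` W"
proof (intro equalityI subsetI)
  fix P assume "P \<in> affine_points hyp"
  then obtain x where x: "x \<noteq> 0" "P = vec.span {x}" "x \<notin> W"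
    by (auto simp: affine_points_def hyp_def pg_points_iff span_single_in_pg_flat[OF subspace_W])
  obtain c w where cw: "w \<in> W" "x = c *s e + w" using e_decomp by blast
  have c: "c \<noteq> 0" using x(3) cw by auto
  hence "x = c *s (e + inverse c *s w)" using cw by (simp add: vec.scale_right_distrib)
  hence "P = ptG (inverse c *s w)"
    using c x(2) cw span_single_eq_iff[OF e_plus_nonzero[of "inverse c *s w"], of x]
    by (auto simp: ptG_def)
  thus "P \<in> ptG ` W" using cw by auto
next
  fix P assume "P \<in> ptG ` W"
  thus "P \<in> affine_points hyp"
    using e_plus_notin e_plus_nonzero
    by (auto simp: affine_points_def hyp_def ptG_def span_single_in_pg_flat[OF subspace_W])
qed

lemma ptG_in_lineG: "w \<in> W \<Longrightarrow> w' \<in> W \<Longrightarrow> ptG w' \<in> lineG w t \<longleftrightarrow> dir w w' t"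
proof -
  assume w: "w \<in> W" "w' \<in> W"
  have "ptG w' \<in> lineG w t \<longleftrightarrow> (\<exists>a b. e + w' = a *s (e + w) + b *s v t)"
    using w e_plus_nonzero by (simp add: ptG_def lineG_def span_single_in_pg_flat in_span_pair)
  also have "\<dots> \<longleftrightarrow> (\<exists>b. w' = w + b *s v t)"
  proof
    assume "\<exists>a b. e + w' = a *s (e + w) + b *s v t"
    then obtain a b where "e + w' = a *s (e + w) + b *s v t" by blast
    hence eq: "1 *s e + w' = a *s e + (a *s w + b *s v t)" by (simp add: vec.scale_right_distrib)
    have "1 = a" "w' = a *s w + b *s v t" using e_unique[OF w(2) _ eq] w(1) by auto
    thus "\<exists>b. w' = w + b *s v t" by auto
  next
    assume "\<exists>b. w' = w + b *s v t"
    then obtain b where "w' = w + b *s v t" by blast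
    thus "\<exists>a b. e + w' = a *s (e + w) + b *s v t"
      by (intro exI[of _ 1] exI[of _ b]) simp
  qed
  finally show ?thesis by (simp add: dir_def)
qed

lemma lineG_eq_iff:
  assumes w: "w \<in> W" "w' \<in> W"
  shows "lineG w t = lineG w' t' \<longleftrightarrow> t = t' \<and> dir w w' t"
proof
  assume eq: "lineG w t = lineG w' t'"
  let ?z = "w' + 1 *s v t'"
  have z: "?z \<in> W" using w by simp
  have "dir w' w' t'" "dir w' ?z t'" by (rule dir_refl, rule dir_add)
  hence *: "dir w w' t" "dir w ?z t"
    using eq ptG_in_lineG[OF w(2) w(2), of t'] ptG_in_lineG[OF w(2) z, of t']
      ptG_in_lineG[OF w, of t] ptG_in_lineG[OF w(1) z, of t] by auto
  hence "dir w' ?z t" using dir_sym dir_trans by blast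
  hence "t = t'" using dir_unique[OF _ dir_add[of w' 1 t']] by auto
  with * show "t = t' \<and> dir w w' t" by simp
next
  assume "t = t' \<and> dir w w' t"
  then obtain c where c: "t = t'" "w' = w + c *s v t" by (auto simp: dir_def)
  have "e + w' = 1 *s (e + w) + c *s v t" "e + w = 1 *s (e + w') + (- c) *s v t"
    using c by simp_all
  hence "e + w' \<in> vec.span {e + w, v t}" "e + w \<in> vec.span {e + w', v t}"
    unfolding in_span_pair by blast+
  hence "vec.span {e + w, v t} = vec.span {e + w', v t}"
    by (simp add: vec.span_eq vec.span_base)
  thus "lineG w t = lineG w' t'" using c by (simp add: lineG_def)
qed

lemma dim_line_span:
  assumes w: "w \<in> W"
  shows "vec.dim {e + w, v t} = 2"
proof -
  have "vec.span {v t} \<subseteq> W" using span_single_subset_iff[OF subspace_W] by simp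
  hence notin: "e + w \<notin> vec.span {v t}" using e_plus_notin[OF w] by blast
  have "vec.independent {v t}" by simp
  hence "vec.independent {e + w, v t}" by (intro vec.independent_insertI[OF notin])
  moreover have "e + w \<noteq> v t" using notin vec.span_base[of "v t" "{v t}"] by auto
  ultimately show ?thesis
    using vec.dim_eq_card_independent by fastforce
qed

lemma affine_lines_eq: "affine_lines hyp arc = (\<lambda>(w, t). lineG w t) ` (W \<times> UNIV)"
proof (intro equalityI subsetI)
  fix L assume "L \<in> affine_lines hyp arc"
  then obtain U where U: "vec.subspace U" "vec.dim U = 2" "L = pg_flat U"
    and L: "\<not> L \<subseteq> hyp" "L \<inter> arc \<noteq> {}"
    by (auto simp: affine_lines_def pg_flats_def numeral_2_eq_2)
  obtain t where "vec.span {v t} \<in> L" using L(2) by (auto simp: arc_def)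
  hence t: "v t \<in> U" using U by (simp add: span_single_in_pg_flat)
  obtain P where P: "P \<in> L" "P \<notin> hyp" using L(1) by blast
  hence "P \<in> affine_points hyp" using U by (auto simp: affine_points_def pg_flat_def)
  then obtain w where w: "w \<in> W" "P = ptG w" by (auto simp: affine_points_eq)
  have wU: "e + w \<in> U" using P w U by (simp add: ptG_def span_single_in_pg_flat)
  have "vec.dim {e + w, v t} = 2" by (rule dim_line_span[OF w(1)])
  hence "vec.span {e + w, v t} = U"
    using U t wU by (intro vec.subspace_dim_equal vec.span_minimal) auto
  thus "L \<in> (\<lambda>(w, t). lineG w t) ` (W \<times> UNIV)" using U w by (auto simp: lineG_def)
next
  fix L assume "L \<in> (\<lambda>(w, t). lineG w t) ` (W \<times> UNIV)"
  then obtain w t where w: "w \<in> W" "L = lineG w t" by auto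
  have "vec.dim {e + w, v t} = 2" by (rule dim_line_span[OF w(1)])
  hence "L \<in> pg_flats 1" using w unfolding pg_flats_def lineG_def
    by (intro CollectI exI[of _ "vec.span {e + w, v t}"]) simp
  moreover have "ptG w \<in> L" using w ptG_in_lineG by simp
  hence "\<not> L \<subseteq> hyp" using affine_points_eq w by (auto simp: affine_points_def)
  moreover have "vec.span {v t} \<in> L"
    using w by (simp add: lineG_def span_single_in_pg_flat vec.span_base)
  hence "L \<inter> arc \<noteq> {}" by (auto simp: arc_def)
  ultimately show "L \<in> affine_lines hyp arc" by (simp add: affine_lines_def)
qed

lemma model_Gamma: "model (Gamma_graph hyp arc) (\<lambda>w. Inl (ptG w)) (\<lambda>w t. Inr (lineG w t))"
  unfolding model_def
proof (intro conjI ballI allI)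
  show "fst (Gamma_graph hyp arc) = (\<lambda>w. Inl (ptG w)) ` W \<union> (\<lambda>(w, t). Inr (lineG w t)) ` (W \<times> UNIV)"
    by (simp add: Gamma_graph_def affine_points_eq affine_lines_eq image_image case_prod_unfold)
  show "inj_on (\<lambda>w. Inl (ptG w)) W" by (auto simp: inj_on_def ptG_eq_iff)
  show "snd (Gamma_graph hyp arc) = {{Inl (ptG w'), Inr (lineG w t)} | w w' t. w \<in> W \<and> w' \<in> W \<and> dir w w' t}"
    (is "_ = ?E")
  proof -
    have "{{Inl P, Inr L} | P L. P \<in> ptG ` W \<and> L \<in> (\<lambda>(w, t). lineG w t) ` (W \<times> UNIV) \<and> P \<in> L}
      = {{Inl (ptG w'), Inr (lineG w t)} | w w' t. w \<in> W \<and> w' \<in> W \<and> ptG w' \<in> lineG w t}"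
      by auto
    also have "\<dots> = ?E"
      by (intro Collect_cong ex_cong1 conj_cong refl) (rule ptG_in_lineG)
    finally show ?thesis by (simp add: Gamma_graph_def affine_points_eq affine_lines_eq)
  qed
qed (auto simp: lineG_eq_iff)

text \<open>A collineation determines its semilinear map only up to a scalar, and the condition
  \<open>f e - e \<in> W\<close> removes this freedom. The data \<open>k\<close> and
  \<open>\<pi>\<close> describe the action on the arc.\<close>

definition normalised ::
  "('a^'m \<Rightarrow> 'a^'m) \<Rightarrow> ('a \<Rightarrow> 'a) \<Rightarrow> ('a \<Rightarrow> 'a) \<Rightarrow> ('a \<Rightarrow> 'a) \<Rightarrow> bool" where
  "normalised f \<sigma> k \<pi> \<longleftrightarrow> semilinear \<sigma> f \<and> semilinear_bij f \<and> f e - e \<in> W \<and> bij \<pi> \<and>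
     (\<forall>t. k t \<noteq> 0 \<and> f (v t) = k t *s v (\<pi> t))"

text \<open>The affine map that a normalised \<open>f\<close> induces on \<open>W\<close> in the
  chart \<open>e + w\<close>.\<close>

definition shift :: "('a^'m \<Rightarrow> 'a^'m) \<Rightarrow> 'a^'m \<Rightarrow> 'a^'m" where
  "shift f w = f e - e + f w"

lemma W_preserved:
  assumes "semilinear \<sigma> f" "\<And>t. f (v t) \<in> W" "w \<in> W"
  shows "f w \<in> W"
  using assms(3) by (induct rule: W_induct) (simp_all add: semilinear_simps[OF assms(1)] assms(2))

lemma normalised_simps:
  assumes f: "normalised f \<sigma> k \<pi>"
  shows "semilinear \<sigma> f" "semilinear_bij f" "bij \<pi>" "k t \<noteq> 0" "f (v t) = k t *s v (\<pi> t)"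
    "w \<in> W \<Longrightarrow> f w \<in> W" "w \<in> W \<Longrightarrow> shift f w \<in> W" "f (e + w) = e + shift f w"
proof -
  show *: "semilinear \<sigma> f" "semilinear_bij f" "bij \<pi>" "k t \<noteq> 0" "f (v t) = k t *s v (\<pi> t)" for t
    using f by (auto simp: normalised_def)
  show W: "f w \<in> W" if "w \<in> W" for w
    using W_preserved[OF *(1) _ that] *(5) by simp
  show "w \<in> W \<Longrightarrow> shift f w \<in> W" using W f by (simp add: shift_def normalised_def)
  show "f (e + w) = e + shift f w" by (simp add: shift_def semilinear_simps[OF *(1)])
qed

lemma normalised_dir:
  assumes f: "normalised f \<sigma> k \<pi>"
  shows "dir (shift f w) (shift f w') (\<pi> t) \<longleftrightarrow> dir w w' t"
proof -
  note n = normalised_simps[OF f]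
  note s = semilinear_simps[OF n(1)] and inv = field_automorphism_inv[OF semilinear_automorphism[OF n(1)]]
  have inj: "f x = f y \<longleftrightarrow> x = y" for x y
    using n(2) by (auto simp: semilinear_bij_def bij_def inj_eq)
  have "dir (shift f w) (shift f w') (\<pi> t) \<longleftrightarrow> (\<exists>c. f w' = f w + c *s v (\<pi> t))"
    by (simp add: dir_def shift_def add.assoc)
  also have "\<dots> \<longleftrightarrow> (\<exists>c. f w' = f (w + c *s v t))"
  proof
    assume "\<exists>c. f w' = f w + c *s v (\<pi> t)"
    then obtain c where "f w' = f w + c *s v (\<pi> t)" by blast
    hence "f w' = f (w + inv_into UNIV \<sigma> (c / k t) *s v t)" using n(4)[of t] by (simp add: s n(5) inv)
    thus "\<exists>c. f w' = f (w + c *s v t)" by blast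
  next
    assume "\<exists>c. f w' = f (w + c *s v t)"
    thus "\<exists>c. f w' = f w + c *s v (\<pi> t)" by (auto simp: s n(5))
  qed
  finally show ?thesis by (simp add: inj dir_def)
qed

text \<open>A map stabilising the arc permutes the lines spanned by the vectors \<open>v t\<close>
  and so preserves their span \<open>W\<close>. Hence the coefficient of \<open>e\<close> in
  \<open>f e\<close> is nonzero and can be divided out without changing the collineation.\<close>

lemma stab_normal_form:
  "g \<in> carrier (PGammaL_stab arc) \<longleftrightarrow> (\<exists>f \<sigma> k \<pi>. normalised f \<sigma> k \<pi> \<and> g = induced f)"
proof
  assume "g \<in> carrier (PGammaL_stab arc)"
  then obtain f where f: "semilinear_bij f" "g = induced f" "g ` arc = arc"
    by (auto simp: carrier_PGammaL_stab)
  then obtain \<sigma> where \<sigma>: "semilinear \<sigma> f" by (auto simp: semilinear_bij_iff)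
  note s = semilinear_simps[OF \<sigma>]
  have gv: "g (vec.span {v t}) = vec.span {f (v t)}" for t
    using induced_span[OF f(1)] f(2) by simp
  have nz: "f (v t) \<noteq> 0" for t using semilinear_bij_nonzero[OF f(1)] by simp
  have "\<exists>c u. c \<noteq> 0 \<and> f (v t) = c *s v u" for t
  proof -
    have "g (vec.span {v t}) \<in> g ` arc" by (simp add: arc_def)
    hence "vec.span {f (v t)} \<in> arc" using f(3) gv[of t] by simp
    then obtain u where "vec.span {v u} = vec.span {f (v t)}" by (auto simp: arc_def)
    thus ?thesis using span_single_eq_iff[of "v u" "f (v t)"] by auto
  qed
  then obtain k \<pi> where k: "\<And>t. k t \<noteq> 0" and \<pi>: "\<And>t. f (v t) = k t *s v (\<pi> t)" by metis
  have spans: "g (vec.span {v t}) = vec.span {v (\<pi> t)}" for t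
    using gv[of t] span_single_eq_iff[of "v (\<pi> t)" "f (v t)"] k \<pi> by auto
  have "surj \<pi>"
  proof -
    have "\<exists>t. u = \<pi> t" for u
    proof -
      have "vec.span {v u} \<in> g ` arc" using f(3) by (auto simp: arc_def)
      then obtain t where "vec.span {v u} = vec.span {v (\<pi> t)}" using spans by (auto simp: arc_def)
      thus ?thesis using arc_eq_iff by blast
    qed
    thus ?thesis by (simp add: surj_def)
  qed
  hence bij: "bij \<pi>" by (simp add: bij_def finite_UNIV_surj_inj)
  have fW: "f w \<in> W" if "w \<in> W" for w using W_preserved[OF \<sigma> _ that] \<pi> by simp
  obtain c w where cw: "w \<in> W" "f e = c *s e + w" using e_decomp by blast
  have inj: "inj f" using f(1) by (simp add: semilinear_bij_def bij_def)
  \<comment> \<open>The injective map \<open>f\<close> sends the finite space \<open>W\<close> onto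
    itself, so a value \<open>f e\<close> in \<open>W\<close> would be taken twice.\<close>
  have "c \<noteq> 0"
  proof
    assume "c = 0"
    hence "f e \<in> W" using cw by simp
    moreover have "f ` W = W"
      using fW inj endo_inj_surj[of W f] by (auto intro: inj_on_subset)
    ultimately obtain x where "x \<in> W" "f e = f x" by blast
    thus False using inj e_notin by (auto simp: inj_eq)
  qed
  let ?f = "\<lambda>x. inverse c *s f x"
  have bij_f: "semilinear_bij ?f" using \<open>c \<noteq> 0\<close> by (intro semilinear_bij_scale f) auto
  have "semilinear \<sigma> ?f"
    using semilinear_automorphism[OF \<sigma>]
    by (simp add: semilinear_def s vec.scale_right_distrib mult.commute)
  moreover have "?f e - e \<in> W" using cw \<open>c \<noteq> 0\<close> by (simp add: vec.scale_right_distrib)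
  ultimately have "normalised ?f \<sigma> (\<lambda>t. inverse c * k t) \<pi>"
    using bij_f bij k \<pi> \<open>c \<noteq> 0\<close> by (simp add: normalised_def)
  moreover have "g = induced ?f"
  proof
    fix P show "g P = induced ?f P"
    proof (cases "P \<in> pg_points")
      case True
      then obtain x where x: "x \<noteq> 0" "P = vec.span {x}" by (auto simp: pg_points_iff)
      have "vec.span {f x} = vec.span {?f x}"
        using span_single_eq_iff[of "f x" "?f x"] semilinear_bij_nonzero[OF f(1)] x \<open>c \<noteq> 0\<close> by auto
      thus ?thesis using x induced_span[OF f(1)] induced_span[OF bij_f] f(2) by simp
    next
      case False thus ?thesis using f(2) by (simp add: induced_def)
    qed
  qed
  ultimately show "\<exists>f \<sigma> k \<pi>. normalised f \<sigma> k \<pi> \<and> g = induced f" by blast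
next
  assume "\<exists>f \<sigma> k \<pi>. normalised f \<sigma> k \<pi> \<and> g = induced f"
  then obtain f \<sigma> k \<pi> where f: "normalised f \<sigma> k \<pi>" "g = induced f" by blast
  note n = normalised_simps[OF f(1)]
  have "g (vec.span {v t}) = vec.span {v (\<pi> t)}" for t
    using induced_span[OF n(2), of "v t"] span_single_eq_iff[of "v (\<pi> t)" "f (v t)"] n(4)[of t] n(5)[of t] f(2)
    by auto
  hence "g ` arc = (\<lambda>t. vec.span {v t}) ` range \<pi>"
    by (simp add: arc_def image_image)
  also have "\<dots> = arc" using n(3) by (simp add: arc_def bij_is_surj)
  finally show "g \<in> carrier (PGammaL_stab arc)"
    using n(2) f(2) by (auto simp: carrier_PGammaL_stab)
qed

lemma induced_ptG:
  assumes f: "normalised f \<sigma> k \<pi>" and w: "w \<in> W"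
  shows "induced f (ptG w) = ptG (shift f w)"
  using induced_span[OF normalised_simps(2)[OF f] e_plus_nonzero[OF w]] normalised_simps(8)[OF f]
  by (simp add: ptG_def)

lemma induced_lineG:
  assumes f: "normalised f \<sigma> k \<pi>" and w: "w \<in> W"
  shows "induced f ` lineG w t = lineG (shift f w) (\<pi> t)"
proof -
  note n = normalised_simps[OF f]
  have "f ` vec.span {e + w, v t} = vec.span {e + shift f w, k t *s v (\<pi> t)}"
    using semilinear_bij_image_span[OF n(2)] by (simp add: n(5,8))
  also have "\<dots> = vec.span {e + shift f w, v (\<pi> t)}"
  proof -
    have "v (\<pi> t) = 0 *s (e + shift f w) + inverse (k t) *s (k t *s v (\<pi> t))" using n(4)[of t] by simp
    hence "v (\<pi> t) \<in> vec.span {e + shift f w, k t *s v (\<pi> t)}" unfolding in_span_pair by blast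
    moreover have "k t *s v (\<pi> t) \<in> vec.span {e + shift f w, v (\<pi> t)}"
      by (intro vec.span_scale vec.span_base) auto
    ultimately show ?thesis by (simp add: vec.span_eq vec.span_base)
  qed
  finally show ?thesis by (simp add: lineG_def induced_image_pg_flat[OF n(2)])
qed

abbreviation "\<G> \<equiv> PGammaL_stab arc"
abbreviation "VA \<equiv> vertex_action hyp arc"
abbreviation "EA \<equiv> edge_action hyp arc"
abbreviation "\<Gamma> \<equiv> Gamma_graph hyp arc"

lemmas G_simps = model_simps[OF model_Gamma]
lemmas G_cases = model_cases[OF model_Gamma, consumes 1, case_names pt lin]

lemma VA_simps:
  assumes f: "normalised f \<sigma> k \<pi>" and w: "w \<in> W"
  shows "VA (induced f) (Inl (ptG w)) = Inl (ptG (shift f w))"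
    "VA (induced f) (Inr (lineG w t)) = Inr (lineG (shift f w) (\<pi> t))"
  using G_simps(1,2)[OF w] induced_ptG[OF f w] induced_lineG[OF f w]
  by (simp_all add: vertex_action_def)

lemma VA_in_graph_Aut:
  assumes g: "g \<in> carrier \<G>"
  shows "VA g \<in> carrier (graph_Aut \<Gamma>)"
proof -
  obtain f \<sigma> k \<pi> where f: "normalised f \<sigma> k \<pi>" "g = induced f"
    using g by (auto simp: stab_normal_form)
  note n = normalised_simps[OF f(1)] and va = VA_simps[OF f(1)]
  have inj: "inj \<pi>" using n(3) by (simp add: bij_def)
  have f_inj: "f x = f y \<longleftrightarrow> x = y" for x y
    using n(2) by (auto simp: semilinear_bij_def bij_def inj_eq)
  have into: "VA g u \<in> fst \<Gamma>" if "u \<in> fst \<Gamma>" for u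
    using that n(7) by (cases rule: G_cases) (auto simp: f(2) va G_simps)
  have "inj_on (VA g) (fst \<Gamma>)"
  proof (rule inj_onI)
    fix u u' assume u: "u \<in> fst \<Gamma>" "u' \<in> fst \<Gamma>" "VA g u = VA g u'"
    show "u = u'"
      using u(1)
    proof (cases rule: G_cases)
      case (pt w)
      show ?thesis using u(2)
        by (cases rule: G_cases) (use pt u(3) n(7) in \<open>auto simp: f(2) va ptG_eq_iff shift_def f_inj\<close>)
    next
      case (lin w t)
      note u1 = this
      show ?thesis using u(2)
      proof (cases rule: G_cases)
        case (lin w' t')
        have "lineG (shift f w) (\<pi> t) = lineG (shift f w') (\<pi> t')"
          using u(3) u1 lin by (simp add: f(2) va)
        hence "\<pi> t = \<pi> t'" "dir (shift f w) (shift f w') (\<pi> t)"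
          using lineG_eq_iff n(7) u1 lin by metis+
        hence "t = t'" "dir w w' t" using normalised_dir[OF f(1)] inj by (auto simp: inj_eq)
        thus ?thesis using lineG_eq_iff u1 lin by simp
      qed (use u1 u(3) in \<open>auto simp: f(2) va\<close>)
    qed
  qed
  hence "VA g \<in> Bij (fst \<Gamma>)"
    using into by (auto simp: Bij_def vertex_action_def intro!: bij_betw_finite_endo)
  moreover have "{VA g u, VA g u'} \<in> snd \<Gamma> \<longleftrightarrow> {u, u'} \<in> snd \<Gamma>" if u: "u \<in> fst \<Gamma>" "u' \<in> fst \<Gamma>" for u u'
    using u(1)
  proof (cases rule: G_cases)
    case (pt w)
    show ?thesis using u(2)
      by (cases rule: G_cases) (use pt n(7) in \<open>auto simp: f(2) va G_simps normalised_dir[OF f(1)]\<close>)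
  next
    case (lin w t)
    show ?thesis using u(2)
      by (cases rule: G_cases) (use lin n(7) in \<open>auto simp: f(2) va G_simps normalised_dir[OF f(1)]\<close>)
  qed
  ultimately show ?thesis by (simp add: graph_Aut_iff)
qed

end

section \<open>The action of the stabiliser and its order\<close>

lemma carrier_BijGroup: "carrier (BijGroup S) = Bij S"
  by (simp add: BijGroup_def)

lemma mult_BijGroup: "f \<in> Bij S \<Longrightarrow> g \<in> Bij S \<Longrightarrow> f \<otimes>\<^bsub>BijGroup S\<^esub> g = compose S f g"
  by (simp add: BijGroup_def)

context moment_curve begin

lemma group_G: "group \<G>"
  by (rule group_PGammaL_stab[OF arc_subset])

lemma mult_G_apply:
  assumes "g \<in> carrier \<G>" "h \<in> carrier \<G>" "P \<in> pg_points"
  shows "(g \<otimes>\<^bsub>\<G>\<^esub> h) P = g (h P)"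
proof -
  obtain f f' where f: "semilinear_bij f" "g = induced f" "semilinear_bij f'" "h = induced f'"
    using assms by (auto simp: carrier_PGammaL_stab)
  show ?thesis
    using assms(3) mult_PGammaL_stab[OF f(1,3), of arc] induced_comp[OF f(1,3), symmetric]
    by (simp add: f(2,4) compose_def)
qed

lemma VA_mult:
  assumes g: "g \<in> carrier \<G>" and h: "h \<in> carrier \<G>"
  shows "VA (g \<otimes>\<^bsub>\<G>\<^esub> h) = compose (fst \<Gamma>) (VA g) (VA h)"
proof
  fix u
  show "VA (g \<otimes>\<^bsub>\<G>\<^esub> h) u = compose (fst \<Gamma>) (VA g) (VA h) u"
  proof (cases "u \<in> fst \<Gamma>")
    case True
    have "VA h \<in> Bij (fst \<Gamma>)" using VA_in_graph_Aut[OF h] by (simp add: graph_Aut_iff)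
    hence hu: "VA h u \<in> fst \<Gamma>" using True by (auto simp: Bij_def bij_betw_def)
    have "(g \<otimes>\<^bsub>\<G>\<^esub> h) ` L = g ` h ` L" if "L \<subseteq> pg_points" for L
      using that mult_G_apply[OF g h] by (auto simp: image_image intro!: image_cong)
    moreover have "L \<subseteq> pg_points" if "L \<in> affine_lines hyp arc" for L
      using that by (auto simp: affine_lines_def pg_flats_def pg_flat_def)
    moreover have "P \<in> pg_points" if "P \<in> affine_points hyp" for P
      using that by (auto simp: affine_points_def)
    ultimately have "map_sum (g \<otimes>\<^bsub>\<G>\<^esub> h) (image (g \<otimes>\<^bsub>\<G>\<^esub> h)) u
        = map_sum g (image g) (map_sum h (image h) u)"
      using True mult_G_apply[OF g h] by (auto simp: Gamma_graph_def)
    thus ?thesis using True hu by (simp add: vertex_action_def compose_def)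
  qed (simp add: vertex_action_def compose_def)
qed

lemma VA_Bij: "g \<in> carrier \<G> \<Longrightarrow> VA g \<in> Bij (fst \<Gamma>)"
  by (rule graph_Aut_iff[THEN iffD1, THEN conjunct1, OF VA_in_graph_Aut])

lemma VA_adj:
  assumes "g \<in> carrier \<G>" "u \<in> fst \<Gamma>" "w \<in> fst \<Gamma>"
  shows "{VA g u, VA g w} \<in> snd \<Gamma> \<longleftrightarrow> {u, w} \<in> snd \<Gamma>"
  by (rule graph_Aut_iff[THEN iffD1, OF VA_in_graph_Aut[OF assms(1)], THEN conjunct2, rule_format, OF assms(2,3)])

lemma group_action_VA: "group_action \<G> (fst \<Gamma>) VA"
  unfolding group_action_def
proof (intro group_hom.intro group_hom_axioms.intro group_G group_BijGroup)
  show "VA \<in> hom \<G> (BijGroup (fst \<Gamma>))"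
  proof (rule homI)
    fix g h assume gh: "g \<in> carrier \<G>" "h \<in> carrier \<G>"
    show "VA g \<in> carrier (BijGroup (fst \<Gamma>))" by (simp only: carrier_BijGroup VA_Bij[OF gh(1)])
    show "VA (g \<otimes>\<^bsub>\<G>\<^esub> h) = VA g \<otimes>\<^bsub>BijGroup (fst \<Gamma>)\<^esub> VA h"
      by (simp only: VA_mult[OF gh] mult_BijGroup[OF VA_Bij[OF gh(1)] VA_Bij[OF gh(2)]])
  qed
qed

lemma edge_cases:
  assumes "X \<in> snd \<Gamma>"
  obtains w t where "w \<in> W" "X = {Inl (ptG w), Inr (lineG w t)}"
proof -
  have E: "snd \<Gamma> = {{Inl (ptG w'), Inr (lineG w t)} | w w' t. w \<in> W \<and> w' \<in> W \<and> dir w w' t}"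
    using model_Gamma unfolding model_def by (elim conjE)
  from assms[unfolded E] obtain w w' t where X: "w \<in> W" "w' \<in> W" "dir w w' t" "X = {Inl (ptG w'), Inr (lineG w t)}"
    by blast
  have "lineG w t = lineG w' t" by (rule lineG_eq_iff[OF X(1,2), THEN iffD2, OF conjI[OF refl X(3)]])
  hence "X = {Inl (ptG w'), Inr (lineG w' t)}" by (simp only: X(4))
  thus ?thesis by (rule that[OF X(2)])
qed

lemma edge_vertices: "X \<in> snd \<Gamma> \<Longrightarrow> X \<subseteq> fst \<Gamma>"
proof (erule edge_cases)
  fix w t assume "w \<in> W" "X = {Inl (ptG w), Inr (lineG w t)}"
  thus "X \<subseteq> fst \<Gamma>" using G_simps(1,2)[of w] by simp
qed

lemma EA_Bij:
  assumes g: "g \<in> carrier \<G>"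
  shows "EA g \<in> Bij (snd \<Gamma>)"
proof -
  have into: "VA g ` X \<in> snd \<Gamma>" if "X \<in> snd \<Gamma>" for X
    using that
  proof (cases rule: edge_cases)
    case (1 w t)
    thus ?thesis using VA_adj[OF g, of "Inl (ptG w)" "Inr (lineG w t)"] by (simp add: G_simps)
  qed
  have inj: "inj_on (VA g) (fst \<Gamma>)" using VA_Bij[OF g] by (simp add: Bij_def bij_betw_def)
  have "inj_on (EA g) (snd \<Gamma>)"
  proof (rule inj_onI)
    fix X Y assume XY: "X \<in> snd \<Gamma>" "Y \<in> snd \<Gamma>" "EA g X = EA g Y"
    hence "VA g ` X = VA g ` Y" by (simp only: edge_action_def restrict_apply if_True)
    thus "X = Y" using inj_on_image_eq_iff[OF inj edge_vertices[OF XY(1)] edge_vertices[OF XY(2)]] by blast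
  qed
  hence "bij_betw (EA g) (snd \<Gamma>) (snd \<Gamma>)"
    by (intro bij_betw_finite_endo) (simp_all only: edge_action_def restrict_apply if_True into finite)
  thus ?thesis by (simp add: Bij_def edge_action_def)
qed

lemma EA_mult:
  assumes g: "g \<in> carrier \<G>" and h: "h \<in> carrier \<G>"
  shows "EA (g \<otimes>\<^bsub>\<G>\<^esub> h) = compose (snd \<Gamma>) (EA g) (EA h)"
proof
  fix X
  show "EA (g \<otimes>\<^bsub>\<G>\<^esub> h) X = compose (snd \<Gamma>) (EA g) (EA h) X"
  proof (cases "X \<in> snd \<Gamma>")
    case True
    have "EA h X \<in> snd \<Gamma>" using EA_Bij[OF h] True by (auto simp: Bij_def bij_betw_def)
    moreover have "VA (g \<otimes>\<^bsub>\<G>\<^esub> h) ` X = VA g ` VA h ` X"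
      unfolding image_image VA_mult[OF g h]
      using edge_vertices[OF True] by (intro image_cong refl compose_eq) blast
    ultimately show ?thesis using True by (simp add: edge_action_def compose_def)
  qed (simp add: edge_action_def compose_def)
qed

lemma realisation_normalised:
  assumes "compatible \<sigma> \<pi>" "k \<noteq> 0" "w0 \<in> W"
  shows "\<exists>f. normalised f \<sigma> (\<lambda>_. k) \<pi> \<and> f e = e + w0"
  using compatible_realisation[OF assms] assms by (auto simp: normalised_def compatible_def)

text \<open>The parameter translation by \<open>t' - t\<close> adjusts the direction, and a
  translation of \<open>W\<close> then moves the point. Both are realised with trivial companion
  automorphism, because affine permutations of the parameters are always compatible.\<close>

lemma edge_transitive: "edge_transitive_PGammaL_stab hyp arc"
  unfolding edge_transitive_PGammaL_stab_def
proof (intro conjI group_action_VA transitive_action.intro transitive_action_axioms.intro)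
  show "group_action \<G> (snd \<Gamma>) EA"
    unfolding group_action_def
  proof (intro group_hom.intro group_hom_axioms.intro group_G group_BijGroup)
    show "EA \<in> hom \<G> (BijGroup (snd \<Gamma>))"
    proof (rule homI)
      fix g h assume gh: "g \<in> carrier \<G>" "h \<in> carrier \<G>"
      show "EA g \<in> carrier (BijGroup (snd \<Gamma>))" by (simp only: carrier_BijGroup EA_Bij[OF gh(1)])
      show "EA (g \<otimes>\<^bsub>\<G>\<^esub> h) = EA g \<otimes>\<^bsub>BijGroup (snd \<Gamma>)\<^esub> EA h"
        by (simp only: EA_mult[OF gh] mult_BijGroup[OF EA_Bij[OF gh(1)] EA_Bij[OF gh(2)]])
    qed
  qed
  fix X Y assume XY: "X \<in> snd \<Gamma>" "Y \<in> snd \<Gamma>"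
  obtain w t where X: "w \<in> W" "X = {Inl (ptG w), Inr (lineG w t)}" using XY(1) by (rule edge_cases)
  obtain w' t' where Y: "w' \<in> W" "Y = {Inl (ptG w'), Inr (lineG w' t')}" using XY(2) by (rule edge_cases)
  let ?\<pi> = "\<lambda>s. s + (t' - t)"
  have comp: "compatible (\<lambda>x. x) ?\<pi>" "compatible (\<lambda>x. x) (\<lambda>s. s)"
    by (rule compatible_affine[where \<alpha> = 1, OF field_automorphism_id]; simp)+
  obtain f where f: "normalised f (\<lambda>x. x) (\<lambda>_. 1) ?\<pi>"
    using realisation_normalised[OF comp(1) _ W_closed(1), of 1] by auto
  have fw: "shift f w \<in> W" by (rule normalised_simps(7)[OF f X(1)])
  hence "w' - shift f w \<in> W" using Y by simp
  then obtain f' where f': "normalised f' (\<lambda>x. x) (\<lambda>_. 1) (\<lambda>s. s)" "f' e = e + (w' - shift f w)"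
    using realisation_normalised[OF comp(2), of 1] by auto
  let ?g = "induced f" and ?g' = "induced f'"
  have g: "?g \<in> carrier \<G>" "?g' \<in> carrier \<G>"
    using f f' by (auto simp: stab_normal_form)
  have id: "f' x = x" if "x \<in> W" for x
    using that
  proof (induct rule: W_induct)
    case (step y c t)
    thus ?case by (simp add: semilinear_simps[OF normalised_simps(1)[OF f'(1)]] normalised_simps(5)[OF f'(1)])
  qed (simp add: semilinear_simps[OF normalised_simps(1)[OF f'(1)]])
  have "shift f' (shift f w) = w'" using f'(2) id[OF fw] by (simp add: shift_def)
  moreover have "EA ?g X = {Inl (ptG (shift f w)), Inr (lineG (shift f w) t')}"
    using XY X by (simp add: edge_action_def VA_simps[OF f])
  moreover from this have "{Inl (ptG (shift f w)), Inr (lineG (shift f w) t')} \<in> snd \<Gamma>"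
    using EA_Bij[OF g(1)] XY(1) by (metis Bij_imp_funcset PiE)
  ultimately have "EA ?g' (EA ?g X) = Y"
    using Y fw by (simp add: edge_action_def VA_simps[OF f'(1)])
  hence "EA (?g' \<otimes>\<^bsub>\<G>\<^esub> ?g) X = Y"
    using EA_mult[OF g(2,1)] XY by (simp add: compose_def)
  thus "\<exists>g\<in>carrier \<G>. EA g X = Y"
    using group.is_monoid[OF group_G] g by (metis monoid.m_closed)
qed

text \<open>The images of the affine points determine \<open>f e\<close> and then \<open>f\<close>
  on \<open>W\<close>. The independence of two directions separates \<open>k\<close> from
  \<open>\<pi>\<close>, and \<open>\<sigma>\<close> is read off from the multiples of
  \<open>v 0\<close>.\<close>

lemma normalised_unique:
  assumes f: "normalised f \<sigma> k \<pi>" and f': "normalised f' \<sigma>' k' \<pi>'"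
    and eq: "\<And>w. w \<in> W \<Longrightarrow> ptG (shift f w) = ptG (shift f' w)"
  shows "f = f'" "\<sigma> = \<sigma>'" "k = k'" "\<pi> = \<pi>'"
proof -
  note n = normalised_simps[OF f] and n' = normalised_simps[OF f']
  note s = semilinear_simps[OF n(1)] and s' = semilinear_simps[OF n'(1)]
  have sh: "shift f w = shift f' w" if "w \<in> W" for w
    using eq[OF that] n(7)[OF that] n'(7)[OF that] ptG_eq_iff by blast
  have fe: "f e = f' e" using sh[of 0] by (simp add: shift_def s s')
  have fW: "f w = f' w" if "w \<in> W" for w using sh[OF that] fe by (simp add: shift_def)
  have kp: "k t = k' t \<and> \<pi> t = \<pi>' t" for t
  proof -
    have eq: "k t *s v (\<pi> t) = k' t *s v (\<pi>' t)" using fW[of "v t"] n(5) n'(5) by simp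
    have "\<pi> t = \<pi>' t"
    proof (rule ccontr)
      assume "\<pi> t \<noteq> \<pi>' t"
      moreover have "k t *s v (\<pi> t) + (- k' t) *s v (\<pi>' t) = 0" using eq by simp
      ultimately have "k t = 0" by (rule v_indep2)
      thus False using n(4) by simp
    qed
    with eq show ?thesis by simp
  qed
  thus "k = k'" "\<pi> = \<pi>'" by auto
  have sig: "\<sigma> c = \<sigma>' c" for c
  proof -
    have "\<sigma> c *s f (v 0) = \<sigma>' c *s f (v 0)" using fW[of "c *s v 0"] fW[of "v 0"] by (simp add: s s')
    moreover have "f (v 0) \<noteq> 0" using n(4)[of 0] by (simp add: n(5))
    ultimately show ?thesis by simp
  qed
  thus "\<sigma> = \<sigma>'" by auto
  show "f = f'"
  proof
    fix x
    obtain c w where "w \<in> W" "x = c *s e + w" using e_decomp by blast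
    thus "f x = f' x" by (simp add: s s' fe fW sig)
  qed
qed

text \<open>Injectivity holds because the affine points determine the normalised representative;
  surjectivity, because \<open>model_automorphism\<close> supplies a semilinear map with the given
  action on points and lines.\<close>

lemma VA_iso:
  assumes nq': "3 \<le> n \<or> odd CARD('a)"
    and q: "n + 3 \<le> CARD('a) \<or> prime CARD('a) \<and> (n + 2 \<le> CARD('a) \<or> CARD('a) = 3)"
  shows "VA \<in> iso \<G> (graph_Aut \<Gamma>)"
proof -
  have "VA \<in> hom \<G> (graph_Aut \<Gamma>)"
  proof (rule homI)
    fix g h assume gh: "g \<in> carrier \<G>" "h \<in> carrier \<G>"
    show "VA g \<in> carrier (graph_Aut \<Gamma>)" by (rule VA_in_graph_Aut[OF gh(1)])
    show "VA (g \<otimes>\<^bsub>\<G>\<^esub> h) = VA g \<otimes>\<^bsub>graph_Aut \<Gamma>\<^esub> VA h"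
      by (simp only: VA_mult[OF gh] mult_graph_Aut[OF VA_Bij[OF gh(1)] VA_Bij[OF gh(2)]])
  qed
  moreover have "inj_on VA (carrier \<G>)"
  proof (rule inj_onI)
    fix g g' assume g: "g \<in> carrier \<G>" "g' \<in> carrier \<G>" "VA g = VA g'"
    obtain f \<sigma> k \<pi> f' \<sigma>' k' \<pi>' where f: "normalised f \<sigma> k \<pi>" "g = induced f"
      "normalised f' \<sigma>' k' \<pi>'" "g' = induced f'"
      using g unfolding stab_normal_form by blast
    have "ptG (shift f w) = ptG (shift f' w)" if "w \<in> W" for w
      using VA_simps(1)[OF f(1) that] VA_simps(1)[OF f(3) that] g(3) f by simp
    hence "f = f'" by (rule normalised_unique(1)[OF f(1,3)])
    thus "g = g'" using f by simp
  qed
  moreover have "carrier (graph_Aut \<Gamma>) \<subseteq> VA ` carrier \<G>"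
  proof
    fix \<psi> assume \<psi>: "\<psi> \<in> carrier (graph_Aut \<Gamma>)"
    hence bij: "bij_betw \<psi> (fst \<Gamma>) (fst \<Gamma>)" and ext: "\<psi> \<in> extensional (fst \<Gamma>)"
      and adj: "\<And>u w. u \<in> fst \<Gamma> \<Longrightarrow> w \<in> fst \<Gamma> \<Longrightarrow> {\<psi> u, \<psi> w} \<in> snd \<Gamma> \<longleftrightarrow> {u, w} \<in> snd \<Gamma>"
      by (auto simp: graph_Aut_iff Bij_def)
    obtain f \<phi> \<pi> where f: "semilinear_bij f" "bij \<pi>" "\<forall>t. \<exists>k. f (v t) = k *s v (\<pi> t)"
      "\<forall>w\<in>W. \<phi> w \<in> W \<and> f (e + w) = e + \<phi> w \<and> \<psi> (Inl (ptG w)) = Inl (ptG (\<phi> w)) \<and>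
        (\<forall>t. \<psi> (Inr (lineG w t)) = Inr (lineG (\<phi> w) (\<pi> t)))"
      using model_automorphism[OF nq' q model_Gamma bij adj] by blast
    obtain k where k: "\<And>t. f (v t) = k t *s v (\<pi> t)" using f(3) by metis
    have "k t \<noteq> 0" for t using k[of t] semilinear_bij_nonzero[OF f(1), of "v t"] by auto
    moreover have "f e - e \<in> W" using f(4) by (metis W_closed(1) add.right_neutral add_diff_cancel_left')
    moreover obtain \<sigma> where "semilinear \<sigma> f" using f(1) by (auto simp: semilinear_bij_iff)
    ultimately have norm: "normalised f \<sigma> k \<pi>" using f(1,2) k by (simp add: normalised_def)
    have sh: "shift f w = \<phi> w" if "w \<in> W" for w
      using normalised_simps(8)[OF norm, of w] f(4) that by (metis add_left_cancel)
    have "VA (induced f) = \<psi>"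
    proof
      fix u show "VA (induced f) u = \<psi> u"
      proof (cases "u \<in> fst \<Gamma>")
        case True
        thus ?thesis by (cases rule: G_cases) (use f(4) in \<open>auto simp: VA_simps[OF norm] sh\<close>)
      next
        case False
        thus ?thesis using ext by (simp add: vertex_action_def extensional_def)
      qed
    qed
    moreover have "induced f \<in> carrier \<G>" using norm by (auto simp: stab_normal_form)
    ultimately show "\<psi> \<in> VA ` carrier \<G>" by blast
  qed
  ultimately show ?thesis
    using VA_in_graph_Aut by (auto simp: iso_def bij_betw_def)
qed

section \<open>The order of the stabiliser\<close>

lemma normalised_direction_maps:
  assumes f: "normalised f \<sigma> k \<pi>"
  shows "direction_maps (\<lambda>t c. \<sigma> c * k t) \<pi>"
proof -
  note n = normalised_simps[OF f]
  note s = semilinear_simps[OF n(1)] and \<sigma>s = field_automorphism_simps[OF semilinear_automorphism[OF n(1)]]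
  have "(\<Sum>t\<in>S. (\<sigma> (l * node_weight S t) * k t) *s v (\<pi> t)) = 0" if S: "card S = n + 2" for S l
  proof -
    have "(\<Sum>t\<in>S. (\<sigma> (l * node_weight S t) * k t) *s v (\<pi> t)) = f (\<Sum>t\<in>S. (l * node_weight S t) *s v t)"
      by (simp add: s n(5))
    also have "(\<Sum>t\<in>S. (l * node_weight S t) *s v t) = l *s (\<Sum>t\<in>S. node_weight S t *s v t)"
      by (simp add: vec.scale_sum_right)
    finally show ?thesis using relation_v[OF S] by (simp add: s)
  qed
  thus ?thesis using n(3,4)
    by (auto simp: direction_maps_def bij_def inj_def \<sigma>s ring_distribs)
qed

text \<open>Normalised maps correspond to quadruples: the translation part
  \<open>w0 = f e - e\<close>, the common factor \<open>k\<close>, the companion automorphism and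
  the permutation. The bound on \<open>q\<close> is what makes the factor the same for all
  directions.\<close>

lemma card_stab:
  assumes q: "n + 2 \<le> CARD('a)"
  shows "card (carrier \<G>)
    = card W * (CARD('a) - 1) * card {(\<sigma>, \<pi>). compatible \<sigma> \<pi>}"
proof -
  define D where "D = W \<times> (UNIV - {0 :: 'a}) \<times> {(\<sigma>, \<pi>). compatible \<sigma> \<pi>}"
  define F where "F = (\<lambda>(w0, k, \<sigma>, \<pi>). SOME f. normalised f \<sigma> (\<lambda>_. k) \<pi> \<and> f e = e + w0)"
  have F: "normalised (F (w0, k, \<sigma>, \<pi>)) \<sigma> (\<lambda>_. k) \<pi> \<and> F (w0, k, \<sigma>, \<pi>) e = e + w0"
    if "(w0, k, \<sigma>, \<pi>) \<in> D" for w0 k \<sigma> \<pi>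
  proof -
    have "\<exists>f. normalised f \<sigma> (\<lambda>_. k) \<pi> \<and> f e = e + w0"
      using that by (intro realisation_normalised) (auto simp: D_def)
    from someI_ex[OF this] show ?thesis by (simp add: F_def)
  qed
  have "bij_betw (\<lambda>d. induced (F d)) D (carrier \<G>)"
    unfolding bij_betw_def
  proof (intro conjI equalityI subsetI inj_onI)
    fix d d' assume d: "d \<in> D" "d' \<in> D" "induced (F d) = induced (F d')"
    obtain w0 k \<sigma> \<pi> w0' k' \<sigma>' \<pi>' where dd: "d = (w0, k, \<sigma>, \<pi>)" "d' = (w0', k', \<sigma>', \<pi>')"
      by (metis prod_cases4)
    have n: "normalised (F d) \<sigma> (\<lambda>_. k) \<pi>" "F d e = e + w0" "normalised (F d') \<sigma>' (\<lambda>_. k') \<pi>'" "F d' e = e + w0'"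
      using F d dd by auto
    have eq: "ptG (shift (F d) w) = ptG (shift (F d') w)" if "w \<in> W" for w
      using induced_ptG[OF n(1) that] induced_ptG[OF n(3) that] d(3) by simp
    note u = normalised_unique[OF n(1,3) eq]
    have "k = k'" using u(3) by (metis)
    moreover have "w0 = w0'" using u(1) n(2,4) by simp
    ultimately show "d = d'" using u(2,4) dd by simp
  next
    fix g assume "g \<in> (\<lambda>d. induced (F d)) ` D"
    then obtain w0 k \<sigma> \<pi> where "(w0, k, \<sigma>, \<pi>) \<in> D" "g = induced (F (w0, k, \<sigma>, \<pi>))" by auto
    thus "g \<in> carrier \<G>" using F stab_normal_form by blast
  next
    fix g assume "g \<in> carrier \<G>"
    then obtain f \<sigma> k \<pi> where f: "normalised f \<sigma> k \<pi>" "g = induced f" by (auto simp: stab_normal_form)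
    note n = normalised_simps[OF f(1)]
    note dc = direction_maps_compatible[OF normalised_direction_maps[OF f(1)] semilinear_automorphism[OF n(1)] q]
    have k: "k = (\<lambda>_. k 0)" using dc(2) by blast
    let ?d = "(f e - e, k 0, \<sigma>, \<pi>)"
    have d: "?d \<in> D" using f(1) n(4) dc(1) by (simp add: D_def normalised_def)
    have n': "normalised (F ?d) \<sigma> k \<pi>" "F ?d e = f e" using F[OF d, folded k] by auto
    have "F ?d w = f w" if "w \<in> W" for w
      using that
      by (induct rule: W_induct)
        (simp_all add: semilinear_simps[OF n(1)] semilinear_simps[OF normalised_simps(1)[OF n'(1)]] n(5) normalised_simps(5)[OF n'(1)])
    hence "ptG (shift (F ?d) w) = ptG (shift f w)" if "w \<in> W" for w
      using that n'(2) by (simp add: shift_def)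
    hence "F ?d = f" by (rule normalised_unique(1)[OF n'(1) f(1)])
    thus "g \<in> (\<lambda>d. induced (F d)) ` D" using d f(2) by (intro image_eqI[of _ _ ?d]) auto
  qed
  hence "card (carrier \<G>) = card D" by (simp add: bij_betw_same_card)
  also have "\<dots> = card W * (CARD('a) - 1) * card {(\<sigma>, \<pi>). compatible \<sigma> \<pi>}"
    by (simp add: D_def card_cartesian_product card_Diff_subset mult.assoc)
  finally show ?thesis .
qed

text \<open>A compatible pair is realised by a semilinear map, whose scalar functions along the
  directions then fall under the classification by cross-ratios.\<close>

lemma compatible_imp_affine:
  assumes comp: "compatible \<sigma> \<pi>" and q: "n + 3 \<le> CARD('a)"
  shows "\<pi> t = (\<pi> 1 - \<pi> 0) * \<sigma> t + \<pi> 0"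
proof -
  obtain f where f: "normalised f \<sigma> (\<lambda>_. 1) \<pi>"
    using realisation_normalised[OF comp, of 1 0] by auto
  have "field_automorphism \<sigma>" using comp by (simp add: compatible_def)
  moreover have "n + 2 \<le> CARD('a)" using q by simp
  ultimately show ?thesis
    by (rule direction_maps_compatible(3)[OF normalised_direction_maps[OF f] _ _ q])
qed

lemma card_compatible_affine:
  assumes q: "n + 3 \<le> CARD('a)"
  shows "card {(\<sigma>, \<pi>). compatible \<sigma> \<pi>}
    = card {\<sigma> :: 'a \<Rightarrow> 'a. field_automorphism \<sigma>} * (CARD('a) - 1) * CARD('a)"
proof -
  let ?A = "{\<sigma> :: 'a \<Rightarrow> 'a. field_automorphism \<sigma>} \<times> (UNIV - {0 :: 'a}) \<times> (UNIV :: 'a set)"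
  let ?F = "\<lambda>(\<sigma> :: 'a \<Rightarrow> 'a, \<alpha>, \<beta>). (\<sigma>, \<lambda>t. \<alpha> * \<sigma> t + \<beta>)"
  have "bij_betw ?F ?A {(\<sigma>, \<pi>). compatible \<sigma> \<pi>}"
    unfolding bij_betw_def
  proof (intro conjI equalityI subsetI inj_onI)
    fix x y assume xy: "x \<in> ?A" "y \<in> ?A" "?F x = ?F y"
    obtain \<sigma> \<alpha> \<beta> \<sigma>' \<alpha>' \<beta>' where d: "x = (\<sigma>, \<alpha>, \<beta>)" "y = (\<sigma>', \<alpha>', \<beta>')"
      by (metis prod_cases3)
    have \<sigma>: "\<sigma> = \<sigma>'" and eq: "\<alpha> * \<sigma> t + \<beta> = \<alpha>' * \<sigma> t + \<beta>'" for t
      using xy(3) d by (auto dest: fun_cong)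
    have "field_automorphism \<sigma>" using xy d by simp
    note s = field_automorphism_simps(1,2)[OF this]
    have "\<beta> = \<beta>'" using eq[of 0] s by simp
    moreover from this have "\<alpha> = \<alpha>'" using eq[of 1] s by simp
    ultimately show "x = y" using d \<sigma> by simp
  next
    fix z assume "z \<in> ?F ` ?A"
    then obtain \<sigma> \<alpha> \<beta> where z: "z = (\<sigma>, \<lambda>t. \<alpha> * \<sigma> t + \<beta>)" "field_automorphism \<sigma>" "\<alpha> \<noteq> 0" by auto
    show "z \<in> {(\<sigma>, \<pi>). compatible \<sigma> \<pi>}"
      using compatible_affine[OF z(2) refl z(3)] z(1) by simp
  next
    fix z assume "z \<in> {(\<sigma>, \<pi>). compatible \<sigma> \<pi>}"
    then obtain \<sigma> \<pi> where z: "z = (\<sigma>, \<pi>)" "compatible \<sigma> \<pi>" by auto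
    have "(\<sigma>, \<pi>) = (\<sigma>, \<lambda>t. (\<pi> 1 - \<pi> 0) * \<sigma> t + \<pi> 0)"
      by (intro arg_cong[where f = "Pair \<sigma>"] ext) (rule compatible_imp_affine[OF z(2) q])
    hence z': "z = ?F (\<sigma>, \<pi> 1 - \<pi> 0, \<pi> 0)"
      unfolding z(1) case_prod_conv .
    have "\<pi> 1 \<noteq> \<pi> 0" using z(2) by (simp add: compatible_def bij_def inj_eq)
    moreover have "field_automorphism \<sigma>" using z(2) by (simp add: compatible_def)
    ultimately have "(\<sigma>, \<pi> 1 - \<pi> 0, \<pi> 0) \<in> ?A" by simp
    with z' show "z \<in> ?F ` ?A"
      by (rule image_eqI)
  qed
  hence "card ?A = card {(\<sigma>, \<pi>). compatible \<sigma> \<pi>}" by (rule bij_betw_same_card)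
  thus ?thesis by (simp add: card_cartesian_product card_Diff_subset mult.assoc)
qed

lemma card_compatible_permutation:
  assumes q: "CARD('a) = n + 2"
  shows "card {(\<sigma>, \<pi>). compatible \<sigma> \<pi>}
    = card {\<sigma> :: 'a \<Rightarrow> 'a. field_automorphism \<sigma>} * fact CARD('a)"
proof -
  have "{(\<sigma>, \<pi>). compatible \<sigma> \<pi>} = {\<sigma>. field_automorphism \<sigma>} \<times> {\<pi>. \<pi> permutes UNIV}"
    using compatible_permutation[OF q] by (auto simp: compatible_def permutes_univ bij_iff)
  thus ?thesis
    by (simp add: card_cartesian_product card_permutations[OF refl])
qed

end

section \<open>The graph on coordinate vectors\<close>

text \<open>Stated for an explicit two-sided inverse \<open>\<theta>'\<close>, so that the same fact
  serves both directions of the isomorphism.\<close>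

lemma graph_Aut_conjugate:
  assumes bij: "bij_betw \<theta> (fst G) (fst G')"
    and adj: "\<And>u w. u \<in> fst G \<Longrightarrow> w \<in> fst G \<Longrightarrow> {\<theta> u, \<theta> w} \<in> snd G' \<longleftrightarrow> {u, w} \<in> snd G"
    and inv: "\<And>x. x \<in> fst G' \<Longrightarrow> \<theta>' x \<in> fst G" "\<And>x. x \<in> fst G' \<Longrightarrow> \<theta> (\<theta>' x) = x"
      "\<And>x. x \<in> fst G \<Longrightarrow> \<theta>' (\<theta> x) = x"
    and \<psi>: "\<psi> \<in> carrier (graph_Aut G)"
  shows "restrict (\<lambda>x. \<theta> (\<psi> (\<theta>' x))) (fst G') \<in> carrier (graph_Aut G')"
proof -
  have \<psi>_bij: "bij_betw \<psi> (fst G) (fst G)"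
    and \<psi>_adj: "\<And>u w. u \<in> fst G \<Longrightarrow> w \<in> fst G \<Longrightarrow> {\<psi> u, \<psi> w} \<in> snd G \<longleftrightarrow> {u, w} \<in> snd G"
    using \<psi> unfolding graph_Aut_iff by (auto simp: Bij_def)
  have \<psi>V: "\<psi> u \<in> fst G" if "u \<in> fst G" for u using bij_betwE[OF \<psi>_bij] that by blast
  have "bij_betw \<theta>' (fst G') (fst G)"
    by (rule bij_betwI[of _ _ _ \<theta>]) (use inv bij_betwE[OF bij] in auto)
  hence "bij_betw (\<theta> \<circ> (\<psi> \<circ> \<theta>')) (fst G') (fst G')"
    using \<psi>_bij bij by (intro bij_betw_trans)
  hence "bij_betw (restrict (\<lambda>x. \<theta> (\<psi> (\<theta>' x))) (fst G')) (fst G') (fst G')"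
    by (subst bij_betw_restrict_eq) (simp add: o_def)
  moreover have "{\<theta> (\<psi> (\<theta>' u)), \<theta> (\<psi> (\<theta>' w))} \<in> snd G' \<longleftrightarrow> {u, w} \<in> snd G'"
    if "u \<in> fst G'" "w \<in> fst G'" for u w
    using adj[OF \<psi>V \<psi>V] \<psi>_adj adj[of "\<theta>' u" "\<theta>' w"] inv(1,2) that by simp
  ultimately show ?thesis by (simp add: graph_Aut_iff Bij_def)
qed

lemma graph_Aut_iso:
  assumes bij: "bij_betw \<theta> (fst G) (fst G')"
    and adj: "\<And>u w. u \<in> fst G \<Longrightarrow> w \<in> fst G \<Longrightarrow> {\<theta> u, \<theta> w} \<in> snd G' \<longleftrightarrow> {u, w} \<in> snd G"
  shows "graph_Aut G \<cong> graph_Aut G'"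
proof -
  define \<theta>' where "\<theta>' = inv_into (fst G) \<theta>"
  have inv: "\<theta>' x \<in> fst G" "\<theta> (\<theta>' x) = x" if "x \<in> fst G'" for x
    using bij that by (auto simp: \<theta>'_def bij_betw_def inv_into_into f_inv_into_f)
  have inv': "\<theta>' (\<theta> x) = x" "\<theta> x \<in> fst G'" if "x \<in> fst G" for x
    using bij that by (auto simp: \<theta>'_def bij_betw_def)
  have bij': "bij_betw \<theta>' (fst G') (fst G)" unfolding \<theta>'_def by (rule bij_betw_inv_into[OF bij])
  have adj': "{\<theta>' u, \<theta>' w} \<in> snd G \<longleftrightarrow> {u, w} \<in> snd G'" if "u \<in> fst G'" "w \<in> fst G'" for u w
    using adj[of "\<theta>' u" "\<theta>' w"] inv that by simp
  let ?F = "\<lambda>\<psi>. restrict (\<lambda>x. \<theta> (\<psi> (\<theta>' x))) (fst G')"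
  let ?F' = "\<lambda>\<psi>. restrict (\<lambda>x. \<theta>' (\<psi> (\<theta> x))) (fst G)"
  have into: "?F \<psi> \<in> carrier (graph_Aut G')" if "\<psi> \<in> carrier (graph_Aut G)" for \<psi>
    by (rule graph_Aut_conjugate[OF bij adj inv inv'(1) that])
  have into': "?F' \<psi> \<in> carrier (graph_Aut G)" if "\<psi> \<in> carrier (graph_Aut G')" for \<psi>
    by (rule graph_Aut_conjugate[OF bij' adj' inv'(2,1) inv(2) that])
  have V1: "\<psi> x \<in> fst G" if "\<psi> \<in> carrier (graph_Aut G)" "x \<in> fst G" for \<psi> x
    using that by (auto simp: graph_Aut_iff Bij_def bij_betw_def)
  have V2: "\<psi> x \<in> fst G'" if "\<psi> \<in> carrier (graph_Aut G')" "x \<in> fst G'" for \<psi> x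
    using that by (auto simp: graph_Aut_iff Bij_def bij_betw_def)
  have e1: "\<psi> x = undefined" if "\<psi> \<in> carrier (graph_Aut G)" "x \<notin> fst G" for \<psi> x
    using that by (auto simp: graph_Aut_iff Bij_def extensional_def)
  have e2: "\<psi> x = undefined" if "\<psi> \<in> carrier (graph_Aut G')" "x \<notin> fst G'" for \<psi> x
    using that by (auto simp: graph_Aut_iff Bij_def extensional_def)
  have "?F \<in> hom (graph_Aut G) (graph_Aut G')"
  proof (rule homI)
    fix \<psi> \<eta> assume pc: "\<psi> \<in> carrier (graph_Aut G)" "\<eta> \<in> carrier (graph_Aut G)"
    show "?F \<psi> \<in> carrier (graph_Aut G')" by (rule into[OF pc(1)])
    have B: "\<psi> \<in> Bij (fst G)" "\<eta> \<in> Bij (fst G)" "?F \<psi> \<in> Bij (fst G')" "?F \<eta> \<in> Bij (fst G')"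
      using pc into unfolding graph_Aut_iff by blast+
    show "?F (\<psi> \<otimes>\<^bsub>graph_Aut G\<^esub> \<eta>) = ?F \<psi> \<otimes>\<^bsub>graph_Aut G'\<^esub> ?F \<eta>"
      unfolding mult_graph_Aut[OF B(1,2)] mult_graph_Aut[OF B(3,4)]
      by (rule ext) (simp add: compose_def inv inv' V1[OF pc(2)])
  qed
  moreover have "bij_betw ?F (carrier (graph_Aut G)) (carrier (graph_Aut G'))"
  proof (rule bij_betwI[of _ _ _ ?F'])
    show "?F \<in> carrier (graph_Aut G) \<rightarrow> carrier (graph_Aut G')" using into by blast
    show "?F' \<in> carrier (graph_Aut G') \<rightarrow> carrier (graph_Aut G)" using into' by blast
    show "?F' (?F \<psi>) = \<psi>" if "\<psi> \<in> carrier (graph_Aut G)" for \<psi>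
      by (rule ext) (simp add: inv' V1[OF that] e1[OF that])
    show "?F (?F' \<psi>) = \<psi>" if "\<psi> \<in> carrier (graph_Aut G')" for \<psi>
      by (rule ext) (simp add: inv V2[OF that] e2[OF that])
  qed
  ultimately have "?F \<in> iso (graph_Aut G) (graph_Aut G')" by (simp add: iso_def)
  thus ?thesis unfolding is_iso_def by blast
qed

context moment_curve begin

text \<open>A model names its vertices by points of \<open>W\<close> and parameters, and matching
  the names is a graph isomorphism. On lines this is well defined because both graphs identify the
  same names.\<close>

lemma models_isomorphic:
  assumes M: "model G pt lin" and M': "model G' pt' lin'"
  shows "graph_Aut G \<cong> graph_Aut G'"
proof -
  note m = model_simps[OF M] and m' = model_simps[OF M'] and M_cases = model_cases[OF M, consumes 1, case_names pt lin]
  define \<theta> where "\<theta> u = (if u \<in> pt ` W then pt' (inv_into W pt u)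
    else (SOME x. \<exists>w\<in>W. \<exists>t. u = lin w t \<and> x = lin' w t))" for u
  have \<theta>_pt: "\<theta> (pt w) = pt' w" if "w \<in> W" for w
  proof -
    have "inj_on pt W" using m(3) by (simp add: inj_on_def)
    thus ?thesis using that by (simp add: \<theta>_def)
  qed
  have \<theta>_lin: "\<theta> (lin w t) = lin' w t" if w: "w \<in> W" for w t
  proof -
    have "lin w t \<notin> pt ` W" using m(5)[OF _ w] by (metis imageE)
    moreover have "(SOME x. \<exists>a\<in>W. \<exists>s. lin w t = lin a s \<and> x = lin' a s) = lin' w t"
    proof (rule some_equality)
      fix x assume "\<exists>a\<in>W. \<exists>s. lin w t = lin a s \<and> x = lin' a s"
      then obtain a s where a: "a \<in> W" "lin w t = lin a s" "x = lin' a s" by blast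
      thus "x = lin' w t" using a(2,3) m(4)[OF w a(1)] m'(4)[OF w a(1)] by metis
    qed (use w in blast)
    ultimately show ?thesis by (simp add: \<theta>_def)
  qed
  have into: "\<theta> u \<in> fst G'" if "u \<in> fst G" for u
    using that by (cases rule: M_cases) (simp_all add: \<theta>_pt \<theta>_lin m'(1,2))
  have inj: "inj_on \<theta> (fst G)"
  proof (rule inj_onI)
    fix u u' assume u: "u \<in> fst G" "u' \<in> fst G" "\<theta> u = \<theta> u'"
    show "u = u'"
      using u(1)
    proof (cases rule: M_cases)
      case (pt w)
      note w = this
      show ?thesis using u(2)
      proof (cases rule: M_cases)
        case (pt w')
        have "pt' w = pt' w'" using u(3) w pt by (simp only: \<theta>_pt)
        hence "w = w'" using m'(3)[OF w(1) pt(1)] by blast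
        thus ?thesis using w pt by simp
      next
        case (lin w' t')
        have "pt' w = lin' w' t'" using u(3) w lin by (simp only: \<theta>_pt \<theta>_lin)
        thus ?thesis using m'(5)[OF w(1) lin(1)] by blast
      qed
    next
      case (lin w t)
      note w = this
      show ?thesis using u(2)
      proof (cases rule: M_cases)
        case (pt w')
        have "pt' w' = lin' w t" using u(3) w pt by (simp only: \<theta>_pt \<theta>_lin)
        thus ?thesis using m'(5)[OF pt(1) w(1)] by blast
      next
        case (lin w' t')
        have "lin' w t = lin' w' t'" using u(3) w lin by (simp only: \<theta>_lin)
        hence "lin w t = lin w' t'" using m'(4)[OF w(1) lin(1)] m(4)[OF w(1) lin(1)] by blast
        thus ?thesis using w lin by simp
      qed
    qed
  qed
  have "fst G' \<subseteq> \<theta> ` fst G"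
  proof
    fix x assume "x \<in> fst G'"
    thus "x \<in> \<theta> ` fst G"
    proof (cases rule: model_cases[OF M', consumes 1, case_names pt lin])
      case (pt w)
      thus ?thesis using \<theta>_pt[OF pt(1)] m(1)[OF pt(1)] by (intro image_eqI[of _ _ "pt w"]) simp_all
    next
      case (lin w t)
      thus ?thesis using \<theta>_lin[OF lin(1)] m(2)[OF lin(1)] by (intro image_eqI[of _ _ "lin w t"]) simp_all
    qed
  qed
  hence bij: "bij_betw \<theta> (fst G) (fst G')" using inj into by (auto simp: bij_betw_def)
  have "{\<theta> u, \<theta> u'} \<in> snd G' \<longleftrightarrow> {u, u'} \<in> snd G" if u: "u \<in> fst G" "u' \<in> fst G" for u u'
    using u(1)
  proof (cases rule: M_cases)
    case (pt w)
    note w = this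
    show ?thesis using u(2)
    proof (cases rule: M_cases)
      case (pt w')
      show ?thesis unfolding w(2) pt(2) \<theta>_pt[OF w(1)] \<theta>_pt[OF pt(1)]
        using m(8)[OF w(1) pt(1)] m'(8)[OF w(1) pt(1)] by blast
    next
      case (lin w' t')
      show ?thesis unfolding w(2) lin(2) \<theta>_pt[OF w(1)] \<theta>_lin[OF lin(1)]
        using m(6)[OF lin(1) w(1)] m'(6)[OF lin(1) w(1)] by blast
    qed
  next
    case (lin w t)
    note w = this
    show ?thesis using u(2)
    proof (cases rule: M_cases)
      case (pt w')
      show ?thesis unfolding w(2) pt(2) \<theta>_lin[OF w(1)] \<theta>_pt[OF pt(1)]
        using m(7)[OF w(1) pt(1)] m'(7)[OF w(1) pt(1)] by blast
    next
      case (lin w' t')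
      show ?thesis unfolding w(2) lin(2) \<theta>_lin[OF w(1)] \<theta>_lin[OF lin(1)]
        using m(9)[OF w(1) lin(1)] m'(9)[OF w(1) lin(1)] by blast
    qed
  qed
  thus ?thesis by (rule graph_Aut_iso[OF bij])
qed

section \<open>Coordinates on \<open>W\<close> and the coordinate graph as a model\<close>

definition vec_of :: "(nat \<Rightarrow> 'a) \<Rightarrow> 'a^'m" where
  "vec_of l = (\<Sum>i=0..n. l (i + 1) *s b i)"

lemma vec_of_eq_iff: "vec_of l = vec_of l' \<longleftrightarrow> (\<forall>i\<le>n. l (i + 1) = l' (i + 1))"
proof
  assume "vec_of l = vec_of l'"
  hence "(\<Sum>i=0..n. (l (i + 1) - l' (i + 1)) *s b i) = 0"
    by (simp add: vec_of_def vec.scale_left_diff_distrib sum_subtractf)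
  thus "\<forall>i\<le>n. l (i + 1) = l' (i + 1)"
    using sum_b_eq_0[of "\<lambda>i. l (i + 1) - l' (i + 1)"] by auto
next
  assume "\<forall>i\<le>n. l (i + 1) = l' (i + 1)"
  thus "vec_of l = vec_of l'" unfolding vec_of_def by (intro sum.cong) auto
qed

lemma vec_of_add_v: "vec_of l + c *s v t = vec_of (\<lambda>i. l i + c * t ^ (i - 1))"
  by (simp add: vec_of_def v_def vec.scale_sum_right sum.distrib[symmetric] vec.scale_left_distrib)

text \<open>The coordinates of a multiple of \<open>v t\<close> form a geometric progression with
  ratio \<open>t\<close>. The recurrence on the right is the one satisfied by the difference of two
  neighbours of a vertex \<open>p\<close> with \<open>p 1 = t\<close>.\<close>

lemma dir_vec_of:
  "dir (vec_of l) (vec_of l') t \<longleftrightarrow> (\<forall>i\<in>{1..n}. l' (i + 1) - l (i + 1) = t * (l' i - l i))"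
proof -
  have "dir (vec_of l) (vec_of l') t \<longleftrightarrow> (\<exists>c. \<forall>i\<le>n. l' (i + 1) = l (i + 1) + c * t ^ i)"
    by (simp add: dir_def vec_of_add_v vec_of_eq_iff)
  also have "\<dots> \<longleftrightarrow> (\<forall>i\<in>{1..n}. l' (i + 1) - l (i + 1) = t * (l' i - l i))"
  proof
    assume "\<exists>c. \<forall>i\<le>n. l' (i + 1) = l (i + 1) + c * t ^ i"
    then obtain c where c: "\<And>i. i \<le> n \<Longrightarrow> l' (i + 1) = l (i + 1) + c * t ^ i" by blast
    show "\<forall>i\<in>{1..n}. l' (i + 1) - l (i + 1) = t * (l' i - l i)"
    proof
      fix i assume i: "i \<in> {1..n}"
      then obtain j where j: "i = Suc j" by (cases i) auto
      show "l' (i + 1) - l (i + 1) = t * (l' i - l i)"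
        using c[of i] c[of j] i unfolding j by (simp add: algebra_simps)
    qed
  next
    assume rec: "\<forall>i\<in>{1..n}. l' (i + 1) - l (i + 1) = t * (l' i - l i)"
    have "l' (i + 1) - l (i + 1) = (l' 1 - l 1) * t ^ i" if "i \<le> n" for i
      using that
    proof (induct i)
      case (Suc i)
      hence "l' (Suc i + 1) - l (Suc i + 1) = t * (l' (i + 1) - l (i + 1))" using rec by simp
      also have "\<dots> = (l' 1 - l 1) * t ^ Suc i" using Suc by simp
      finally show ?case .
    qed simp
    thus "\<exists>c. \<forall>i\<le>n. l' (i + 1) = l (i + 1) + c * t ^ i"
      by (intro exI[of _ "l' 1 - l 1"]) (auto simp: algebra_simps)
  qed
  finally show ?thesis .
qed

lemma coord_space_eqI:
  assumes "l \<in> coord_space n" "l' \<in> coord_space n" "\<And>i. i \<le> n \<Longrightarrow> l (i + 1) = l' (i + 1)"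
  shows "l = l'"
proof (rule PiE_ext)
  show "l \<in> {1..n+1} \<rightarrow>\<^sub>E UNIV" "l' \<in> {1..n+1} \<rightarrow>\<^sub>E UNIV" using assms(1,2) by (auto simp: coord_space_def)
  fix i assume "i \<in> {1..n+1}"
  thus "l i = l' i" using assms(3)[of "i - 1"] by (cases i) auto
qed

lemma bij_vec_of: "bij_betw vec_of (coord_space n) W"
  unfolding bij_betw_def
proof (intro conjI equalityI subsetI inj_onI)
  fix l l' assume "l \<in> coord_space n" "l' \<in> coord_space n" "vec_of l = vec_of l'"
  thus "l = l'" by (intro coord_space_eqI) (auto simp: vec_of_eq_iff)
next
  fix x assume "x \<in> vec_of ` coord_space n"
  then obtain l where l: "x = vec_of l" by blast
  show "x \<in> W" unfolding l vec_of_def W_def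
    by (intro vec.span_sum vec.span_scale vec.span_base imageI)
next
  fix x assume "x \<in> W"
  then obtain u where "x = (\<Sum>y\<in>b ` {0..n}. u y *s y)"
    unfolding W_def by (subst (asm) vec.span_finite) auto
  also have "\<dots> = (\<Sum>i=0..n. u (b i) *s b i)" using inj_b by (simp add: sum.reindex)
  also have "\<dots> = vec_of (restrict (\<lambda>i. u (b (i - 1))) {1..n+1})"
    unfolding vec_of_def by (intro sum.cong) auto
  finally show "x \<in> vec_of ` coord_space n" by (auto simp: coord_space_def)
qed

lemma card_W: "card W = CARD('a) ^ (n + 1)"
proof -
  have "card W = card (coord_space n :: (nat \<Rightarrow> 'a) set)"
    using bij_betw_same_card[OF bij_vec_of] by simp
  thus ?thesis by (simp add: coord_space_def card_PiE)
qed

definition coords :: "'a^'m \<Rightarrow> nat \<Rightarrow> 'a" where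
  "coords = inv_into (coord_space n) vec_of"

text \<open>A vertex \<open>l\<close> of the second class is a point of \<open>W\<close>, and a vertex \<open>p\<close> of the first class is a
  line with direction \<open>v (p 1)\<close>: adjacency determines \<open>l\<close> from \<open>p\<close> and \<open>l 1\<close>.\<close>

definition ptL :: "'a^'m \<Rightarrow> (nat \<Rightarrow> 'a) + (nat \<Rightarrow> 'a)" where
  "ptL w = Inr (coords w)"

text \<open>The adjacency equations solved for \<open>p\<close>, given \<open>p 1 = t\<close> and
  the neighbour \<open>l = coords w\<close>.\<close>

definition lineL :: "'a^'m \<Rightarrow> 'a \<Rightarrow> (nat \<Rightarrow> 'a) + (nat \<Rightarrow> 'a)" where
  "lineL w t = Inl (restrict (\<lambda>i. if i = 1 then t else t * coords w (i - 1) - coords w i) {1..n+1})"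

lemma coords: "w \<in> W \<Longrightarrow> coords w \<in> coord_space n" "w \<in> W \<Longrightarrow> vec_of (coords w) = w"
  "l \<in> coord_space n \<Longrightarrow> coords (vec_of l) = l" "l \<in> coord_space n \<Longrightarrow> vec_of l \<in> W"
  using bij_vec_of by (auto simp: coords_def bij_betw_def inv_into_into f_inv_into_f)

lemma dir_coords:
  assumes "w \<in> W" "w' \<in> W"
  shows "dir w w' t \<longleftrightarrow> (\<forall>i\<in>{1..n}. coords w' (i + 1) - coords w (i + 1) = t * (coords w' i - coords w i))"
  using dir_vec_of[of "coords w" "coords w'" t] coords(2) assms by simp

lemma lineL_eq_iff:
  assumes w: "w \<in> W" "w' \<in> W"
  shows "lineL w t = lineL w' t' \<longleftrightarrow> t = t' \<and> dir w w' t"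
proof -
  let ?p = "\<lambda>w t. restrict (\<lambda>i. if i = 1 then t else t * coords w (i - 1) - coords w i) {1..n+1}"
  let ?L = "\<forall>i\<le>n. ?p w t (i + 1) = ?p w' t' (i + 1)"
  let ?R = "t = t' \<and> (\<forall>i\<in>{1..n}. t * coords w i - coords w (i + 1) = t' * coords w' i - coords w' (i + 1))"
  have C: "?p w t \<in> coord_space n" for w t by (simp add: coord_space_def)
  have "lineL w t = lineL w' t' \<longleftrightarrow> (?L)"
    unfolding lineL_def sum.inject using coord_space_eqI[OF C C] by (metis (no_types, lifting))
  also have "\<dots> \<longleftrightarrow> ?R"
  proof
    assume eq: "?L"
    have "t * coords w i - coords w (i + 1) = t' * coords w' i - coords w' (i + 1)" if "i \<in> {1..n}" for i
      using eq[rule_format, of i] that by simp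
    moreover have "t = t'" using eq[rule_format, of 0] by simp
    ultimately show "?R"
      by blast
  next
    assume eq: "?R"
    show "?L"
    proof (intro allI impI)
      fix i assume "i \<le> n"
      thus "?p w t (i + 1) = ?p w' t' (i + 1)"
        using conjunct1[OF eq] conjunct2[OF eq, rule_format, of i] by (cases "i = 0") auto
    qed
  qed
  also have "\<dots> \<longleftrightarrow> t = t' \<and> dir w w' t"
    unfolding dir_coords[OF w] by (intro conj_cong refl ball_cong) (auto simp: algebra_simps)
  finally show ?thesis .
qed

lemma Lambda_adj:
  assumes w: "w \<in> W" "w' \<in> W" and p: "lineL w t = Inl p" and l: "ptL w' = Inr l"
  shows "(\<forall>i\<in>{1..n}. l (i + 1) + p (i + 1) = p 1 * l i) \<longleftrightarrow> dir w w' t"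
proof -
  have pp: "p 1 = t" "\<And>i. i \<in> {1..n} \<Longrightarrow> p (Suc i) = t * coords w i - coords w (Suc i)"
    using p by (auto simp: lineL_def)
  have ll: "l = coords w'" using l by (simp add: ptL_def)
  show ?thesis
    unfolding dir_coords[OF w] ll pp(1)
    by (intro ball_cong refl) (auto simp: pp(2) algebra_simps)
qed

lemma lineL_surj:
  assumes p: "p \<in> coord_space n"
  shows "\<exists>w\<in>W. \<exists>t. lineL w t = Inl p"
proof -
  \<comment> \<open>The first coordinate of a neighbour of \<open>p\<close> is free. Starting the
    recursion with 0 at the index 0 gives it the value \<open>- p 1\<close>, and the adjacency
    equations fix the others.\<close>
  define r where "r = rec_nat 0 (\<lambda>i x. p 1 * x - p (Suc i))"
  have r: "r (Suc i) = p 1 * r i - p (Suc i)" for i by (simp add: r_def)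
  define l' where "l' = restrict r {1..n+1}"
  have l: "l' \<in> coord_space n" by (simp add: coord_space_def l'_def)
  let ?q = "restrict (\<lambda>i. if i = 1 then p 1 else p 1 * coords (vec_of l') (i - 1) - coords (vec_of l') i) {1..n+1}"
  have "?q = p"
  proof (rule coord_space_eqI[OF _ p])
    show "?q \<in> coord_space n" by (simp add: coord_space_def)
    fix i assume "i \<le> n"
    thus "?q (i + 1) = p (i + 1)" unfolding coords(3)[OF l] by (auto simp: l'_def r)
  qed
  hence "lineL (vec_of l') (p 1) = Inl p" unfolding lineL_def by (rule arg_cong[where f = Inl])
  with coords(4)[OF l] show ?thesis by (intro bexI exI)
qed

lemma model_Lambda: "model (Lambda_graph n :: ((nat \<Rightarrow> 'a) + (nat \<Rightarrow> 'a)) sgraph) ptL lineL"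
  unfolding model_def
proof (intro conjI ballI allI)
  have ptL: "ptL ` W = Inr ` coord_space n"
  proof -
    have "coords ` W = coord_space n"
      using bij_betw_inv_into[OF bij_vec_of] by (simp add: coords_def bij_betw_def)
    moreover have "ptL ` W = Inr ` coords ` W" unfolding image_image by (rule image_cong) (simp_all add: ptL_def)
    ultimately show ?thesis by simp
  qed
  have lineL_C: "\<exists>p\<in>coord_space n. lineL w t = Inl p" for w t
    unfolding lineL_def coord_space_def by (rule bexI, rule refl) simp
  have lineL: "(\<lambda>(w, t). lineL w t) ` (W \<times> UNIV) = Inl ` coord_space n"
  proof (intro equalityI subsetI)
    fix x assume "x \<in> (\<lambda>(w, t). lineL w t) ` (W \<times> UNIV)"
    then obtain w t where "x = lineL w t" by auto
    thus "x \<in> Inl ` coord_space n" using lineL_C[of w t] by auto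
  next
    fix x :: "(nat \<Rightarrow> 'a) + (nat \<Rightarrow> 'a)" assume "x \<in> Inl ` coord_space n"
    then obtain p where p: "p \<in> coord_space n" "x = Inl p" by blast
    then obtain w t where "w \<in> W" "x = lineL w t" using lineL_surj[OF p(1)] unfolding p(2) by metis
    thus "x \<in> (\<lambda>(w, t). lineL w t) ` (W \<times> UNIV)" by (intro image_eqI[of _ _ "(w, t)"]) simp_all
  qed
  show "fst (Lambda_graph n) = ptL ` W \<union> (\<lambda>(w, t). lineL w t) ` (W \<times> UNIV)"
    unfolding ptL lineL Lambda_graph_def by auto
  show "inj_on ptL W"
  proof (rule inj_onI)
    fix w w' assume w: "w \<in> W" "w' \<in> W" "ptL w = ptL w'"
    hence "vec_of (coords w) = vec_of (coords w')" by (simp add: ptL_def)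
    thus "w = w'" by (simp only: coords(2)[OF w(1)] coords(2)[OF w(2)])
  qed
  show "snd (Lambda_graph n) = {{ptL w', lineL w t} | w w' t. w \<in> W \<and> w' \<in> W \<and> dir w w' t}" (is "_ = ?E")
  proof (intro equalityI subsetI)
    fix X :: "((nat \<Rightarrow> 'a) + (nat \<Rightarrow> 'a)) set" assume "X \<in> snd (Lambda_graph n)"
    then obtain p l where X: "X = {Inl p, Inr l}" "p \<in> coord_space n" "l \<in> coord_space n"
      and adj: "\<forall>i\<in>{1..n}. l (i + 1) + p (i + 1) = p 1 * l i"
      unfolding Lambda_graph_def snd_conv by blast
    obtain w t where w: "w \<in> W" "lineL w t = Inl p" using lineL_surj[OF X(2)] by blast
    have w': "vec_of l \<in> W" "ptL (vec_of l) = Inr l" using coords(3,4)[OF X(3)] by (simp_all add: ptL_def)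
    have "dir w (vec_of l) t" using Lambda_adj[OF w(1) w'(1) w(2) w'(2)] adj by blast
    moreover have "X = {ptL (vec_of l), lineL w t}" unfolding X(1) w(2) w'(2) by (rule insert_commute)
    ultimately show "X \<in> ?E"
      using w(1) w'(1) by blast
  next
    fix X assume "X \<in> ?E"
    then obtain w w' t where X: "X = {ptL w', lineL w t}" "w \<in> W" "w' \<in> W" "dir w w' t" by blast
    obtain p where p: "p \<in> coord_space n" "lineL w t = Inl p" using lineL_C by blast
    have l: "ptL w' = Inr (coords w')" "coords w' \<in> coord_space n"
      using coords(1)[OF X(3)] by (simp_all add: ptL_def)
    have "\<forall>i\<in>{1..n}. coords w' (i + 1) + p (i + 1) = p 1 * coords w' i"
      using Lambda_adj[OF X(2,3) p(2) l(1)] X(4) by blast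
    moreover have "X = {Inl p, Inr (coords w')}" unfolding X(1) p(2) l(1) by (rule insert_commute)
    ultimately show "X \<in> snd (Lambda_graph n)"
      using p(1) l(2) unfolding Lambda_graph_def snd_conv by blast
  qed
  show "lineL w t = lineL w' t' \<longleftrightarrow> t = t' \<and> dir w w' t" if "w \<in> W" "w' \<in> W" for w w' t t'
    by (rule lineL_eq_iff[OF that])
  show "ptL w \<noteq> lineL w' t" for w w' t by (simp add: ptL_def lineL_def)
qed

end

section \<open>Reparametrisation and the main theorem\<close>

text \<open>A normal rational curve has no distinguished point: substituting \<open>t = t0 + 1 / s\<close> and clearing
  denominators moves \<open>v t0\<close> to the point at infinity.\<close>

definition reparam :: "nat \<Rightarrow> 'a::field \<Rightarrow> nat \<Rightarrow> 'a poly" where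
  "reparam n t0 i = monom 1 (n - i) * [:1, t0:] ^ i"

lemma degree_reparam: "i \<le> n \<Longrightarrow> degree (reparam n t0 i) \<le> n"
proof -
  assume i: "i \<le> n"
  have "degree ([:1, t0:] ^ i) \<le> 1 * i"
    by (rule order.trans[OF degree_power_le]) (simp add: degree_pCons_le)
  moreover have "degree (reparam n t0 i) \<le> degree (monom (1::'a) (n - i)) + degree ([:1, t0:] ^ i)"
    unfolding reparam_def by (rule degree_mult_le)
  ultimately show ?thesis using i degree_monom_le[of "1::'a" "n - i"] by linarith
qed

lemma coeff_linear_power_top: "coeff ([:1, t:] ^ i) i = (t :: 'a::field) ^ i"
proof (induct i)
  case (Suc i)
  have "degree ([:1, t:] ^ i) \<le> 1 * i"
    by (rule order.trans[OF degree_power_le]) (simp add: degree_pCons_le)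
  hence "coeff ([:1, t:] ^ i) (Suc i) = 0" by (intro coeff_eq_0) simp
  thus ?case using Suc by simp
qed simp

lemma coeff_reparam_top: "i \<le> n \<Longrightarrow> coeff (reparam n t0 i) n = t0 ^ i"
  by (simp add: reparam_def coeff_monom_mult coeff_linear_power_top)

lemma poly_reparam:
  "i \<le> n \<Longrightarrow> s \<noteq> 0 \<Longrightarrow> poly (reparam n t0 i) s = s ^ n * (t0 + 1 / s) ^ i"
proof -
  assume i: "i \<le> n" and s: "s \<noteq> 0"
  have "poly (reparam n t0 i) s = s ^ (n - i) * (s * (t0 + 1 / s)) ^ i"
    using s by (simp add: reparam_def poly_monom ring_distribs mult.commute add.commute)
  also have "\<dots> = s ^ n * (t0 + 1 / s) ^ i"
    using i by (simp add: power_mult_distrib power_add[symmetric] mult.assoc[symmetric])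
  finally show ?thesis .
qed

lemma poly_reparam_0: "i \<le> n \<Longrightarrow> poly (reparam n t0 i) 0 = (if i = n then 1 else 0)"
  by (auto simp: reparam_def poly_monom)

lemma poly_eq_sum_upto:
  fixes p :: "'a::field poly"
  assumes "degree p \<le> n"
  shows "poly p x = (\<Sum>j=0..n. coeff p j * x ^ j)"
proof -
  have "poly p x = (\<Sum>j\<le>degree p. coeff p j * x ^ j)" by (simp add: poly_altdef)
  also have "\<dots> = (\<Sum>j=0..n. coeff p j * x ^ j)"
    using assms by (intro sum.mono_neutral_left) (auto simp: coeff_eq_0)
  finally show ?thesis .
qed

text \<open>The vector \<open>b' j\<close> collects the coefficients of \<open>s ^ j\<close> in the
  substituted curve. Its value at \<open>s = 0\<close> is \<open>b n\<close>, and its leading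
  coefficient \<open>b' n\<close> is \<open>v t0\<close>, which is now the omitted point at
  infinity. All \<open>v t\<close> are combinations of the \<open>n + 1\<close> new vectors, so
  these form a basis of \<open>W\<close>.\<close>

lemma (in moment_curve) reparametrisation:
  shows "\<exists>b'. moment_curve b' n e \<and> vec.span (b' ` {0..n}) = W \<and>
    range (\<lambda>s. vec.span {\<Sum>i=0..n. s ^ i *s b' i})
      = insert (vec.span {b n}) ((\<lambda>t. vec.span {v t}) ` (- {t0}))"
proof -
  define b' where "b' j = (\<Sum>i=0..n. coeff (reparam n t0 i) j *s b i)" for j
  let ?A = "range (\<lambda>s. vec.span {\<Sum>i=0..n. s ^ i *s b' i})"
  let ?B = "insert (vec.span {b n}) ((\<lambda>t. vec.span {v t}) ` (- {t0}))"
  have v': "(\<Sum>j=0..n. s ^ j *s b' j) = (\<Sum>i=0..n. poly (reparam n t0 i) s *s b i)" for s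
  proof -
    have "(\<Sum>j=0..n. s ^ j *s b' j) = (\<Sum>j=0..n. \<Sum>i=0..n. (coeff (reparam n t0 i) j * s ^ j) *s b i)"
      unfolding b'_def by (simp add: vec.scale_sum_right mult.commute)
    also have "\<dots> = (\<Sum>i=0..n. (\<Sum>j=0..n. coeff (reparam n t0 i) j * s ^ j) *s b i)"
      by (subst sum.swap) (simp add: vec.scale_sum_left)
    also have "\<dots> = (\<Sum>i=0..n. poly (reparam n t0 i) s *s b i)"
      by (intro sum.cong refl) (simp add: poly_eq_sum_upto[OF degree_reparam])
    finally show ?thesis .
  qed
  have v'_0: "(\<Sum>j=0..n. 0 ^ j *s b' j) = b n"
  proof -
    have "(\<Sum>j=0..n. 0 ^ j *s b' j) = (\<Sum>i=0..n. (if i = n then 1 else 0) *s b i)"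
      unfolding v' by (intro sum.cong refl) (simp add: poly_reparam_0)
    also have "\<dots> = (\<Sum>i=0..n. if i = n then b i else 0)" by (intro sum.cong) auto
    finally show ?thesis by simp
  qed
  have v'_s: "(\<Sum>j=0..n. s ^ j *s b' j) = s ^ n *s v (t0 + 1 / s)" if "s \<noteq> 0" for s
    unfolding v' v_def vec.scale_sum_right
    by (intro sum.cong refl) (simp add: poly_reparam[OF _ that])
  have b'_n: "b' n = v t0"
    unfolding b'_def v_def by (intro sum.cong refl) (simp add: coeff_reparam_top)
  have in_span: "(\<Sum>j=0..n. s ^ j *s b' j) \<in> vec.span (b' ` {0..n})" for s
    by (intro vec.span_sum vec.span_scale vec.span_base imageI)
  have "b' j \<in> W" for j
    unfolding b'_def W_def by (intro vec.span_sum vec.span_scale vec.span_base imageI)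
  hence sub: "b' ` {0..n} \<subseteq> W" by blast
  have "v t \<in> vec.span (b' ` {0..n})" for t
  proof (cases "t = t0")
    case True
    thus ?thesis unfolding True b'_n[symmetric] by (intro vec.span_base imageI) simp
  next
    case False
    define s where "s = 1 / (t - t0)"
    have s: "s \<noteq> 0" "t0 + 1 / s = t" using False by (auto simp: s_def)
    have "v t = inverse (s ^ n) *s (s ^ n *s v t)" using s by simp
    also have "s ^ n *s v t = (\<Sum>j=0..n. s ^ j *s b' j)" using v'_s[OF s(1)] s(2) by simp
    finally show ?thesis using vec.span_scale[OF in_span] by metis
  qed
  hence "vec.span (range v) \<subseteq> vec.span (b' ` {0..n})" by (intro vec.span_minimal) auto
  hence W_sub: "W \<subseteq> vec.span (b' ` {0..n})" by (simp add: span_range_v)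
  have span: "vec.span (b' ` {0..n}) = W"
    using W_sub vec.span_minimal[OF sub subspace_W] by blast
  have "n + 1 \<le> card (b' ` {0..n})"
    using vec.dim_le_card[OF W_sub] dim_W by simp
  moreover have "card (b' ` {0..n}) \<le> n + 1" using card_image_le[of "{0..n}" b'] by simp
  ultimately have card: "card (b' ` {0..n}) = n + 1" by simp
  have inj: "inj_on b' {0..n}" by (rule eq_card_imp_inj_on) (simp_all add: card)
  have "vec.independent (b' ` {0..n})"
    using vec.card_eq_dim[OF sub] card dim_W W_sub by simp
  hence mc: "moment_curve b' n e"
    using inj dim n2 nq e span by unfold_locales (simp_all add: W_def)
  have "?A = ?B"
  proof (intro equalityI subsetI)
    fix P assume "P \<in> ?A"
    then obtain s where P: "P = vec.span {\<Sum>i=0..n. s ^ i *s b' i}" by blast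
    show "P \<in> ?B"
    proof (cases "s = 0")
      case True
      thus ?thesis using P v'_0 by simp
    next
      case False
      have "vec.span {v (t0 + 1 / s)} = vec.span {s ^ n *s v (t0 + 1 / s)}"
        using span_single_eq_iff[of "v (t0 + 1 / s)" "s ^ n *s v (t0 + 1 / s)"] False by auto
      hence "P = vec.span {v (t0 + 1 / s)}" using P v'_s[OF False] by simp
      moreover have "t0 + 1 / s \<noteq> t0" using False by simp
      ultimately show ?thesis by blast
    qed
  next
    fix P assume "P \<in> ?B"
    then consider "P = vec.span {b n}" | t where "t \<noteq> t0" "P = vec.span {v t}" by blast
    thus "P \<in> ?A"
    proof cases
      case 1
      hence "P = vec.span {\<Sum>i=0..n. 0 ^ i *s b' i}" using v'_0 by simp
      thus ?thesis by blast
    next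
      case 2
      define s where "s = 1 / (t - t0)"
      have s: "s \<noteq> 0" "t0 + 1 / s = t" using 2 by (auto simp: s_def)
      have "vec.span {v t} = vec.span {s ^ n *s v t}"
        using span_single_eq_iff[of "v t" "s ^ n *s v t"] s by auto
      hence "P = vec.span {\<Sum>i=0..n. s ^ i *s b' i}" using 2 v'_s[OF s(1)] s(2) by simp
      thus ?thesis by blast
    qed
  qed
  with mc span show ?thesis by blast
qed

text \<open>\<open>K\<close> has one point less than the curve. If the point at infinity is missing,
  the given basis serves; otherwise some \<open>v t0\<close> is missing and is moved to
  infinity.\<close>

lemma arc_of_normal_rational_curve:
  fixes H K C :: "('a::{field,finite} ^ 'm::finite) set set"
  assumes q: "CARD('a) = q" and n: "2 \<le> n" and dim: "CARD('m) = n + 2"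
    and C: "is_normal_rational_curve n H C" and K: "K \<subseteq> C" "is_arc n H q K"
  shows "\<exists>b e. moment_curve b n e \<and> H = moment_curve.hyp b n \<and> K = moment_curve.arc b n"
proof -
  obtain b :: "nat \<Rightarrow> 'a^'m" where b: "inj_on b {0..n}" "vec.independent (b ` {0..n})"
    "H = pg_flat (vec.span (b ` {0..n}))"
    "C = insert (vec.span {b n}) {vec.span {\<Sum>i=0..n. t ^ i *s b i} | t. t \<in> UNIV}"
    using C unfolding is_normal_rational_curve_def by blast
  have arc: "finite K" "card K = q" "n + 1 \<le> q" using K(2) by (auto simp: is_arc_def)
  have dim_span: "vec.dim (vec.span (b ` {0..n})) = n + 1"
    using vec.dim_span_eq_card_independent[OF b(2)] card_image[OF b(1)] by simp
  have "vec.span (b ` {0..n}) \<noteq> (UNIV :: ('a^'m) set)"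
  proof
    assume "vec.span (b ` {0..n}) = (UNIV :: ('a^'m) set)"
    hence "vec.dim (UNIV :: ('a^'m) set) = n + 1" using dim_span by (simp only:)
    thus False using dim vec_dim_card[where 'a = 'a and 'n = 'm] by linarith
  qed
  then obtain e where e: "e \<notin> vec.span (b ` {0..n})" by blast
  interpret mc: moment_curve b n e
    using b e n dim q arc by unfold_locales auto
  let ?R = "range (\<lambda>t. vec.span {mc.v t})"
  have C': "C = insert (vec.span {b n}) ?R" unfolding b(4) mc.v_def by blast
  have H: "H = mc.hyp" using b(3) by (simp add: mc.hyp_def mc.W_def)
  have inj: "inj (\<lambda>t. vec.span {mc.v t})" using mc.arc_eq_iff by (simp add: inj_def)
  have card_R: "card ?R = q" using card_image[OF inj] q by simp
  show ?thesis
  proof (cases "K \<subseteq> ?R")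
    case True
    hence "K = ?R" using card_R arc by (intro card_seteq) auto
    thus ?thesis using H mc.moment_curve_axioms by (auto simp: mc.arc_def)
  next
    case False
    hence inf: "vec.span {b n} \<in> K" "vec.span {b n} \<notin> ?R" using K(1) C' by auto
    have "\<exists>t0. vec.span {mc.v t0} \<notin> K"
    proof (rule ccontr)
      assume "\<not> ?thesis"
      hence "insert (vec.span {b n}) ?R \<subseteq> K" using inf by auto
      hence "card (insert (vec.span {b n}) ?R) \<le> q" using arc card_mono by blast
      thus False using inf card_R by simp
    qed
    then obtain t0 where t0: "vec.span {mc.v t0} \<notin> K" by blast
    let ?K = "insert (vec.span {b n}) ((\<lambda>t. vec.span {mc.v t}) ` (- {t0}))"
    have "K \<subseteq> ?K" using K(1) C' t0 by auto
    moreover have "card ?K \<le> card K"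
    proof -
      have "card ((\<lambda>t. vec.span {mc.v t}) ` (- {t0})) = q - 1"
        using card_image[OF inj_on_subset[OF inj subset_UNIV, of "- {t0}"]] q
        by (simp add: Compl_eq_Diff_UNIV card_Diff_subset)
      thus ?thesis using arc by (simp add: card_insert_if)
    qed
    ultimately have K': "K = ?K" by (intro card_seteq) auto
    obtain b' where b': "moment_curve b' n e" "vec.span (b' ` {0..n}) = mc.W"
      "range (\<lambda>s. vec.span {\<Sum>i=0..n. s ^ i *s b' i}) = ?K"
      using mc.reparametrisation[of t0] by blast
    interpret mc': moment_curve b' n e by (rule b'(1))
    have "H = mc'.hyp" using H b'(2) by (simp add: mc.hyp_def mc'.hyp_def mc'.W_def)
    moreover have "K = mc'.arc" using K' b'(3) by (simp add: mc'.arc_def mc'.v_def)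
    ultimately show ?thesis using b'(1) by blast
  qed
qed

theorem corollary5p2:
  fixes H K C :: "('a::{field,finite} ^ 'm::finite) set set"
    and n q p h :: nat
  assumes "prime p" and "1 \<le> h" and "q = p ^ h" and "CARD('a) = q"
    and "2 \<le> n" and "CARD('m) = n + 2"
    and "H \<in> pg_flats n"
    and "is_normal_rational_curve n H C"
    and "K \<subseteq> C" and "is_arc n H q K"
  shows "edge_transitive_PGammaL_stab H K \<and>
    ((n + 3 \<le> q \<and> (3 \<le> n \<or> n = 2 \<and> odd q)) \<or> (q = p \<and> q = n + 2) \<or> (n = 2 \<and> q = 3) \<longrightarrow>
      graph_Aut (Lambda_graph n :: ((nat \<Rightarrow> 'a) + (nat \<Rightarrow> 'a)) sgraph) \<cong> PGammaL_stab K) \<and>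
    (n + 3 \<le> q \<and> (3 \<le> n \<or> n = 2 \<and> odd q) \<longrightarrow>
      Coset.order (graph_Aut (Lambda_graph n :: ((nat \<Rightarrow> 'a) + (nat \<Rightarrow> 'a)) sgraph))
        = h * q ^ (n + 2) * (q - 1)\<^sup>2) \<and>
    (q = p \<and> q = n + 2 \<longrightarrow>
      Coset.order (graph_Aut (Lambda_graph n :: ((nat \<Rightarrow> 'a) + (nat \<Rightarrow> 'a)) sgraph))
        = q ^ (n + 1) * (q - 1) * fact q)"
proof -
  let ?\<Lambda> = "Lambda_graph n :: ((nat \<Rightarrow> 'a) + (nat \<Rightarrow> 'a)) sgraph"
  let ?big = "n + 3 \<le> q \<and> (3 \<le> n \<or> n = 2 \<and> odd q)"
  obtain b e where mc: "moment_curve b n e" and H: "H = moment_curve.hyp b n" and K: "K = moment_curve.arc b n"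
    using arc_of_normal_rational_curve[OF assms(4-6,8-10)] by blast
  interpret mc: moment_curve b n e by (rule mc)
  have card_aut: "card {\<sigma> :: 'a \<Rightarrow> 'a. field_automorphism \<sigma>} = h"
    using card_field_automorphisms[OF assms(1) _ assms(2)] assms(3,4) by simp
  have h1: "h = 1" if "q = p"
  proof -
    have "p ^ h = p ^ 1" using that assms(3) by simp
    thus ?thesis using prime_gt_1_nat[OF assms(1)] power_inject_exp by blast
  qed
  have iso: "graph_Aut ?\<Lambda> \<cong> PGammaL_stab K"
    if cases: "?big \<or> (q = p \<and> q = n + 2) \<or> (n = 2 \<and> q = 3)"
  proof -
    \<comment> \<open>In the case \<open>q = n + 2\<close> the combination of \<open>n = 2\<close>
      with an even \<open>q\<close> would mean \<open>q = 4\<close>, which is not prime.\<close>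
    have odd: "3 \<le> n \<or> odd CARD('a)"
    proof (cases "q = p \<and> q = n + 2 \<and> n = 2")
      case True
      hence "prime (4 :: nat)" using True assms(1) by auto
      hence False using primes_dvd_imp_eq[of 2 "4 :: nat"] by simp
      thus ?thesis ..
    qed (use cases assms(4,5) in auto)
    have "prime CARD('a) \<and> (n + 2 \<le> CARD('a) \<or> CARD('a) = 3)" if "\<not> n + 3 \<le> CARD('a)"
      using cases that assms(1,4) by auto
    hence q: "n + 3 \<le> CARD('a) \<or> prime CARD('a) \<and> (n + 2 \<le> CARD('a) \<or> CARD('a) = 3)" by blast
    have "PGammaL_stab mc.arc \<cong> graph_Aut (Gamma_graph mc.hyp mc.arc)"
      using mc.VA_iso[OF odd q] unfolding is_iso_def by blast
    hence "graph_Aut (Gamma_graph mc.hyp mc.arc) \<cong> PGammaL_stab mc.arc"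
      by (rule group.iso_sym[OF mc.group_G])
    with mc.models_isomorphic[OF mc.model_Lambda mc.model_Gamma]
    show ?thesis unfolding K by (rule iso_trans)
  qed
  have order: "Coset.order (graph_Aut ?\<Lambda>) = q ^ (n + 1) * (q - 1) * card {(\<sigma>, \<pi>). mc.compatible \<sigma> \<pi>}"
    if "?big \<or> (q = p \<and> q = n + 2)"
  proof -
    have "card (carrier (graph_Aut ?\<Lambda>)) = card (carrier (PGammaL_stab mc.arc))"
      using iso that K unfolding is_iso_def iso_def by (auto dest: bij_betw_same_card)
    thus ?thesis using mc.card_stab mc.card_W that assms(4) by (auto simp: Coset.order_def)
  qed
  have "Coset.order (graph_Aut ?\<Lambda>) = h * q ^ (n + 2) * (q - 1)\<^sup>2" if ?big
  proof -
    have "card {(\<sigma>, \<pi>). mc.compatible \<sigma> \<pi>} = h * (q - 1) * q"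
      using mc.card_compatible_affine that card_aut assms(4) by simp
    thus ?thesis using order that by (simp add: power2_eq_square)
  qed
  moreover have "Coset.order (graph_Aut ?\<Lambda>) = q ^ (n + 1) * (q - 1) * fact q" if "q = p \<and> q = n + 2"
  proof -
    have "card {(\<sigma>, \<pi>). mc.compatible \<sigma> \<pi>} = h * fact q"
      using mc.card_compatible_permutation that card_aut assms(4) by simp
    thus ?thesis using order h1 that by simp
  qed
  moreover have "edge_transitive_PGammaL_stab H K" unfolding H K by (rule mc.edge_transitive)
  ultimately show ?thesis using iso by blast
qed

end
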